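(* Let $\mathcal{D}=(G,\chi,a,\alpha)$ be a datum and let $n>1$ be the order of $\chi(a)$. (Direct part) Let $\mathcal{H}=(H_{\mathcal{D}},\cdot,\mathbin{:})$ be a Hopf $q$-brace and assume that $x\cdot x\ne0$ and $x\mathbin{:}x\ne0$. Then $n=2$, $\mathcal{H}$ induces by restriction a $q$-brace structure on $G$ such that $a\cdot g=a\mathbin{:}g=a$ and $g\cdot a=g\mathbin{:}a=g$, for all $g\in G$, 1) $\chi^2=1$ (i.e. $\chi(g)^2=1$ for all $g\in G$), 2) $\chi(h)\chi(l\mathbin{:}h)=\chi(l)\chi(h\cdot l)$ for all $h,l\in G$, and there exists $\lambda_{10}\in\mathds{k}^{\times}$ such that, for all $h,g\in G$, $$(\ast)\qquad\begin{aligned}&hx\cdot g=\chi(g)(h\cdot g)x\quad\text{and}\quad hx\mathbin{:}g=\chi(g)(h\mathbin{:}g)x,\\&h\cdot gx=0\quad\text{and}\quad h\mathbin{:}gx=0,\\&hx\cdot gx=\lambda_{10}(h\cdot g)(1-a)\quad\text{and}\quad hx\mathbin{:}gx=-\lambda_{10}(h\mathbin{:}g)(1-a).\end{aligned}$$ (Converse) If $(G,\cdot,\mathbin{:})$ is a $q$-brace such that $a\cdot g=a\mathbin{:}g=a$ and $g\cdot a=g\mathbin{:}a=g$, for all $g\in G$, and conditions 1) and 2) are fulfilled, then, for each $\lambda_{10}\in\mathds{k}^{\times}$, the Hopf algebra $H_{\mathcal{D}}$ is a Hopf $q$-brace via the $q$-brace structure of $G$ and the formulas $(\ast)$.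
   Context: $\mathds{k}$ is an algebraically closed field of characteristic zero. Sweedler notation is used. Multiplication has precedence over the binary operations $\cdot$ and $\mathbin{:}$, which have precedence over $+$ and $-$. Rank one pointed Hopf algebras. A datum $\mathcal{D}=(G,\chi,a,\alpha)$ consists of a finite group $G$, a character $\chi\colon G\to\mathds{k}^{\times}$, a central element $a\in G$ and $\alpha\in\mathds{k}$ such that, denoting by $n$ the order of $\chi(a)$, one has $n>1$ and ($\alpha(a^n-1)=0$ in $\mathds{k}[G]$ or $\chi^n=1$). $H_{\mathcal{D}}$ is the Hopf algebra generated as an algebra by $G$ and $x$, subject to the group relations of $G$, $x^n=\alpha(a^n-1)$ and $xg=\chi(g)gx$ for $g\in G$, with $\Delta(x)=x\otimes a+1\otimes x$, $\Delta(g)=g\otimes g$ (so $\epsilon(g)=1$, $\epsilon(x)=0$). It has $\mathds{k}$-basis $\{gx^m: g\in G,\ 0\le m<n\}$. Hopf $q$-braces. Let $X$ be a coalgebra and $p,d\colon X\otimes X\to X$ linear maps with $\epsilon\circ p=\epsilon\circ d=\epsilon\otimes\epsilon$; write $x\cdot y=p(x\otimes y)$, $x\mathbin{:}y=d(x\otimes y)$. $(X,\cdot,\mathbin{:})$ is a $q$-magma coalgebra if the map $X\otimes X^{\mathrm{cop}}\to X^{\mathrm{cop}}\otimes X$, $x\otimes y\mapsto y_{(1)}\mathbin{:}x_{(2)}\otimes x_{(1)}\cdot y_{(2)}$, is a coalgebra morphism; equivalently, $p,d\colon X\otimes X^{\mathrm{cop}}\to X$ are coalgebra maps and $v_{(1)}\mathbin{:}u_{(2)}\otimes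 u_{(1)}\cdot v_{(2)}=v_{(2)}\mathbin{:}u_{(1)}\otimes u_{(2)}\cdot v_{(1)}$ for all $u,v\in X$. It is left regular if $x\otimes y\mapsto x\cdot y_{(1)}\otimes y_{(2)}$ is bijective on $X\otimes X$, right regular if $x\otimes y\mapsto x\mathbin{:}y_{(2)}\otimes y_{(1)}$ is bijective, and regular if it is both. A $q$-cycle coalgebra is a left regular $q$-magma coalgebra such that for all $u,v,w$: $(u\cdot v_{(1)})\cdot(w\mathbin{:}v_{(2)})=(u\cdot w_{(2)})\cdot(v\cdot w_{(1)})$, $(u\cdot v_{(1)})\mathbin{:}(w\cdot v_{(2)})=(u\mathbin{:}w_{(2)})\cdot(v\mathbin{:}w_{(1)})$, $(u\mathbin{:}v_{(1)})\mathbin{:}(w\mathbin{:}v_{(2)})=(u\mathbin{:}w_{(2)})\mathbin{:}(v\cdot w_{(1)})$. A Hopf $q$-brace is a Hopf algebra $H$ with a regular $q$-cycle coalgebra structure $(H,\cdot,\mathbin{:})$ such that $(H,\cdot)$ and $(H,\mathbin{:})$ are right $H^{\mathrm{op}}$-modules (i.e. $h\cdot 1=h$, $h\cdot kl=(h\cdot l)\cdot k$, and likewise for $\mathbin{:}$) and, for all $h,k,l\in H$, $hk\cdot l=(h\cdot(l_{(1)}\mathbin{:}k_{(2)}))(k_{(1)}\cdot l_{(2)})$ and $hk\mathbin{:}l=(h\mathbin{:}(l_{(1)}\cdot k_{(2)}))(k_{(1)}\mathbin{:}l_{(2)})$. A $q$-brace structure on a group $G$ is a pair of binary operations $\cdot,\mathbin{:}$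 on the set $G$ whose linear extensions make $\mathds{k}[G]$ a Hopf $q$-brace; i.e. $g\mapsto g\cdot h$ and $g\mapsto g\mathbin{:}h$ are bijective for each $h$ and the identities above hold for elements of $G$ with all Sweedler indices dropped. *)

theory Defs
  imports
    "HOL-Computational_Algebra.Polynomial"
    "HOL-Library.Function_Algebras"
    "HOL-Library.Poly_Mapping"
    "HOL-Algebra.Group"
begin

section \<open>Tensor products of vector spaces\<close>

definition bilinear_map ::
  "('k::field \<Rightarrow> 'u::ab_group_add \<Rightarrow> 'u) \<Rightarrow> ('k \<Rightarrow> 'v::ab_group_add \<Rightarrow> 'v) \<Rightarrow>
   ('k \<Rightarrow> 'w::ab_group_add \<Rightarrow> 'w) \<Rightarrow> ('u \<Rightarrow> 'v \<Rightarrow> 'w) \<Rightarrow> bool" where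
  "bilinear_map sU sV sW f \<longleftrightarrow>
     (\<forall>v. Vector_Spaces.linear sU sW (\<lambda>u. f u v)) \<and> (\<forall>u. Vector_Spaces.linear sV sW (f u))"

text \<open>
  The tensor product of two vector spaces over a field is realised inside the dual of the space of
  bilinear forms: the pure tensor of \<open>u\<close> and \<open>v\<close> is evaluation of bilinear forms at \<open>(u, v)\<close>
  (and, as a convention, \<open>0\<close> on functions that are not bilinear forms), and the tensor product is
  the span of the pure tensors.  It is a proper subspace of the type \<open>('u, 'v, 'k) tensor\<close>.
  Taking a whole type \<open>('u, 'v, 'k) tensor\<close> as a factor of a further tensor product is harmless:
  bilinear forms extend from subspaces, so the product of subspaces embeds into the product of the
  ambient spaces.
  The lemmas \<open>tensor_bilinear\<close> and \<open>tensor_lift_sum\<close> below give its universal property.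
\<close>

type_synonym ('u, 'v, 'k) tensor = "('u \<Rightarrow> 'v \<Rightarrow> 'k) \<Rightarrow> 'k"

definition tensor_scale :: "'k::field \<Rightarrow> ('u, 'v, 'k) tensor \<Rightarrow> ('u, 'v, 'k) tensor" where
  "tensor_scale c t = (\<lambda>\<beta>. c * t \<beta>)"

definition tensor ::
  "('k::field \<Rightarrow> 'u::ab_group_add \<Rightarrow> 'u) \<Rightarrow> ('k \<Rightarrow> 'v::ab_group_add \<Rightarrow> 'v) \<Rightarrow>
   'u \<Rightarrow> 'v \<Rightarrow> ('u, 'v, 'k) tensor" where
  "tensor sU sV u v = (\<lambda>\<beta>. if bilinear_map sU sV (*) \<beta> then \<beta> u v else 0)"

definition tensor_space ::
  "('k::field \<Rightarrow> 'u::ab_group_add \<Rightarrow> 'u) \<Rightarrow> ('k \<Rightarrow> 'v::ab_group_add \<Rightarrow> 'v) \<Rightarrow>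
   ('u, 'v, 'k) tensor set" where
  "tensor_space sU sV = module.span tensor_scale {tensor sU sV u v | u v. True}"

text \<open>
  The linear map on the tensor product induced by a bilinear map \<open>f\<close>; it sends a finite sum of
  pure tensors to the corresponding sum of values of \<open>f\<close>.
\<close>

definition tensor_lift ::
  "('k::field \<Rightarrow> 'u::ab_group_add \<Rightarrow> 'u) \<Rightarrow> ('k \<Rightarrow> 'v::ab_group_add \<Rightarrow> 'v) \<Rightarrow>
   ('u \<Rightarrow> 'v \<Rightarrow> 'w::ab_group_add) \<Rightarrow> ('u, 'v, 'k) tensor \<Rightarrow> 'w" where
  "tensor_lift sU sV f t =
     (THE w. \<exists>uvs. t = (\<Sum>(u, v)\<leftarrow>uvs. tensor sU sV u v) \<and> w = (\<Sum>(u, v)\<leftarrow>uvs. f u v))"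

lemma vector_space_tensor_scale: "vector_space tensor_scale"
  by unfold_locales (auto simp: tensor_scale_def fun_eq_iff algebra_simps)

lemma tensor_bilinear:
  fixes sU :: "'k::field \<Rightarrow> 'u::ab_group_add \<Rightarrow> 'u" and sV :: "'k \<Rightarrow> 'v::ab_group_add \<Rightarrow> 'v"
  assumes "vector_space sU" "vector_space sV"
  shows "bilinear_map sU sV tensor_scale (tensor sU sV)"
proof -
  interpret u: vector_space sU by fact
  interpret v: vector_space sV by fact
  interpret t: vector_space "tensor_scale :: _ \<Rightarrow> ('u, 'v, 'k) tensor \<Rightarrow> _"
    by (rule vector_space_tensor_scale)
  have "Vector_Spaces.linear sU tensor_scale (\<lambda>u. tensor sU sV u v)" for v
    by unfold_locales
      (auto simp: tensor_def tensor_scale_def fun_eq_iff bilinear_map_def Vector_Spaces.linear_def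
        module_hom_def module_hom_axioms_def)
  moreover have "Vector_Spaces.linear sV tensor_scale (tensor sU sV u)" for u
    by unfold_locales
      (auto simp: tensor_def tensor_scale_def fun_eq_iff bilinear_map_def Vector_Spaces.linear_def
        module_hom_def module_hom_axioms_def)
  ultimately show ?thesis by (simp add: bilinear_map_def)
qed

lemma linear_functionals_separate:
  fixes s :: "'k::field \<Rightarrow> 'w::ab_group_add \<Rightarrow> 'w"
  assumes "vector_space s"
    and eq: "\<And>\<phi>. Vector_Spaces.linear s ((*) :: 'k \<Rightarrow> 'k \<Rightarrow> 'k) \<phi> \<Longrightarrow> \<phi> x = \<phi> y"
  shows "x = y"
proof (rule ccontr)
  assume "x \<noteq> y"
  interpret vector_space s by fact
  interpret p: vector_space_pair s "(*) :: 'k \<Rightarrow> 'k \<Rightarrow> 'k"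
    by unfold_locales (auto simp: algebra_simps)
  have ind: "\<not> dependent {x - y}"
    using \<open>x \<noteq> y\<close> by simp
  define \<phi> where "\<phi> = p.construct {x - y} (\<lambda>_. 1)"
  have lin: "Vector_Spaces.linear s (*) \<phi>"
    unfolding \<phi>_def by (rule p.linear_construct[OF ind])
  have "\<phi> (x - y) = 1"
    unfolding \<phi>_def by (rule p.construct_basis[OF ind]) simp
  moreover have "\<phi> (x - y) = \<phi> x - \<phi> y"
    by (rule p.linear_diff[OF lin])
  ultimately show False using eq[OF lin] by simp
qed

lemma tensor_sum_apply:
  assumes "bilinear_map sU sV (*) \<beta>"
  shows "(\<Sum>(u, v)\<leftarrow>uvs. tensor sU sV u v) \<beta> = (\<Sum>(u, v)\<leftarrow>uvs. \<beta> u v)"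
  using assms by (induction uvs) (auto simp: tensor_def)

lemma bilinear_map_compose:
  assumes "bilinear_map sU sV sW f" "Vector_Spaces.linear sW sZ \<phi>"
  shows "bilinear_map sU sV sZ (\<lambda>u v. \<phi> (f u v))"
  using assms Vector_Spaces.linear_compose[of sU sW _ sZ \<phi>]
    Vector_Spaces.linear_compose[of sV sW _ sZ \<phi>]
  by (auto simp: bilinear_map_def o_def)

lemma tensor_lift_sum:
  assumes f: "bilinear_map sU sV sW f"
  shows "tensor_lift sU sV f (\<Sum>(u, v)\<leftarrow>uvs. tensor sU sV u v) = (\<Sum>(u, v)\<leftarrow>uvs. f u v)"
proof -
  have W: "vector_space sW"
    using f by (auto simp: bilinear_map_def Vector_Spaces.linear_def)
  have unique: "(\<Sum>(u, v)\<leftarrow>xs. f u v) = (\<Sum>(u, v)\<leftarrow>ys. f u v)"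
    if "(\<Sum>(u, v)\<leftarrow>xs. tensor sU sV u v) = (\<Sum>(u, v)\<leftarrow>ys. tensor sU sV u v)" for xs ys
  proof (rule linear_functionals_separate[OF W])
    fix \<phi> assume lin: "Vector_Spaces.linear sW (*) \<phi>"
    then interpret l: Vector_Spaces.linear sW "(*)" \<phi> .
    have sum: "\<phi> (\<Sum>(u, v)\<leftarrow>zs. f u v) = (\<Sum>(u, v)\<leftarrow>zs. \<phi> (f u v))" for zs
      by (induction zs) (auto simp: l.add)
    show "\<phi> (\<Sum>(u, v)\<leftarrow>xs. f u v) = \<phi> (\<Sum>(u, v)\<leftarrow>ys. f u v)"
      using arg_cong[OF that, of "\<lambda>t. t (\<lambda>u v. \<phi> (f u v))"]
      unfolding sum by (simp add: tensor_sum_apply[OF bilinear_map_compose[OF f lin]])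
  qed
  show ?thesis
    unfolding tensor_lift_def
  proof (rule the_equality)
    show "\<exists>xs. (\<Sum>(u, v)\<leftarrow>uvs. tensor sU sV u v) = (\<Sum>(u, v)\<leftarrow>xs. tensor sU sV u v) \<and>
            (\<Sum>(u, v)\<leftarrow>uvs. f u v) = (\<Sum>(u, v)\<leftarrow>xs. f u v)"
      by blast
  qed (metis unique)
qed


section \<open>Hopf algebras\<close>

text \<open>
  The underlying vector space is a whole type with scalar multiplication \<open>scale\<close>.
\<close>

locale coalgebra_data = vector_space scale
  for scale :: "'k::field \<Rightarrow> 'h::ab_group_add \<Rightarrow> 'h" +
  fixes \<Delta> :: "'h \<Rightarrow> ('h, 'h, 'k) tensor"
    and \<epsilon> :: "'h \<Rightarrow> 'k"
begin

abbreviation tens :: "'h \<Rightarrow> 'h \<Rightarrow> ('h, 'h, 'k) tensor"  (infixr "\<boxtimes>" 75) where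
  "u \<boxtimes> v \<equiv> tensor scale scale u v"

text \<open>
  Sweedler notation: \<open>sw h (\<lambda>h\<^sub>1 h\<^sub>2. E h\<^sub>1 h\<^sub>2)\<close> is the expression \<open>E\<close> in the two components of \<open>\<Delta> h\<close>.
\<close>
definition sw :: "'h \<Rightarrow> ('h \<Rightarrow> 'h \<Rightarrow> 'w::ab_group_add) \<Rightarrow> 'w" where
  "sw h f = tensor_lift scale scale f (\<Delta> h)"

end

locale coalgebra = coalgebra_data scale \<Delta> \<epsilon>
  for scale :: "'k::field \<Rightarrow> 'h::ab_group_add \<Rightarrow> 'h" and \<Delta> \<epsilon> +
  assumes comult_linear: "Vector_Spaces.linear scale tensor_scale \<Delta>"
    and comult_in_tensor_space: "\<Delta> h \<in> tensor_space scale scale"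
    and counit_linear: "Vector_Spaces.linear scale (*) \<epsilon>"
    and coassoc:
      "sw h (\<lambda>u v. sw u (\<lambda>u\<^sub>1 u\<^sub>2. tensor scale tensor_scale u\<^sub>1 (u\<^sub>2 \<boxtimes> v))) =
       sw h (\<lambda>u v. sw v (\<lambda>v\<^sub>1 v\<^sub>2. tensor scale tensor_scale u (v\<^sub>1 \<boxtimes> v\<^sub>2)))"
    and counit_left: "sw h (\<lambda>u v. scale (\<epsilon> u) v) = h"
    and counit_right: "sw h (\<lambda>u v. scale (\<epsilon> v) u) = h"

locale hopf_algebra = coalgebra scale \<Delta> \<epsilon>
  for scale :: "'k::field \<Rightarrow> 'h::ring_1 \<Rightarrow> 'h" and \<Delta> \<epsilon> +
  assumes scale_mult_left: "scale c u * v = scale c (u * v)"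
    and scale_mult_right: "u * scale c v = scale c (u * v)"
    and comult_one: "\<Delta> 1 = 1 \<boxtimes> 1"
    and comult_mult: "\<Delta> (u * v) = sw u (\<lambda>u\<^sub>1 u\<^sub>2. sw v (\<lambda>v\<^sub>1 v\<^sub>2. (u\<^sub>1 * v\<^sub>1) \<boxtimes> (u\<^sub>2 * v\<^sub>2)))"
    and counit_one: "\<epsilon> 1 = 1"
    and counit_mult: "\<epsilon> (u * v) = \<epsilon> u * \<epsilon> v"
    and antipode_exists:
      "\<exists>S. Vector_Spaces.linear scale scale S \<and>
           (\<forall>h. sw h (\<lambda>h\<^sub>1 h\<^sub>2. S h\<^sub>1 * h\<^sub>2) = scale (\<epsilon> h) 1 \<and>
                sw h (\<lambda>h\<^sub>1 h\<^sub>2. h\<^sub>1 * S h\<^sub>2) = scale (\<epsilon> h) 1)"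


section \<open>\<open>q\<close>-magma coalgebras, \<open>q\<close>-cycle coalgebras and Hopf \<open>q\<close>-braces\<close>

text \<open>
  The linear maps \<open>p\<close> and \<open>d\<close> on the tensor square are given as bilinear maps;
  \<open>p u v\<close> is \<open>u \<cdot> v\<close> and \<open>d u v\<close> is \<open>u : v\<close>.
\<close>

context coalgebra_data
begin

definition cop :: "'h \<Rightarrow> ('h, 'h, 'k) tensor" where
  "cop h = sw h (\<lambda>h\<^sub>1 h\<^sub>2. h\<^sub>2 \<boxtimes> h\<^sub>1)"

text \<open>
  Comultiplication of the tensor product of the coalgebras with comultiplications \<open>\<Delta>1\<close>, \<open>\<Delta>2\<close>
  on the same space: \<open>u \<boxtimes> v\<close> is sent to the tensor of \<open>u\<^sub>1 \<boxtimes> v\<^sub>1\<close> and \<open>u\<^sub>2 \<boxtimes> v\<^sub>2\<close>.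
\<close>
definition tensor_comult ::
  "('h \<Rightarrow> ('h, 'h, 'k) tensor) \<Rightarrow> ('h \<Rightarrow> ('h, 'h, 'k) tensor) \<Rightarrow> ('h, 'h, 'k) tensor \<Rightarrow>
   (('h, 'h, 'k) tensor, ('h, 'h, 'k) tensor, 'k) tensor" where
  "tensor_comult \<Delta>1 \<Delta>2 =
     tensor_lift scale scale (\<lambda>u v.
       tensor_lift scale scale (\<lambda>u\<^sub>1 u\<^sub>2.
         tensor_lift scale scale (\<lambda>v\<^sub>1 v\<^sub>2.
           tensor tensor_scale tensor_scale (u\<^sub>1 \<boxtimes> v\<^sub>1) (u\<^sub>2 \<boxtimes> v\<^sub>2)) (\<Delta>2 v)) (\<Delta>1 u))"

definition tensor_counit :: "('h, 'h, 'k) tensor \<Rightarrow> 'k" where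
  "tensor_counit = tensor_lift scale scale (\<lambda>u v. \<epsilon> u * \<epsilon> v)"

definition q_map :: "('h \<Rightarrow> 'h \<Rightarrow> 'h) \<Rightarrow> ('h \<Rightarrow> 'h \<Rightarrow> 'h) \<Rightarrow> 'h \<Rightarrow> 'h \<Rightarrow> ('h, 'h, 'k) tensor" where
  "q_map p d u v = sw u (\<lambda>u\<^sub>1 u\<^sub>2. sw v (\<lambda>v\<^sub>1 v\<^sub>2. d v\<^sub>1 u\<^sub>2 \<boxtimes> p u\<^sub>1 v\<^sub>2))"

text \<open>
  The last two clauses say that the linear map \<open>u \<boxtimes> v \<mapsto> q_map p d u v\<close> is a coalgebra morphism
  from \<open>X \<otimes> X\<^sup>c\<^sup>o\<^sup>p\<close> to \<open>X\<^sup>c\<^sup>o\<^sup>p \<otimes> X\<close>, written out on pure tensors: the comultiplication of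
  \<open>X \<otimes> X\<^sup>c\<^sup>o\<^sup>p\<close> sends \<open>u \<boxtimes> v\<close> to the tensor of \<open>u\<^sub>1 \<boxtimes> v\<^sub>2\<close> and \<open>u\<^sub>2 \<boxtimes> v\<^sub>1\<close>.
\<close>
definition q_magma_coalgebra :: "('h \<Rightarrow> 'h \<Rightarrow> 'h) \<Rightarrow> ('h \<Rightarrow> 'h \<Rightarrow> 'h) \<Rightarrow> bool" where
  "q_magma_coalgebra p d \<longleftrightarrow>
     coalgebra scale \<Delta> \<epsilon> \<and>
     bilinear_map scale scale scale p \<and> bilinear_map scale scale scale d \<and>
     (\<forall>u v. \<epsilon> (p u v) = \<epsilon> u * \<epsilon> v \<and> \<epsilon> (d u v) = \<epsilon> u * \<epsilon> v) \<and>
     (\<forall>u v. tensor_comult cop \<Delta> (q_map p d u v) =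
        sw u (\<lambda>u\<^sub>1 u\<^sub>2. sw v (\<lambda>v\<^sub>1 v\<^sub>2.
          tensor tensor_scale tensor_scale (q_map p d u\<^sub>1 v\<^sub>2) (q_map p d u\<^sub>2 v\<^sub>1)))) \<and>
     (\<forall>u v. tensor_counit (q_map p d u v) = \<epsilon> u * \<epsilon> v)"

definition left_regular :: "('h \<Rightarrow> 'h \<Rightarrow> 'h) \<Rightarrow> bool" where
  "left_regular p \<longleftrightarrow>
     bij_betw (tensor_lift scale scale (\<lambda>u v. sw v (\<lambda>v\<^sub>1 v\<^sub>2. p u v\<^sub>1 \<boxtimes> v\<^sub>2)))
       (tensor_space scale scale) (tensor_space scale scale)"

definition right_regular :: "('h \<Rightarrow> 'h \<Rightarrow> 'h) \<Rightarrow> bool" where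
  "right_regular d \<longleftrightarrow>
     bij_betw (tensor_lift scale scale (\<lambda>u v. sw v (\<lambda>v\<^sub>1 v\<^sub>2. d u v\<^sub>2 \<boxtimes> v\<^sub>1)))
       (tensor_space scale scale) (tensor_space scale scale)"

definition q_cycle_coalgebra :: "('h \<Rightarrow> 'h \<Rightarrow> 'h) \<Rightarrow> ('h \<Rightarrow> 'h \<Rightarrow> 'h) \<Rightarrow> bool" where
  "q_cycle_coalgebra p d \<longleftrightarrow>
     q_magma_coalgebra p d \<and> left_regular p \<and>
     (\<forall>u v w.
        sw v (\<lambda>v\<^sub>1 v\<^sub>2. p (p u v\<^sub>1) (d w v\<^sub>2)) = sw w (\<lambda>w\<^sub>1 w\<^sub>2. p (p u w\<^sub>2) (p v w\<^sub>1)) \<and>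
        sw v (\<lambda>v\<^sub>1 v\<^sub>2. d (p u v\<^sub>1) (p w v\<^sub>2)) = sw w (\<lambda>w\<^sub>1 w\<^sub>2. p (d u w\<^sub>2) (d v w\<^sub>1)) \<and>
        sw v (\<lambda>v\<^sub>1 v\<^sub>2. d (d u v\<^sub>1) (d w v\<^sub>2)) = sw w (\<lambda>w\<^sub>1 w\<^sub>2. d (d u w\<^sub>2) (p v w\<^sub>1)))"

end

locale hopf_q_brace = hopf_algebra scale \<Delta> \<epsilon>
  for scale :: "'k::field \<Rightarrow> 'h::ring_1 \<Rightarrow> 'h" and \<Delta> \<epsilon> +
  fixes p d :: "'h \<Rightarrow> 'h \<Rightarrow> 'h"
  assumes q_cycle: "q_cycle_coalgebra p d"
    and right_regular: "right_regular d"
    and p_one: "p h 1 = h"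
    and p_mult: "p h (k * l) = p (p h l) k"
    and d_one: "d h 1 = h"
    and d_mult: "d h (k * l) = d (d h l) k"
    and mult_p: "p (h * k) l = sw l (\<lambda>l\<^sub>1 l\<^sub>2. sw k (\<lambda>k\<^sub>1 k\<^sub>2. p h (d l\<^sub>1 k\<^sub>2) * p k\<^sub>1 l\<^sub>2))"
    and mult_d: "d (h * k) l = sw l (\<lambda>l\<^sub>1 l\<^sub>2. sw k (\<lambda>k\<^sub>1 k\<^sub>2. d h (p l\<^sub>1 k\<^sub>2) * d k\<^sub>1 l\<^sub>2))"

text \<open>
  A \<open>q\<close>-brace structure on a group: \<open>dot g h\<close> is \<open>g \<cdot> h\<close> and \<open>col g h\<close> is \<open>g : h\<close>.
\<close>
locale group_q_brace = group G for G (structure) +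
  fixes dot col :: "'g \<Rightarrow> 'g \<Rightarrow> 'g"
  assumes dot_bij: "h \<in> carrier G \<Longrightarrow> bij_betw (\<lambda>g. dot g h) (carrier G) (carrier G)"
    and col_bij: "h \<in> carrier G \<Longrightarrow> bij_betw (\<lambda>g. col g h) (carrier G) (carrier G)"
    and cycle1: "\<lbrakk>u \<in> carrier G; v \<in> carrier G; w \<in> carrier G\<rbrakk> \<Longrightarrow>
      dot (dot u v) (col w v) = dot (dot u w) (dot v w)"
    and cycle2: "\<lbrakk>u \<in> carrier G; v \<in> carrier G; w \<in> carrier G\<rbrakk> \<Longrightarrow>
      col (dot u v) (dot w v) = dot (col u w) (col v w)"
    and cycle3: "\<lbrakk>u \<in> carrier G; v \<in> carrier G; w \<in> carrier G\<rbrakk> \<Longrightarrow>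
      col (col u v) (col w v) = col (col u w) (dot v w)"
    and dot_one: "h \<in> carrier G \<Longrightarrow> dot h \<one> = h"
    and dot_mult: "\<lbrakk>h \<in> carrier G; k \<in> carrier G; l \<in> carrier G\<rbrakk> \<Longrightarrow>
      dot h (k \<otimes> l) = dot (dot h l) k"
    and col_one: "h \<in> carrier G \<Longrightarrow> col h \<one> = h"
    and col_mult: "\<lbrakk>h \<in> carrier G; k \<in> carrier G; l \<in> carrier G\<rbrakk> \<Longrightarrow>
      col h (k \<otimes> l) = col (col h l) k"
    and mult_dot: "\<lbrakk>h \<in> carrier G; k \<in> carrier G; l \<in> carrier G\<rbrakk> \<Longrightarrow>
      dot (h \<otimes> k) l = dot h (col l k) \<otimes> dot k l"
    and mult_col: "\<lbrakk>h \<in> carrier G; k \<in> carrier G; l \<in> carrier G\<rbrakk> \<Longrightarrow>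
      col (h \<otimes> k) l = col h (dot l k) \<otimes> col k l"


section \<open>Rank one pointed Hopf algebras\<close>

definition mult_order :: "'k::field \<Rightarrow> nat" where
  "mult_order c = (LEAST m. 0 < m \<and> c ^ m = 1)"

text \<open>
  In the last assumption, the condition on \<open>\<alpha>\<close> is \<open>\<alpha> (a\<^sup>n - 1) = 0\<close> in the group algebra, whose
  elements are written as finitely supported functions.
\<close>
locale rank_one_datum = group G
  for G (structure) and \<chi> :: "'g \<Rightarrow> 'k::field" and a :: 'g and \<alpha> :: 'k +
  assumes finite_carrier: "finite (carrier G)"
    and char_nonzero: "g \<in> carrier G \<Longrightarrow> \<chi> g \<noteq> 0"
    and char_mult: "\<lbrakk>g \<in> carrier G; h \<in> carrier G\<rbrakk> \<Longrightarrow> \<chi> (g \<otimes> h) = \<chi> g * \<chi> h"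
    and a_closed: "a \<in> carrier G"
    and a_central: "g \<in> carrier G \<Longrightarrow> a \<otimes> g = g \<otimes> a"
    and order_gt_1: "mult_order (\<chi> a) > 1"
    and datum_condition:
      "Poly_Mapping.single (a [^] mult_order (\<chi> a)) \<alpha> - Poly_Mapping.single \<one> \<alpha> = 0 \<or>
       (\<forall>g\<in>carrier G. \<chi> g ^ mult_order (\<chi> a) = 1)"

text \<open>
  The free algebra on \<open>G \<union> {x}\<close> consists of the finitely supported functions on words.
\<close>

datatype 'g hd_gen = Grp 'g | X

definition hd_words :: "('g, 'm) monoid_scheme \<Rightarrow> 'g hd_gen list set" where
  "hd_words G = lists (insert X (Grp ` carrier G))"

definition hd_free :: "('g, 'm) monoid_scheme \<Rightarrow> ('g hd_gen list \<Rightarrow>\<^sub>0 'k::field) set" where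
  "hd_free G = {f. Poly_Mapping.keys f \<subseteq> hd_words G}"

text \<open>
  The defining relations, multiplied by the word \<open>v\<close> on the left and the word \<open>w\<close> on the right.
\<close>
inductive_set hd_relators ::
  "('g, 'm) monoid_scheme \<Rightarrow> ('g \<Rightarrow> 'k::field) \<Rightarrow> 'g \<Rightarrow> 'k \<Rightarrow>
   'g hd_gen list \<Rightarrow> 'g hd_gen list \<Rightarrow> ('g hd_gen list \<Rightarrow>\<^sub>0 'k) set"
  for G (structure) and \<chi> a \<alpha> v w where
  group_mult: "\<lbrakk>g \<in> carrier G; h \<in> carrier G\<rbrakk> \<Longrightarrow>
    Poly_Mapping.single (v @ [Grp g, Grp h] @ w) 1 - Poly_Mapping.single (v @ [Grp (g \<otimes> h)] @ w) 1
      \<in> hd_relators G \<chi> a \<alpha> v w"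
| group_one:
    "Poly_Mapping.single (v @ [Grp \<one>] @ w) 1 - Poly_Mapping.single (v @ w) 1
      \<in> hd_relators G \<chi> a \<alpha> v w"
| x_power: "n = mult_order (\<chi> a) \<Longrightarrow>
    Poly_Mapping.single (v @ replicate n X @ w) 1 -
      (Poly_Mapping.single (v @ replicate n (Grp a) @ w) \<alpha> - Poly_Mapping.single (v @ w) \<alpha>)
      \<in> hd_relators G \<chi> a \<alpha> v w"
| x_commute: "g \<in> carrier G \<Longrightarrow>
    Poly_Mapping.single (v @ [X, Grp g] @ w) 1 - Poly_Mapping.single (v @ [Grp g, X] @ w) (\<chi> g)
      \<in> hd_relators G \<chi> a \<alpha> v w"

text \<open>The two-sided ideal of the free algebra generated by the relations.\<close>
definition hd_ideal ::
  "('g, 'm) monoid_scheme \<Rightarrow> ('g \<Rightarrow> 'k::field) \<Rightarrow> 'g \<Rightarrow> 'k \<Rightarrow> ('g hd_gen list \<Rightarrow>\<^sub>0 'k) set" where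
  "hd_ideal G \<chi> a \<alpha> =
     module.span (\<lambda>c. Poly_Mapping.map ((*) c))
       (\<Union>v\<in>hd_words G. \<Union>w\<in>hd_words G. hd_relators G \<chi> a \<alpha> v w)"

text \<open>The algebra map out of the free algebra given by the images of the generators.\<close>
definition hd_eval ::
  "('k::field \<Rightarrow> 'h::ring_1 \<Rightarrow> 'h) \<Rightarrow> ('g \<Rightarrow> 'h) \<Rightarrow> 'h \<Rightarrow> ('g hd_gen list \<Rightarrow>\<^sub>0 'k) \<Rightarrow> 'h" where
  "hd_eval scale \<iota> x f =
     (\<Sum>w\<in>Poly_Mapping.keys f.
        scale (Poly_Mapping.lookup f w)
          (prod_list (map (\<lambda>y. case y of Grp g \<Rightarrow> \<iota> g | X \<Rightarrow> x) w)))"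

text \<open>
  \<open>rank_one_hopf_algebra G \<chi> a \<alpha> scale \<Delta> \<epsilon> \<iota> x\<close> states that the Hopf algebra is the one attached to
  the datum \<open>(G, \<chi>, a, \<alpha>)\<close>, with \<open>\<iota>\<close> and \<open>x\<close> the images of the generators.  The assumptions
  \<open>generated\<close> and \<open>relations\<close> say that it is the quotient of the free algebra by the ideal
  generated by the relations.
\<close>
locale rank_one_hopf_algebra =
  rank_one_datum G \<chi> a \<alpha> + hopf_algebra scale \<Delta> \<epsilon>
  for G (structure) and \<chi> :: "'g \<Rightarrow> 'k::field" and a \<alpha>
    and scale :: "'k \<Rightarrow> 'h::ring_1 \<Rightarrow> 'h" and \<Delta> \<epsilon> +
  fixes \<iota> :: "'g \<Rightarrow> 'h" and x :: 'h
  assumes generated: "hd_eval scale \<iota> x ` hd_free G = UNIV"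
    and relations: "{f \<in> hd_free G. hd_eval scale \<iota> x f = 0} = hd_ideal G \<chi> a \<alpha>"
    and comult_x: "\<Delta> x = x \<boxtimes> \<iota> a + 1 \<boxtimes> x"
    and comult_group: "g \<in> carrier G \<Longrightarrow> \<Delta> (\<iota> g) = \<iota> g \<boxtimes> \<iota> g"

text \<open>
  \<open>p\<close> and \<open>d\<close> extend the operations \<open>dot\<close> and \<open>col\<close> of the group and are given on the other
  elements by the explicit formulas whose parameter \<open>\<lambda>\<^sub>1\<^sub>0\<close> is called \<open>\<mu>\<close>.
\<close>

definition restricts_to ::
  "('g, 'm) monoid_scheme \<Rightarrow> ('g \<Rightarrow> 'h) \<Rightarrow> ('h \<Rightarrow> 'h \<Rightarrow> 'h) \<Rightarrow> ('g \<Rightarrow> 'g \<Rightarrow> 'g) \<Rightarrow> bool" where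
  "restricts_to G \<iota> p dot \<longleftrightarrow> (\<forall>g\<in>carrier G. \<forall>h\<in>carrier G. p (\<iota> g) (\<iota> h) = \<iota> (dot g h))"

definition star_formulas ::
  "('g, 'm) monoid_scheme \<Rightarrow> ('g \<Rightarrow> 'k::field) \<Rightarrow> 'g \<Rightarrow> ('k \<Rightarrow> 'h::ring_1 \<Rightarrow> 'h) \<Rightarrow>
   ('g \<Rightarrow> 'h) \<Rightarrow> 'h \<Rightarrow> ('g \<Rightarrow> 'g \<Rightarrow> 'g) \<Rightarrow> ('g \<Rightarrow> 'g \<Rightarrow> 'g) \<Rightarrow> 'k \<Rightarrow>
   ('h \<Rightarrow> 'h \<Rightarrow> 'h) \<Rightarrow> ('h \<Rightarrow> 'h \<Rightarrow> 'h) \<Rightarrow> bool" where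
  "star_formulas G \<chi> a scale \<iota> x dot col \<mu> p d \<longleftrightarrow>
     (\<forall>h\<in>carrier G. \<forall>g\<in>carrier G.
        p (\<iota> h * x) (\<iota> g) = scale (\<chi> g) (\<iota> (dot h g) * x) \<and>
        d (\<iota> h * x) (\<iota> g) = scale (\<chi> g) (\<iota> (col h g) * x) \<and>
        p (\<iota> h) (\<iota> g * x) = 0 \<and>
        d (\<iota> h) (\<iota> g * x) = 0 \<and>
        p (\<iota> h * x) (\<iota> g * x) = scale \<mu> (\<iota> (dot h g) * (1 - \<iota> a)) \<and>
        d (\<iota> h * x) (\<iota> g * x) = - scale \<mu> (\<iota> (col h g) * (1 - \<iota> a)))"

text \<open>The conditions on the group-level operations common to both parts of the theorem.\<close>
definition admissible_q_brace ::
  "('g, 'm) monoid_scheme \<Rightarrow> ('g \<Rightarrow> 'k::field) \<Rightarrow> 'g \<Rightarrow>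
   ('g \<Rightarrow> 'g \<Rightarrow> 'g) \<Rightarrow> ('g \<Rightarrow> 'g \<Rightarrow> 'g) \<Rightarrow> bool" where
  "admissible_q_brace G \<chi> a dot col \<longleftrightarrow>
     group_q_brace G dot col \<and>
     (\<forall>g\<in>carrier G. dot a g = a \<and> col a g = a \<and> dot g a = g \<and> col g a = g) \<and>
     (\<forall>g\<in>carrier G. (\<chi> g)\<^sup>2 = 1) \<and>
     (\<forall>h\<in>carrier G. \<forall>l\<in>carrier G. \<chi> h * \<chi> (col l h) = \<chi> l * \<chi> (dot h l))"

end

theory Submission
  imports Defs "HOL-Algebra.Multiplicative_Group"
begin

text \<open>
  The operations of a Hopf \<open>q\<close>-brace are coalgebra maps \<open>H \<otimes> H\<^sup>c\<^sup>o\<^sup>p \<rightarrow> H\<close>.  They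
  therefore send pairs of grouplike elements to grouplike elements, and since \<open>x\<close> is skew
  primitive, values such as \<open>x \<cdot> g\<close> and \<open>x \<cdot> x\<close> are skew primitive too.  In \<open>H\<close> there are few
  such elements: the grouplikes are the elements of \<open>G\<close>, and the skew primitives for \<open>(b, 1)\<close> are
  spanned by \<open>1 - b\<close>, together with \<open>x\<close> if \<open>b = a\<close> (\<open>grouplike_cases\<close>,
  \<open>skew_primitive_cases\<close>).  Both facts come from one operator on \<open>H\<close>, a skew derivative with
  respect to \<open>x\<close>, which lowers the degree in the basis \<open>g x\<^sup>m\<close> and whose kernel is the group
  algebra because the \<open>q\<close>-numbers of \<open>q = \<chi>(a)\<close> below the order of \<open>q\<close> do not vanish.

  For the direct part this leaves \<open>1 \<cdot> x = 0\<close>, \<open>x \<cdot> g = c(g) x + e(g) (1 - a)\<close> and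
  \<open>x \<cdot> x = \<xi> x + e (1 - a)\<close> with unknown scalars.  The relation \<open>x g = \<chi>(g) g x\<close>, used with
  \<open>g = a\<close> and \<open>\<chi>(a) \<noteq> 1\<close>, gives \<open>e(g) = 0\<close> and \<open>\<xi> = 0\<close>; as \<open>x \<cdot> x \<noteq> 0\<close>, now \<open>e \<noteq> 0\<close>, and
  the same relation yields \<open>c = \<chi>\<close>.  The compatibility
  \<open>v\<^sub>1 : u\<^sub>2 \<otimes> u\<^sub>1 \<cdot> v\<^sub>2 = v\<^sub>2 : u\<^sub>1 \<otimes> u\<^sub>2 \<cdot> v\<^sub>1\<close> at \<open>u = v = x\<close> compares
  \<open>\<chi>(a)\<^sup>2 x \<otimes> x\<close> with \<open>x \<otimes> x\<close>, whence \<open>n = 2\<close>, and shows that the parameters of \<open>x \<cdot> x\<close> and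
  \<open>x : x\<close> are opposite (\<open>opposite_parameters\<close>).  Condition 1) is the first cycle identity at
  \<open>x, g, x\<close>, and condition 2) results from expanding \<open>x g \<cdot> l\<close> in two ways.  The argument is
  symmetric in the two operations, which \<open>rank_one_operations.swapped\<close> makes available.

  For the converse, \<open>\<chi>(a)\<^sup>2 = 1 \<noteq> \<chi>(a)\<close> forces \<open>n = 2\<close>, so that \<open>H\<close> has the basis \<open>g, g x\<close>.
  Every axiom is an equation between multilinear expressions, hence need only hold on this basis;
  there each Sweedler sum has one or two terms, and the equation reduces to the identities of the
  \<open>q\<close>-brace \<open>G\<close>, the conditions 1) and 2), and \<open>\<chi>(a) = - 1\<close>.  Regularity follows from the module
  axioms, the antipode and its inverse providing the inverse maps.

  Equations in tensor squares are handled in two ways.  Tensors are functions on bilinear forms,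
  so they may be evaluated at products \<open>\<psi> \<otimes> \<omega>\<close> of linear forms, which is how information is
  extracted from the axioms; and a Sweedler sum of a bilinear map is an ordinary finite sum over a
  presentation of the coproduct, which is how linearity is established.
\<close>


section \<open>Linear maps, bilinear maps and sums of pure tensors\<close>

lemma linearI:
  assumes "vector_space s" "vector_space t"
    and "\<And>x y. f (x + y) = f x + f y" "\<And>c x. f (s c x) = t c (f x)"
  shows "Vector_Spaces.linear s t f"
  using assms by (simp add: Vector_Spaces.linear_iff)

lemma linear_vector_spaces:
  assumes "Vector_Spaces.linear s t f"
  shows "vector_space s" "vector_space t"
  using assms by (simp_all add: Vector_Spaces.linear_iff)

lemma linear_simps:
  assumes "Vector_Spaces.linear s t f"
  shows "f (x + y) = f x + f y" "f (s c x) = t c (f x)" "f (x - y) = f x - f y"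
    "f (- x) = - f x" "f 0 = 0"
proof -
  interpret Vector_Spaces.linear s t f by fact
  show "f (x + y) = f x + f y" "f (s c x) = t c (f x)" "f (x - y) = f x - f y"
    "f (- x) = - f x" "f 0 = 0"
    by (simp_all add: add scale diff neg)
qed

lemma lin_sum: "Vector_Spaces.linear s t f \<Longrightarrow> f (sum g A) = (\<Sum>i\<in>A. f (g i))"
  by (induction A rule: infinite_finite_induct) (simp_all add: linear_simps)

lemma lin_sum_list_pairs:
  "Vector_Spaces.linear s t \<phi> \<Longrightarrow>
    \<phi> (\<Sum>(u, v)\<leftarrow>uvs. f u v) = (\<Sum>(u, v)\<leftarrow>uvs. \<phi> (f u v))"
  by (induction uvs) (auto simp: linear_simps)

lemma lin_ident: "vector_space s \<Longrightarrow> Vector_Spaces.linear s s (\<lambda>x. x)"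
  by (rule linearI) auto

lemma lin_zero: "vector_space s \<Longrightarrow> vector_space t \<Longrightarrow> Vector_Spaces.linear s t (\<lambda>x. 0)"
  by (rule linearI) (auto simp: module.scale_zero_right module_iff_vector_space)

lemma lin_add:
  assumes f: "Vector_Spaces.linear s t f" and g: "Vector_Spaces.linear s t g"
  shows "Vector_Spaces.linear s t (\<lambda>x. f x + g x)"
proof -
  interpret t: vector_space t using f by (rule linear_vector_spaces)
  show ?thesis
    by (rule linearI)
      (simp_all add: linear_simps[OF f] linear_simps[OF g] linear_vector_spaces[OF f]
        t.scale_right_distrib add_ac)
qed

lemma lin_comp:
  assumes "Vector_Spaces.linear t r \<phi>" "Vector_Spaces.linear s t f"
  shows "Vector_Spaces.linear s r (\<lambda>x. \<phi> (f x))"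
  using assms by (intro linearI) (auto simp: linear_simps linear_vector_spaces)

lemma lin_scale:
  assumes "Vector_Spaces.linear s t f"
  shows "Vector_Spaces.linear s t (\<lambda>x. t c (f x))"
proof -
  interpret t: vector_space t using assms by (rule linear_vector_spaces)
  show ?thesis
    using assms
    by (intro linearI)
      (auto simp: linear_simps linear_vector_spaces t.scale_right_distrib mult.commute)
qed

lemma lin_scale_of_form:
  assumes "Vector_Spaces.linear s (*) f" "vector_space t"
  shows "Vector_Spaces.linear s t (\<lambda>x. t (f x) c)"
proof -
  interpret t: vector_space t by fact
  show ?thesis
    using assms
    by (intro linearI) (auto simp: linear_simps linear_vector_spaces t.scale_left_distrib)
qed

lemma lin_sum_list_family:
  assumes "vector_space s" "vector_space t" "\<And>a b. Vector_Spaces.linear s t (\<lambda>u. f u a b)"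
  shows "Vector_Spaces.linear s t (\<lambda>u. \<Sum>(a, b)\<leftarrow>L. f u a b)"
  by (induction L) (use assms in \<open>auto intro: lin_zero lin_add\<close>)

lemma bilinear_mapI:
  assumes "\<And>v. Vector_Spaces.linear sU sW (\<lambda>u. f u v)"
    and "\<And>u. Vector_Spaces.linear sV sW (\<lambda>v. f u v)"
  shows "bilinear_map sU sV sW f"
  using assms by (simp add: bilinear_map_def)

lemma bilinear_map_linear:
  assumes "bilinear_map sU sV sW f"
  shows "Vector_Spaces.linear sU sW (\<lambda>u. f u v)" "Vector_Spaces.linear sV sW (\<lambda>v. f u v)"
  using assms by (simp_all add: bilinear_map_def)

lemma bilinear_map_vector_spaces:
  assumes "bilinear_map sU sV sW f"
  shows "vector_space sU" "vector_space sV" "vector_space sW"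
  using bilinear_map_linear[OF assms, THEN linear_vector_spaces(1)]
    bilinear_map_linear(1)[OF assms, THEN linear_vector_spaces(2)] by simp_all

lemma linear_bilinear_left:
  "bilinear_map sU sV sW f \<Longrightarrow> Vector_Spaces.linear s sU F \<Longrightarrow>
    Vector_Spaces.linear s sW (\<lambda>u. f (F u) c)"
  using lin_comp[of sU sW "\<lambda>u. f u c" s F] by (auto simp: bilinear_map_def)

lemma linear_bilinear_right:
  "bilinear_map sU sV sW f \<Longrightarrow> Vector_Spaces.linear s sV F \<Longrightarrow>
    Vector_Spaces.linear s sW (\<lambda>u. f c (F u))"
  using lin_comp[of sV sW "f c" s F] by (auto simp: bilinear_map_def)

text \<open>
  Scalars can be absorbed into the first factors, so every element of the tensor product is a plain
  finite sum of pure tensors; this is the form on which \<^const>\<open>tensor_lift\<close> is computed.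
\<close>
lemma tensor_space_sum_list:
  fixes sU :: "'k::field \<Rightarrow> 'u::ab_group_add \<Rightarrow> 'u" and sV :: "'k \<Rightarrow> 'v::ab_group_add \<Rightarrow> 'v"
  assumes "vector_space sU" "vector_space sV" "t \<in> tensor_space sU sV"
  shows "\<exists>uvs. t = (\<Sum>(u, v)\<leftarrow>uvs. tensor sU sV u v)"
proof -
  interpret T: vector_space "tensor_scale :: _ \<Rightarrow> ('u, 'v, 'k) tensor \<Rightarrow> _"
    by (rule vector_space_tensor_scale)
  note bil = bilinear_map_linear[OF tensor_bilinear[OF assms(1,2)]]
  show ?thesis
    using assms(3) unfolding tensor_space_def
  proof (induction rule: T.span_induct_alt)
    case base
    show ?case by (rule exI[of _ "[]"]) simp
  next
    case (step c t t')
    then obtain u v uvs where "t = tensor sU sV u v" "t' = (\<Sum>(u, v)\<leftarrow>uvs. tensor sU sV u v)"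
      by blast
    then show ?case
      by (intro exI[of _ "(sU c u, v) # uvs"]) (simp add: linear_simps(2)[OF bil(1)])
  qed
qed

lemma tensor_in_tensor_space:
  fixes sU :: "'k::field \<Rightarrow> 'u::ab_group_add \<Rightarrow> 'u" and sV :: "'k \<Rightarrow> 'v::ab_group_add \<Rightarrow> 'v"
  shows "tensor sU sV u v \<in> tensor_space sU sV"
proof -
  interpret T: vector_space "tensor_scale :: _ \<Rightarrow> ('u, 'v, 'k) tensor \<Rightarrow> _"
    by (rule vector_space_tensor_scale)
  show ?thesis
    unfolding tensor_space_def by (rule T.span_base) blast
qed

lemma tensor_space_closed:
  fixes sU :: "'k::field \<Rightarrow> 'u::ab_group_add \<Rightarrow> 'u" and sV :: "'k \<Rightarrow> 'v::ab_group_add \<Rightarrow> 'v"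
  shows "0 \<in> tensor_space sU sV"
    and "s \<in> tensor_space sU sV \<Longrightarrow> t \<in> tensor_space sU sV \<Longrightarrow> s + t \<in> tensor_space sU sV"
    and "t \<in> tensor_space sU sV \<Longrightarrow> tensor_scale c t \<in> tensor_space sU sV"
proof -
  interpret T: vector_space "tensor_scale :: _ \<Rightarrow> ('u, 'v, 'k) tensor \<Rightarrow> _"
    by (rule vector_space_tensor_scale)
  show "0 \<in> tensor_space sU sV"
    and "s \<in> tensor_space sU sV \<Longrightarrow> t \<in> tensor_space sU sV \<Longrightarrow> s + t \<in> tensor_space sU sV"
    and "t \<in> tensor_space sU sV \<Longrightarrow> tensor_scale c t \<in> tensor_space sU sV"
    unfolding tensor_space_def by (rule T.span_zero T.span_add T.span_scale; assumption)+
qed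

lemma tensor_space_sum_list_closed:
  "(\<And>a b. f a b \<in> tensor_space sU sV) \<Longrightarrow> (\<Sum>(a, b)\<leftarrow>L. f a b) \<in> tensor_space sU sV"
  by (induction L) (auto simp: tensor_space_closed)

lemma tensor_lift_tensor: "bilinear_map sU sV sW f \<Longrightarrow> tensor_lift sU sV f (tensor sU sV u v) = f u v"
  using tensor_lift_sum[of sU sV sW f "[(u, v)]"] by simp

lemma tensor_lift_add:
  assumes f: "bilinear_map sU sV sW f" and "s \<in> tensor_space sU sV" "t \<in> tensor_space sU sV"
  shows "tensor_lift sU sV f (s + t) = tensor_lift sU sV f s + tensor_lift sU sV f t"
proof -
  note V = bilinear_map_vector_spaces[OF f]
  obtain xs ys where xs: "s = (\<Sum>(u, v)\<leftarrow>xs. tensor sU sV u v)"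
    and ys: "t = (\<Sum>(u, v)\<leftarrow>ys. tensor sU sV u v)"
    using tensor_space_sum_list[OF V(1,2)] assms by meson
  have "s + t = (\<Sum>(u, v)\<leftarrow>xs @ ys. tensor sU sV u v)"
    by (simp add: xs ys)
  then show ?thesis
    by (simp only: tensor_lift_sum[OF f] xs ys) simp
qed

lemma tensor_lift_scale:
  fixes sU :: "'k::field \<Rightarrow> 'u::ab_group_add \<Rightarrow> 'u" and sV :: "'k \<Rightarrow> 'v::ab_group_add \<Rightarrow> 'v"
  assumes f: "bilinear_map sU sV sW f" and "t \<in> tensor_space sU sV"
  shows "tensor_lift sU sV f (tensor_scale c t) = sW c (tensor_lift sU sV f t)"
proof -
  note V = bilinear_map_vector_spaces[OF f]
  interpret W: vector_space sW by (rule V)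
  interpret T: vector_space "tensor_scale :: _ \<Rightarrow> ('u, 'v, 'k) tensor \<Rightarrow> _"
    by (rule vector_space_tensor_scale)
  note bil = bilinear_map_linear[OF tensor_bilinear[OF V(1,2)]] and fbil = bilinear_map_linear[OF f]
  obtain xs where xs: "t = (\<Sum>(u, v)\<leftarrow>xs. tensor sU sV u v)"
    using tensor_space_sum_list[OF V(1,2)] assms by meson
  have "tensor_scale c t = (\<Sum>(u, v)\<leftarrow>map (\<lambda>(u, v). (sU c u, v)) xs. tensor sU sV u v)"
    unfolding xs
    by (induction xs)
      (auto simp: linear_simps(2)[OF bil(1)] T.scale_right_distrib simp del: plus_fun_apply zero_fun_apply)
  moreover have "(\<Sum>(u, v)\<leftarrow>map (\<lambda>(u, v). (sU c u, v)) xs. f u v) = sW c (\<Sum>(u, v)\<leftarrow>xs. f u v)"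
    by (induction xs) (auto simp: linear_simps(2)[OF fbil(1)] W.scale_right_distrib)
  ultimately show ?thesis
    by (simp only: tensor_lift_sum[OF f] xs)
qed

lemma tensor_lift_zero: "bilinear_map sU sV sW f \<Longrightarrow> tensor_lift sU sV f 0 = 0"
  using tensor_lift_sum[of sU sV sW f "[]"] by simp

lemma tensor_lift_sum_list:
  assumes f: "bilinear_map sU sV sW f" and g: "\<And>a b. g a b \<in> tensor_space sU sV"
  shows "tensor_lift sU sV f (\<Sum>(a, b)\<leftarrow>L. g a b) = (\<Sum>(a, b)\<leftarrow>L. tensor_lift sU sV f (g a b))"
  by (induction L)
    (auto simp: tensor_lift_zero[OF f] tensor_lift_add[OF f] g tensor_space_sum_list_closed
      simp del: plus_fun_apply zero_fun_apply)


section \<open>Calculus of Sweedler sums\<close>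

context coalgebra
begin

lemma tens_bilinear: "bilinear_map scale scale tensor_scale tens"
  by (rule tensor_bilinear) (rule vector_space_axioms)+

text \<open>
  Any presentation of the coproduct as a sum of pure tensors computes all Sweedler sums, by the
  universal property of the tensor product; fixing one makes them finite sums over a list.
\<close>
definition comult_list :: "'h \<Rightarrow> ('h \<times> 'h) list" where
  "comult_list h = (SOME uvs. \<Delta> h = (\<Sum>(u, v)\<leftarrow>uvs. u \<boxtimes> v))"

lemma comult_list: "\<Delta> h = (\<Sum>(u, v)\<leftarrow>comult_list h. u \<boxtimes> v)"
  unfolding comult_list_def
  by (rule someI_ex)
    (rule tensor_space_sum_list[OF vector_space_axioms vector_space_axioms comult_in_tensor_space])

lemma sw_eq_sum_list:
  "bilinear_map scale scale s f \<Longrightarrow> sw h f = (\<Sum>(u, v)\<leftarrow>comult_list h. f u v)"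
  unfolding sw_def by (subst comult_list) (rule tensor_lift_sum)

lemma linear_sw_arg:
  assumes f: "bilinear_map scale scale s f"
  shows "Vector_Spaces.linear scale s (\<lambda>h. sw h f)"
  unfolding sw_def
  by (rule linearI)
    (simp_all add: vector_space_axioms bilinear_map_vector_spaces[OF f] linear_simps[OF comult_linear]
      tensor_lift_add[OF f] tensor_lift_scale[OF f] comult_in_tensor_space)

lemma linear_sw:
  assumes "bilinear_map scale scale s f" "Vector_Spaces.linear r scale F"
  shows "Vector_Spaces.linear r s (\<lambda>h. sw (F h) f)"
  by (rule lin_comp[OF linear_sw_arg]) fact+

lemma linear_sw_fun:
  assumes "\<And>u. bilinear_map scale scale s (f u)" "\<And>a b. Vector_Spaces.linear r s (\<lambda>u. f u a b)"
  shows "Vector_Spaces.linear r s (\<lambda>u. sw h (f u))"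
  using linear_vector_spaces[OF assms(2)]
  by (simp add: sw_eq_sum_list[OF assms(1)] lin_sum_list_family assms(2))

lemma linear_of_sw:
  assumes "bilinear_map scale scale s f" "Vector_Spaces.linear s t \<phi>"
  shows "\<phi> (sw h f) = sw h (\<lambda>u v. \<phi> (f u v))"
  by (simp add: sw_eq_sum_list[OF assms(1)] sw_eq_sum_list[OF bilinear_map_compose[OF assms]]
      lin_sum_list_pairs[OF assms(2)])

lemma sw_in_tensor_space:
  assumes "bilinear_map scale scale tensor_scale f" "\<And>a b. f a b \<in> tensor_space sU sV"
  shows "sw h f \<in> tensor_space sU sV"
  by (simp add: sw_eq_sum_list[OF assms(1)] tensor_space_sum_list_closed assms(2))

lemma tensor_lift_sw:
  assumes "bilinear_map sU sV sW f" "bilinear_map scale scale tensor_scale g"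
    and "\<And>a b. g a b \<in> tensor_space sU sV"
    and "bilinear_map scale scale sW (\<lambda>a b. tensor_lift sU sV f (g a b))"
  shows "tensor_lift sU sV f (sw h g) = sw h (\<lambda>a b. tensor_lift sU sV f (g a b))"
  by (simp add: sw_eq_sum_list[OF assms(2)] sw_eq_sum_list[OF assms(4)]
      tensor_lift_sum_list[OF assms(1,3)])

lemma sw_flip:
  assumes "bilinear_map scale scale s f"
  shows "tensor_lift scale scale f (cop h) = sw h (\<lambda>a b. f b a)"
proof -
  have bil: "bilinear_map scale scale tensor_scale (\<lambda>a b. b \<boxtimes> a)"
    using tens_bilinear by (simp add: bilinear_map_def)
  have f: "bilinear_map scale scale s (\<lambda>a b. f b a)"
    using assms by (simp add: bilinear_map_def)
  show ?thesis
    unfolding cop_def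
    by (subst tensor_lift_sw[OF assms bil])
      (simp_all add: tensor_in_tensor_space tensor_lift_tensor[OF assms] f)
qed

lemma sw_counit_left:
  assumes "Vector_Spaces.linear scale s F"
  shows "sw h (\<lambda>u v. s (\<epsilon> u) (F v)) = F h"
proof -
  have "bilinear_map scale scale scale (\<lambda>u v. scale (\<epsilon> u) v)"
    by (intro bilinear_mapI lin_scale lin_scale_of_form lin_ident counit_linear
        vector_space_axioms)
  from linear_of_sw[OF this assms, of h, unfolded counit_left linear_simps(2)[OF assms], symmetric]
  show ?thesis .
qed

lemma sw_counit_right:
  assumes "Vector_Spaces.linear scale s F"
  shows "sw h (\<lambda>u v. s (\<epsilon> v) (F u)) = F h"
proof -
  have "bilinear_map scale scale scale (\<lambda>u v. scale (\<epsilon> v) u)"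
    by (intro bilinear_mapI lin_scale lin_scale_of_form lin_ident counit_linear
        vector_space_axioms)
  from linear_of_sw[OF this assms, of h, unfolded counit_right linear_simps(2)[OF assms], symmetric]
  show ?thesis .
qed

end


section \<open>Linear functions on a free algebra\<close>

text \<open>
  The scalar multiplication with respect to which \<^const>\<open>hd_ideal\<close> is a span.
\<close>
abbreviation word_scale :: "'k::field \<Rightarrow> ('w \<Rightarrow>\<^sub>0 'k) \<Rightarrow> 'w \<Rightarrow>\<^sub>0 'k" where
  "word_scale c \<equiv> Poly_Mapping.map ((*) c)"

lemma lookup_word_scale: "Poly_Mapping.lookup (word_scale c f) w = c * Poly_Mapping.lookup f w"
  by (simp add: map.rep_eq when_def)

lemma vector_space_word_scale: "vector_space (word_scale :: 'k::field \<Rightarrow> ('w \<Rightarrow>\<^sub>0 'k) \<Rightarrow> _)"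
  by unfold_locales
    (auto intro!: poly_mapping_eqI simp: lookup_word_scale lookup_add algebra_simps)

definition word_lift ::
  "('k::field \<Rightarrow> 'v::ab_group_add \<Rightarrow> 'v) \<Rightarrow> ('w \<Rightarrow> 'v) \<Rightarrow> ('w \<Rightarrow>\<^sub>0 'k) \<Rightarrow> 'v" where
  "word_lift s F f = (\<Sum>w\<in>Poly_Mapping.keys f. s (Poly_Mapping.lookup f w) (F w))"

lemma word_lift_linear:
  fixes s :: "'k::field \<Rightarrow> 'v::ab_group_add \<Rightarrow> 'v" and F :: "'w \<Rightarrow> 'v"
  assumes "vector_space s"
  shows "Vector_Spaces.linear word_scale s (word_lift s F)"
proof -
  interpret vector_space s by fact
  have ext: "word_lift s F f = (\<Sum>w\<in>A. s (Poly_Mapping.lookup f w) (F w))"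
    if "finite A" "Poly_Mapping.keys f \<subseteq> A" for f A
    unfolding word_lift_def
    using that by (intro sum.mono_neutral_left) (auto simp: in_keys_iff)
  show ?thesis
  proof (rule linearI)
    fix f g :: "'w \<Rightarrow>\<^sub>0 'k"
    let ?A = "Poly_Mapping.keys f \<union> Poly_Mapping.keys g"
    show "word_lift s F (f + g) = word_lift s F f + word_lift s F g"
      using keys_add[of f g]
      by (simp add: ext[of ?A] lookup_add scale_left_distrib sum.distrib)
  next
    fix c and f :: "'w \<Rightarrow>\<^sub>0 'k"
    have "Poly_Mapping.keys (word_scale c f) \<subseteq> Poly_Mapping.keys f"
      by (auto simp: in_keys_iff lookup_word_scale)
    then show "word_lift s F (word_scale c f) = s c (word_lift s F f)"
      by (simp add: ext[of "Poly_Mapping.keys f"] lookup_word_scale scale_sum_right)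
  qed (rule vector_space_word_scale, fact)
qed

lemma word_lift_single:
  assumes "vector_space s"
  shows "word_lift s F (Poly_Mapping.single w c) = s c (F w)"
proof -
  interpret vector_space s by fact
  show ?thesis by (simp add: word_lift_def)
qed


section \<open>The basis of a rank one pointed Hopf algebra\<close>

context rank_one_datum
begin

abbreviation n :: nat where "n \<equiv> mult_order (\<chi> a)"

lemma n_pos: "0 < n"
  using order_gt_1 by simp

lemma char_one: "\<chi> \<one> = 1"
  using char_mult[of \<one> \<one>] char_nonzero[of \<one>] by simp

lemma char_pow: "g \<in> carrier G \<Longrightarrow> \<chi> (g [^] (k::nat)) = \<chi> g ^ k"
  by (induction k) (simp_all add: char_one char_mult mult.commute)

lemma char_a_pow: "\<chi> a ^ n = 1"
proof -
  have "\<chi> a ^ order G = 1"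
    using pow_order_eq_1[OF a_closed] by (metis char_pow a_closed char_one)
  moreover have "0 < order G"
    using finite_carrier by (simp add: order_gt_0_iff_finite)
  ultimately show ?thesis
    using LeastI[of "\<lambda>m. 0 < m \<and> \<chi> a ^ m = 1" "order G"]
    unfolding mult_order_def by blast
qed

lemma char_a_pow_neq_one: "0 < m \<Longrightarrow> m < n \<Longrightarrow> \<chi> a ^ m \<noteq> 1"
  unfolding mult_order_def using not_less_Least by blast

lemma char_a_neq_one: "\<chi> a \<noteq> 1"
  using char_a_pow_neq_one[of 1] order_gt_1 by simp

lemma a_neq_one: "a \<noteq> \<one>"
  using char_a_neq_one char_one by auto

lemma datum_cases: "\<alpha> = 0 \<or> a [^] n = \<one> \<or> (\<forall>g\<in>carrier G. \<chi> g ^ n = 1)"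
proof -
  have "\<alpha> = 0 \<or> a [^] n = \<one>"
    if *: "Poly_Mapping.single (a [^] n) \<alpha> - Poly_Mapping.single \<one> \<alpha> = 0"
    using arg_cong[OF *, of "\<lambda>f. Poly_Mapping.lookup f \<one>"]
    by (auto simp: lookup_minus lookup_single when_def split: if_splits)
  then show ?thesis using datum_condition by blast
qed

text \<open>
  The two ways of moving \<open>h\<close> past \<open>x\<^sup>n = \<alpha> (a\<^sup>n - 1)\<close> agree.  This consistency of the relations is
  what the last condition of the datum is for.
\<close>
lemma char_pow_mult_difference:
  assumes "g \<in> carrier G" "h \<in> carrier G"
  shows "\<alpha> * (f (g \<otimes> a [^] n \<otimes> h) - f (g \<otimes> h) :: 'k) = \<chi> h ^ n * (\<alpha> * (f (g \<otimes> h \<otimes> a [^] n) - f (g \<otimes> h)))"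
proof -
  have "a [^] n \<otimes> h = h \<otimes> a [^] n"
    using a_central[OF assms(2)] assms(2) a_closed by (simp add: group_commutes_pow)
  then have "g \<otimes> a [^] n \<otimes> h = g \<otimes> h \<otimes> a [^] n"
    using assms a_closed by (simp add: m_assoc)
  then show ?thesis using datum_cases assms by auto
qed

text \<open>
  The action of the free algebra on the functions on \<open>G \<times> {0..<n}\<close>, to be thought of as linear
  forms on \<open>H\<close> given by their values on the elements \<open>g x\<^sup>m\<close>: a letter acts by the transpose of
  right multiplication by it.
\<close>
fun letter_act :: "'g hd_gen \<Rightarrow> ('g \<Rightarrow> nat \<Rightarrow> 'k) \<Rightarrow> 'g \<Rightarrow> nat \<Rightarrow> 'k" where
  "letter_act (Grp h) F g m = (if g \<in> carrier G \<and> m < n then \<chi> h ^ m * F (g \<otimes> h) m else 0)"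
| "letter_act X F g m =
     (if g \<in> carrier G \<and> m < n
      then if Suc m < n then F g (Suc m) else \<alpha> * (F (g \<otimes> a [^] n) 0 - F g 0) else 0)"

definition word_act :: "'g hd_gen list \<Rightarrow> ('g \<Rightarrow> nat \<Rightarrow> 'k) \<Rightarrow> 'g \<Rightarrow> nat \<Rightarrow> 'k" where
  "word_act w F = foldr letter_act w F"

lemma word_act_simps [simp]:
  "word_act [] F = F" "word_act (y # w) F = letter_act y (word_act w F)"
  "word_act (v @ w) F = word_act v (word_act w F)"
  by (simp_all add: word_act_def)

lemma letter_act_diff:
  "letter_act y (\<lambda>g m. c * F g m - d * F' g m) = (\<lambda>g m. c * letter_act y F g m - d * letter_act y F' g m)"
  by (cases y) (auto simp: fun_eq_iff algebra_simps)

lemma word_act_diff: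
  "word_act v (\<lambda>g m. c * F g m - d * F' g m) = (\<lambda>g m. c * word_act v F g m - d * word_act v F' g m)"
  by (induction v) (simp_all add: letter_act_diff)

lemma word_act_scale: "word_act v (\<lambda>g m. c * F g m) = (\<lambda>g m. c * word_act v F g m)"
  using word_act_diff[of v c F 0 F] by simp

definition supported :: "('g \<Rightarrow> nat \<Rightarrow> 'k) \<Rightarrow> bool" where
  "supported F \<longleftrightarrow> (\<forall>g m. \<not> (g \<in> carrier G \<and> m < n) \<longrightarrow> F g m = 0)"

lemma supported_letter_act: "supported (letter_act y F)"
  by (cases y) (auto simp: supported_def)

lemma supported_word_act: "supported F \<Longrightarrow> supported (word_act w F)"
  by (cases w) (simp_all add: supported_letter_act)

lemma supported_ext:
  assumes "supported F" "supported F'"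
    and "\<And>g m. g \<in> carrier G \<Longrightarrow> m < n \<Longrightarrow> F g m = F' g m"
  shows "F = F'"
  using assms unfolding supported_def fun_eq_iff by metis

lemma act_group_mult:
  "g \<in> carrier G \<Longrightarrow> h \<in> carrier G \<Longrightarrow>
    letter_act (Grp g) (letter_act (Grp h) F) = letter_act (Grp (g \<otimes> h)) F"
  by (auto simp: fun_eq_iff char_mult power_mult_distrib m_assoc)

lemma act_group_one: "supported F \<Longrightarrow> letter_act (Grp \<one>) F = F"
  by (auto simp: fun_eq_iff supported_def char_one)

lemma act_x_commute:
  assumes h: "h \<in> carrier G"
  shows "letter_act X (letter_act (Grp h) F) =
    (\<lambda>g m. \<chi> h * letter_act (Grp h) (letter_act X F) g m)"
proof (rule ext)+
  fix g m
  consider "\<not> (g \<in> carrier G \<and> m < n)" | "g \<in> carrier G" "Suc m < n" | "g \<in> carrier G" "n = Suc m"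
    by linarith
  then show "letter_act X (letter_act (Grp h) F) g m = \<chi> h * letter_act (Grp h) (letter_act X F) g m"
  proof cases
    case 3
    with char_pow_mult_difference[OF 3(1) h, of "\<lambda>g. F g 0"] show ?thesis
      using h a_closed by (simp add: mult.assoc)
  qed (use h in auto)
qed

lemma act_x_pow:
  assumes "g \<in> carrier G" "m < n" "k \<le> n"
  shows "word_act (replicate k X) F g m =
    (if m + k < n then F g (m + k) else \<alpha> * (F (g \<otimes> a [^] n) (m + k - n) - F g (m + k - n)))"
  using assms
proof (induction k arbitrary: g m)
  case (Suc k)
  show ?case
  proof (cases "Suc m < n")
    case True
    then show ?thesis using Suc by simp
  next
    case False
    then have "n = Suc m" using Suc.prems by simp
    then show ?thesis using Suc a_closed by simp
  qed
qed simp

lemma act_a_pow: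
  assumes "g \<in> carrier G" "m < n"
  shows "word_act (replicate k (Grp a)) F g m = \<chi> a ^ (m * k) * F (g \<otimes> a [^] k) m"
  using assms
proof (induction k arbitrary: g)
  case (Suc k)
  have "a \<otimes> a [^] k = a [^] Suc k"
    using a_closed by (simp add: group_commutes_pow)
  then show ?case
    using Suc a_closed by (simp add: power_add m_assoc)
qed (use assms in simp)

lemma act_x_power:
  assumes F: "supported F"
  shows "word_act (replicate n X) F =
    (\<lambda>g m. \<alpha> * word_act (replicate n (Grp a)) F g m - \<alpha> * F g m)"
proof (rule supported_ext)
  show "supported (word_act (replicate n X) F)"
    by (rule supported_word_act) fact
  show "supported (\<lambda>g m. \<alpha> * word_act (replicate n (Grp a)) F g m - \<alpha> * F g m)"
    using F supported_word_act[OF F, of "replicate n (Grp a)"] unfolding supported_def by auto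
  fix g m assume *: "g \<in> carrier G" "m < n"
  have "\<chi> a ^ (m * n) = 1"
    by (simp only: mult.commute[of m n] power_mult char_a_pow power_one)
  then show "word_act (replicate n X) F g m =
      \<alpha> * word_act (replicate n (Grp a)) F g m - \<alpha> * F g m"
    using * by (simp add: act_x_pow act_a_pow right_diff_distrib)
qed

definition free_form :: "('g \<Rightarrow> nat \<Rightarrow> 'k) \<Rightarrow> ('g hd_gen list \<Rightarrow>\<^sub>0 'k) \<Rightarrow> 'k" where
  "free_form F = word_lift (*) (\<lambda>w. word_act w F \<one> 0)"

lemma vector_space_field: "vector_space ((*) :: 'k \<Rightarrow> 'k \<Rightarrow> 'k)"
  by unfold_locales (auto simp: algebra_simps)

lemma free_form_linear: "Vector_Spaces.linear word_scale (*) (free_form F)"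
  unfolding free_form_def by (rule word_lift_linear) (rule vector_space_field)

lemma free_form_single: "free_form F (Poly_Mapping.single w c) = c * word_act w F \<one> 0"
  unfolding free_form_def by (rule word_lift_single) (rule vector_space_field)

text \<open>
  Words act by composition of letters, so the factors surrounding a relation do not matter: it is
  enough that the two sides of the relation act equally on the functions supported on
  \<open>G \<times> {0..<n}\<close>.
\<close>
lemma free_form_relators:
  assumes "supported F" "r \<in> hd_relators G \<chi> a \<alpha> v w"
  shows "free_form F r = 0"
  using assms(2)
proof cases
  case (group_mult g h)
  then show ?thesis
    by (simp add: linear_simps[OF free_form_linear] free_form_single act_group_mult)
next
  case group_one
  then show ?thesis
    by (simp add: linear_simps[OF free_form_linear] free_form_single act_group_one
        supported_word_act[OF assms(1)])
next
  case (x_power k)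
  then show ?thesis
    by (simp add: linear_simps[OF free_form_linear] free_form_single word_act_diff
        act_x_power[OF supported_word_act[OF assms(1)]])
next
  case (x_commute g)
  then show ?thesis
    by (simp add: linear_simps[OF free_form_linear] free_form_single act_x_commute word_act_scale
        del: letter_act.simps)
qed

lemma free_form_ideal:
  assumes "supported F" "r \<in> hd_ideal G \<chi> a \<alpha>"
  shows "free_form F r = 0"
proof -
  interpret W: vector_space "word_scale :: _ \<Rightarrow> ('g hd_gen list \<Rightarrow>\<^sub>0 'k) \<Rightarrow> _"
    by (rule vector_space_word_scale)
  show ?thesis
    using assms(2) unfolding hd_ideal_def
  proof (induction rule: W.span_induct_alt)
    case base
    show ?case by (rule linear_simps(5)[OF free_form_linear])
  next
    case (step c r r')
    then show ?case
      using free_form_relators[OF assms(1)] by (auto simp: linear_simps[OF free_form_linear])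
  qed
qed

end

context rank_one_hopf_algebra
begin

definition letter :: "'g hd_gen \<Rightarrow> 'h" where
  "letter y = (case y of Grp g \<Rightarrow> \<iota> g | X \<Rightarrow> x)"

lemma letter_simps [simp]: "letter (Grp g) = \<iota> g" "letter X = x"
  by (simp_all add: letter_def)

lemma hd_eval_eq: "hd_eval scale \<iota> x = word_lift scale (\<lambda>w. prod_list (map letter w))"
  by (simp add: fun_eq_iff hd_eval_def word_lift_def letter_def[abs_def])

lemma hd_eval_linear: "Vector_Spaces.linear word_scale scale (hd_eval scale \<iota> x)"
  unfolding hd_eval_eq by (rule word_lift_linear) (rule vector_space_axioms)

lemma hd_eval_single:
  "hd_eval scale \<iota> x (Poly_Mapping.single w c) = scale c (prod_list (map letter w))"
  unfolding hd_eval_eq by (rule word_lift_single) (rule vector_space_axioms)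

lemma hd_eval_relators:
  assumes "r \<in> hd_relators G \<chi> a \<alpha> [] []"
  shows "hd_eval scale \<iota> x r = 0"
proof -
  interpret W: vector_space "word_scale :: _ \<Rightarrow> ('g hd_gen list \<Rightarrow>\<^sub>0 'k) \<Rightarrow> _"
    by (rule vector_space_word_scale)
  have "r \<in> hd_ideal G \<chi> a \<alpha>"
    unfolding hd_ideal_def using assms by (intro W.span_base) (auto simp: hd_words_def)
  then show ?thesis using relations by auto
qed

lemma iota_mult: "g \<in> carrier G \<Longrightarrow> h \<in> carrier G \<Longrightarrow> \<iota> g * \<iota> h = \<iota> (g \<otimes> h)"
  using hd_eval_relators[OF hd_relators.group_mult, of g h]
  by (simp add: linear_simps[OF hd_eval_linear] hd_eval_single)

lemma iota_one: "\<iota> \<one> = 1"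
  using hd_eval_relators[OF hd_relators.group_one]
  by (simp add: linear_simps[OF hd_eval_linear] hd_eval_single)

lemma x_iota: "g \<in> carrier G \<Longrightarrow> x * \<iota> g = scale (\<chi> g) (\<iota> g * x)"
  using hd_eval_relators[OF hd_relators.x_commute, of g]
  by (simp add: linear_simps[OF hd_eval_linear] hd_eval_single)

lemma prod_list_replicate: "prod_list (replicate k y) = (y :: 'h) ^ k"
  by (induction k) simp_all

lemma iota_pow: "g \<in> carrier G \<Longrightarrow> \<iota> g ^ k = \<iota> (g [^] (k::nat))"
  by (induction k) (simp_all add: iota_one iota_mult power_Suc2 del: power_Suc)

lemma x_pow_n: "x ^ n = scale \<alpha> (\<iota> (a [^] n) - 1)"
  using hd_eval_relators[OF hd_relators.x_power[OF refl]]
  by (simp add: linear_simps[OF hd_eval_linear] hd_eval_single prod_list_replicate iota_pow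
      a_closed scale_right_diff_distrib)

definition hd_basis :: "'h set" where
  "hd_basis = {\<iota> g * x ^ m | g m. g \<in> carrier G \<and> m < n}"

lemma hd_basisI: "g \<in> carrier G \<Longrightarrow> m < n \<Longrightarrow> \<iota> g * x ^ m \<in> hd_basis"
  by (auto simp: hd_basis_def)

lemma mult_linear: "Vector_Spaces.linear scale scale (\<lambda>u. u * v)" "Vector_Spaces.linear scale scale ((*) u)"
  by (rule linearI; simp add: vector_space_axioms scale_mult_left scale_mult_right algebra_simps)+

lemma letter_mult_hd_basis:
  assumes y: "y \<in> insert X (Grp ` carrier G)" and b: "b \<in> hd_basis"
  shows "letter y * b \<in> span hd_basis"
proof -
  obtain g m where g: "g \<in> carrier G" and m: "m < n" and b: "b = \<iota> g * x ^ m"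
    using b by (auto simp: hd_basis_def)
  show ?thesis
  proof (cases y)
    case (Grp h)
    then show ?thesis
      using y g m by (auto simp: b iota_mult simp flip: mult.assoc intro!: span_base hd_basisI)
  next
    case X
    have eq: "x * (\<iota> g * x ^ m) = scale (\<chi> g) (\<iota> g * x ^ Suc m)"
      using g by (simp add: x_iota scale_mult_left mult.assoc flip: mult.assoc[of x])
    show ?thesis
    proof (cases "Suc m < n")
      case True
      then show ?thesis
        using span_scale[OF span_base[OF hd_basisI[OF g True]]] by (simp only: X b eq letter_simps)
    next
      case False
      with m have *: "Suc m = n" by simp
      have "x * (\<iota> g * x ^ m) =
          scale (\<chi> g * \<alpha>) (\<iota> (g \<otimes> a [^] n) * x ^ 0 - \<iota> g * x ^ 0)"
        unfolding eq * x_pow_n using g a_closed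
        by (simp add: scale_mult_right algebra_simps iota_mult)
      then show ?thesis
        using span_scale[OF span_diff[OF span_base[OF hd_basisI] span_base[OF hd_basisI]]] g a_closed n_pos
        by (simp only: X b letter_simps m_closed nat_pow_closed)
    qed
  qed
qed

text \<open>
  The span of the elements \<open>g x\<^sup>m\<close> contains \<open>1\<close> and is stable under left multiplication by the
  generators.
\<close>
lemma hd_basis_span: "span hd_basis = UNIV"
proof -
  have letter: "letter y * u \<in> span hd_basis"
    if y: "y \<in> insert X (Grp ` carrier G)" and u: "u \<in> span hd_basis" for y u
    using u
  proof (induction rule: span_induct_alt)
    case base
    show ?case by (simp add: span_zero)
  next
    case (step c b u)
    then show ?case
      using letter_mult_hd_basis[OF y]
      by (simp add: distrib_left scale_mult_right span_add span_scale)
  qed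
  have word: "prod_list (map letter w) \<in> span hd_basis" if "w \<in> hd_words G" for w
    using that unfolding hd_words_def
  proof (induction w)
    case Nil
    have "\<iota> \<one> * x ^ 0 \<in> span hd_basis"
      by (intro span_base hd_basisI one_closed n_pos)
    then show ?case by (simp add: iota_one)
  next
    case (Cons y w)
    then show ?case using letter by simp
  qed
  have "u \<in> span hd_basis" for u
  proof -
    obtain f where f: "f \<in> hd_free G" "u = hd_eval scale \<iota> x f"
      using generated by (metis UNIV_I imageE)
    then show ?thesis
      unfolding hd_eval_eq word_lift_def hd_free_def
      by (auto intro!: span_sum span_scale word)
  qed
  then show ?thesis by auto
qed

lemma linear_ext_hd_basis:
  assumes F: "Vector_Spaces.linear scale s F" "Vector_Spaces.linear scale s F'"
    and eq: "\<And>g m. g \<in> carrier G \<Longrightarrow> m < n \<Longrightarrow> F (\<iota> g * x ^ m) = F' (\<iota> g * x ^ m)"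
  shows "F u = F' u"
proof -
  have "u \<in> span hd_basis" by (simp add: hd_basis_span)
  then show ?thesis
  proof (induction rule: span_induct_alt)
    case base
    show ?case by (simp add: linear_simps[OF F(1)] linear_simps[OF F(2)])
  next
    case (step c b u)
    moreover from step(1) have "F b = F' b" using eq by (auto simp: hd_basis_def)
    ultimately show ?case by (simp add: linear_simps[OF F(1)] linear_simps[OF F(2)])
  qed
qed

lemma hd_free_closed:
  "f \<in> hd_free G \<Longrightarrow> f' \<in> hd_free G \<Longrightarrow> f + f' \<in> hd_free G"
  "f \<in> hd_free G \<Longrightarrow> f' \<in> hd_free G \<Longrightarrow> f - f' \<in> hd_free G"
  "f \<in> hd_free G \<Longrightarrow> word_scale c f \<in> hd_free G"
  unfolding hd_free_def subset_iff in_keys_iff lookup_add lookup_minus lookup_word_scale mem_Collect_eq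
  by (metis add_0 diff_self mult_zero_right)+

lemma free_form_well_defined:
  assumes "supported F" "f \<in> hd_free G" "f' \<in> hd_free G"
    and "hd_eval scale \<iota> x f = hd_eval scale \<iota> x f'"
  shows "free_form F f = free_form F f'"
proof -
  have "f - f' \<in> hd_free G" "hd_eval scale \<iota> x (f - f') = 0"
    using assms(2-4) by (simp_all add: hd_free_closed linear_simps(3)[OF hd_eval_linear])
  then have "f - f' \<in> hd_ideal G \<chi> a \<alpha>"
    using relations by blast
  from free_form_ideal[OF assms(1) this] show ?thesis
    by (simp add: linear_simps(3)[OF free_form_linear])
qed

text \<open>
  Linear independence of the elements \<open>g x\<^sup>m\<close>: a form on the free algebra that kills the ideal of
  relations descends to \<open>H\<close>, with prescribed values on these elements.
\<close>
lemma linear_form_exists: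
  assumes F: "supported F"
  shows "\<exists>\<phi>. Vector_Spaces.linear scale (*) \<phi> \<and>
    (\<forall>g\<in>carrier G. \<forall>m<n. \<phi> (\<iota> g * x ^ m) = F g m)"
proof -
  define lift where "lift u = (SOME f. f \<in> hd_free G \<and> hd_eval scale \<iota> x f = u)" for u
  have "\<exists>f. f \<in> hd_free G \<and> hd_eval scale \<iota> x f = u" for u
    using generated by (metis UNIV_I imageE)
  then have lift: "lift u \<in> hd_free G" "hd_eval scale \<iota> x (lift u) = u" for u
    unfolding lift_def by (metis (mono_tags, lifting) someI_ex)+
  define \<phi> where "\<phi> u = free_form F (lift u)" for u
  have \<phi>: "\<phi> (hd_eval scale \<iota> x f) = free_form F f" if "f \<in> hd_free G" for f
    unfolding \<phi>_def using that by (intro free_form_well_defined[OF F]) (simp_all add: lift)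
  have "Vector_Spaces.linear scale (*) \<phi>"
  proof (rule linearI)
    fix u v c
    show "\<phi> (u + v) = \<phi> u + \<phi> v"
      using \<phi>[of "lift u + lift v"]
      by (simp add: hd_free_closed lift linear_simps[OF hd_eval_linear] linear_simps[OF free_form_linear] \<phi>_def)
    show "\<phi> (scale c u) = c * \<phi> u"
      using \<phi>[of "word_scale c (lift u)"]
      by (simp add: hd_free_closed lift linear_simps[OF hd_eval_linear] linear_simps[OF free_form_linear] \<phi>_def)
  qed (rule vector_space_axioms vector_space_field)+
  moreover have "\<phi> (\<iota> g * x ^ m) = F g m" if "g \<in> carrier G" "m < n" for g m
  proof -
    let ?w = "Poly_Mapping.single (Grp g # replicate m X) (1::'k)"
    have "?w \<in> hd_free G"
      using that by (auto simp: hd_free_def hd_words_def)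
    from \<phi>[OF this] show ?thesis
      using that n_pos by (simp add: hd_eval_single prod_list_replicate free_form_single act_x_pow)
  qed
  ultimately show ?thesis by blast
qed

definition coord :: "'g \<Rightarrow> nat \<Rightarrow> 'h \<Rightarrow> 'k" where
  "coord g m = (SOME \<phi>. Vector_Spaces.linear scale (*) \<phi> \<and>
    (\<forall>h\<in>carrier G. \<forall>k<n. \<phi> (\<iota> h * x ^ k) = (if h = g \<and> k = m then 1 else 0)))"

lemma coord:
  "Vector_Spaces.linear scale (*) (coord g m) \<and>
    (\<forall>h\<in>carrier G. \<forall>k<n. coord g m (\<iota> h * x ^ k) = (if h = g \<and> k = m then 1 else 0))"
proof -
  let ?F = "\<lambda>h k. if h \<in> carrier G \<and> k < n \<and> h = g \<and> k = m then 1 else 0"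
  have "supported ?F" by (simp add: supported_def)
  then obtain \<phi> where "Vector_Spaces.linear scale (*) \<phi>"
    "\<forall>h\<in>carrier G. \<forall>k<n. \<phi> (\<iota> h * x ^ k) = ?F h k"
    using linear_form_exists by blast
  then have "\<exists>\<phi>. Vector_Spaces.linear scale (*) \<phi> \<and>
      (\<forall>h\<in>carrier G. \<forall>k<n. \<phi> (\<iota> h * x ^ k) = (if h = g \<and> k = m then 1 else 0))"
    by (intro exI[of _ \<phi>]) simp
  then show ?thesis unfolding coord_def by (rule someI_ex)
qed

lemma coord_linear: "Vector_Spaces.linear scale (*) (coord g m)"
  using coord by blast

lemma coord_hd_basis:
  "h \<in> carrier G \<Longrightarrow> k < n \<Longrightarrow> coord g m (\<iota> h * x ^ k) = (if h = g \<and> k = m then 1 else 0)"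
  using coord by blast

lemma hd_basis_expansion:
  "u = (\<Sum>g\<in>carrier G. \<Sum>m<n. scale (coord g m u) (\<iota> g * x ^ m))"
proof (rule linear_ext_hd_basis[where s = scale and F = "\<lambda>u. u" and
      F' = "\<lambda>u. \<Sum>g\<in>carrier G. \<Sum>m<n. scale (coord g m u) (\<iota> g * x ^ m)"])
  show "Vector_Spaces.linear scale scale (\<lambda>u. u)"
    by (rule lin_ident) (rule vector_space_axioms)
  show "Vector_Spaces.linear scale scale
      (\<lambda>u. \<Sum>g\<in>carrier G. \<Sum>m<n. scale (coord g m u) (\<iota> g * x ^ m))"
    by (rule linearI)
      (simp_all add: vector_space_axioms linear_simps[OF coord_linear] scale_left_distrib
        sum.distrib scale_sum_right)
  fix g m assume *: "g \<in> carrier G" "m < n"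
  have "(\<Sum>h\<in>carrier G. \<Sum>k<n. scale (coord h k (\<iota> g * x ^ m)) (\<iota> h * x ^ k)) =
      (\<Sum>h\<in>carrier G. \<Sum>k<n. if h = g then if k = m then \<iota> g * x ^ m else 0 else 0)"
    using * by (intro sum.cong refl) (auto simp: coord_hd_basis)
  also have "\<dots> = (\<Sum>h\<in>carrier G. if h = g then \<iota> g * x ^ m else 0)"
    using * by (intro sum.cong refl) simp
  also have "\<dots> = \<iota> g * x ^ m"
    using * finite_carrier by simp
  finally show "\<iota> g * x ^ m =
      (\<Sum>h\<in>carrier G. \<Sum>k<n. scale (coord h k (\<iota> g * x ^ m)) (\<iota> h * x ^ k))"
    by simp
qed

lemma coord_iota:
  "h \<in> carrier G \<Longrightarrow> coord g m (\<iota> h) = (if h = g \<and> m = 0 then 1 else 0)"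
  using coord_hd_basis[of h 0 g m] n_pos by auto

lemma iota_inj: "g \<in> carrier G \<Longrightarrow> h \<in> carrier G \<Longrightarrow> \<iota> g = \<iota> h \<Longrightarrow> g = h"
  using coord_iota[of g g 0] coord_iota[of h g 0] by (metis zero_neq_one)

lemma iota_nonzero: "g \<in> carrier G \<Longrightarrow> \<iota> g \<noteq> 0"
  using coord_iota[of g g 0] linear_simps(5)[OF coord_linear, of g 0] by auto

end


section \<open>The coalgebra morphism axiom tested on linear forms\<close>

lemma lin_mult_field:
  assumes "Vector_Spaces.linear s ((*) :: 'k::field \<Rightarrow> _) f"
  shows "Vector_Spaces.linear s (*) (\<lambda>u. c * f u)" "Vector_Spaces.linear s (*) (\<lambda>u. f u * c)"
  using lin_scale[OF assms, of c] by (simp_all add: mult.commute)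

lemma sum_list_pairs_add:
  "(\<Sum>(a, b)\<leftarrow>L. f a b + g a b) = (\<Sum>(a, b)\<leftarrow>L. f a b) + (\<Sum>(a, b)\<leftarrow>L. (g a b :: 'w::ab_group_add))"
  by (induction L) (auto simp: add_ac simp del: plus_fun_apply zero_fun_apply)

lemma sum_list_pairs_swap:
  "(\<Sum>(a, b)\<leftarrow>L. \<Sum>(c, d)\<leftarrow>M. f a b c d) = (\<Sum>(c, d)\<leftarrow>M. \<Sum>(a, b)\<leftarrow>L. (f a b c d :: 'w::ab_group_add))"
proof (induction L)
  case Nil
  have "(\<Sum>(c, d)\<leftarrow>M. 0 :: 'w) = 0" by (induction M) auto
  then show ?case by simp
next
  case (Cons l L)
  then show ?case by (cases l) (simp add: sum_list_pairs_add)
qed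

context coalgebra
begin

abbreviation lin_form :: "('h \<Rightarrow> 'k) \<Rightarrow> bool" where
  "lin_form \<equiv> Vector_Spaces.linear scale (*)"

text \<open>
  The conclusions are higher-order patterns, so that \<open>intro\<close> decomposes goals saying that a
  nested Sweedler expression is linear in one variable or bilinear in two.  The later collections
  of this kind add the multiplication and the operations.
\<close>
lemmas lin_rules =
  lin_ident[OF vector_space_axioms] lin_mult_field lin_add lin_scale[where t = scale]
  lin_scale_of_form[where t = scale, OF _ vector_space_axioms] lin_comp[OF counit_linear]
  linear_bilinear_left[OF tens_bilinear] linear_bilinear_right[OF tens_bilinear]
  linear_sw linear_sw_fun bilinear_mapI

lemma sw_add:
  assumes "bilinear_map scale scale s f" "bilinear_map scale scale s g"
  shows "sw h (\<lambda>u v. f u v + g u v) = sw h f + sw h g"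
proof -
  have "bilinear_map scale scale s (\<lambda>u v. f u v + g u v)"
    using assms by (simp add: bilinear_map_def lin_add)
  then show ?thesis
    by (simp add: sw_eq_sum_list[OF assms(1)] sw_eq_sum_list[OF assms(2)] sw_eq_sum_list
        sum_list_pairs_add)
qed

lemma sw_mult_const:
  assumes "bilinear_map scale scale ((*) :: 'k \<Rightarrow> _) f"
  shows "sw h (\<lambda>u v. c * f u v) = c * sw h f" "sw h (\<lambda>u v. f u v * c) = sw h f * c"
proof -
  have *: "Vector_Spaces.linear (*) (*) (\<lambda>y::'k. c * y)"
    by (intro lin_rules lin_ident) (auto simp: vector_space_def algebra_simps)
  show "sw h (\<lambda>u v. c * f u v) = c * sw h f"
    using linear_of_sw[OF assms *, of h] by simp
  then show "sw h (\<lambda>u v. f u v * c) = sw h f * c"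
    by (simp add: mult.commute)
qed

lemma sw_swap:
  assumes "\<And>c d. bilinear_map scale scale s (\<lambda>a b. f a b c d)"
    and "\<And>a b. bilinear_map scale scale s (f a b)"
  shows "sw h (\<lambda>a b. sw k (\<lambda>c d. f a b c d)) = sw k (\<lambda>c d. sw h (\<lambda>a b. f a b c d))"
proof -
  note * = bilinear_map_linear[OF assms(1)]
  have "bilinear_map scale scale s (\<lambda>a b. sw k (\<lambda>c d. f a b c d))"
    by (intro bilinear_mapI linear_sw_fun assms(2) *)
  moreover have "bilinear_map scale scale s (\<lambda>c d. sw h (\<lambda>a b. f a b c d))"
    using bilinear_map_linear[OF assms(2)] by (intro bilinear_mapI linear_sw_fun assms(1))
  ultimately show ?thesis
    using sum_list_pairs_swap
    by (simp add: sw_eq_sum_list[OF assms(1)] sw_eq_sum_list[OF assms(2)] sw_eq_sum_list)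
qed

text \<open>
  As an iterated Sweedler sum of pure tensors, this side of the morphism axiom can be evaluated at
  linear forms.
\<close>
lemma tensor_comult_q_map:
  assumes p: "bilinear_map scale scale scale p" and d: "bilinear_map scale scale scale d"
  shows "tensor_comult cop \<Delta> (q_map p d u v) =
    sw u (\<lambda>u1 u2. sw v (\<lambda>v1 v2. sw (d v1 u2) (\<lambda>y1 y2. sw (p u1 v2) (\<lambda>z1 z2.
      tensor tensor_scale tensor_scale (y2 \<boxtimes> z1) (y1 \<boxtimes> z2)))))"
proof -
  have T: "bilinear_map tensor_scale tensor_scale tensor_scale
      (tensor tensor_scale tensor_scale :: ('h, 'h, 'k) tensor \<Rightarrow> ('h, 'h, 'k) tensor \<Rightarrow> _)"
    by (intro tensor_bilinear vector_space_tensor_scale)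
  note rules = lin_rules linear_bilinear_left[OF p] linear_bilinear_right[OF p]
    linear_bilinear_left[OF d] linear_bilinear_right[OF d]
    linear_bilinear_left[OF T] linear_bilinear_right[OF T]
  define K where "K y z = sw y (\<lambda>y1 y2. sw z (\<lambda>z1 z2.
    tensor tensor_scale tensor_scale (y2 \<boxtimes> z1) (y1 \<boxtimes> z2)))" for y z
  have "tensor_comult cop \<Delta> = tensor_lift scale scale K"
    unfolding tensor_comult_def sw_def[symmetric] K_def
    by (subst sw_flip[where s = tensor_scale]) (intro rules, rule refl)
  moreover have K: "bilinear_map scale scale tensor_scale K"
    unfolding K_def by (intro rules)
  moreover have inner: "tensor_lift scale scale K (sw v (\<lambda>v1 v2. d v1 b \<boxtimes> p a v2)) =
      sw v (\<lambda>v1 v2. K (d v1 b) (p a v2))" for a b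
    by (subst tensor_lift_sw[OF K]; (intro rules tensor_in_tensor_space)?;
      simp add: tensor_lift_tensor[OF K]; intro rules linear_bilinear_left[OF K] linear_bilinear_right[OF K])
  have "tensor_lift scale scale K (sw u (\<lambda>u1 u2. sw v (\<lambda>v1 v2. d v1 u2 \<boxtimes> p u1 v2))) =
      sw u (\<lambda>u1 u2. sw v (\<lambda>v1 v2. K (d v1 u2) (p u1 v2)))"
    by (subst tensor_lift_sw[OF K]; (intro rules sw_in_tensor_space tensor_in_tensor_space)?;
      simp add: inner; intro rules linear_bilinear_left[OF K] linear_bilinear_right[OF K])
  ultimately show ?thesis
    by (simp add: q_map_def K_def)
qed

lemma tens_apply: "bilinear_map scale scale (*) \<beta> \<Longrightarrow> (u \<boxtimes> v) \<beta> = \<beta> u v"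
  by (simp add: tensor_def)

lemma lin_tensor_eval:
  "Vector_Spaces.linear (tensor_scale :: 'k \<Rightarrow> ('u, 'v, 'k) tensor \<Rightarrow> _) (*) (\<lambda>t. t \<beta>)"
  by (rule linearI) (auto simp: vector_space_tensor_scale tensor_scale_def vector_space_def algebra_simps)

lemma sw_eval:
  "bilinear_map scale scale tensor_scale f \<Longrightarrow> sw h f \<beta> = sw h (\<lambda>a b. f a b \<beta>)"
  by (rule linear_of_sw[OF _ lin_tensor_eval])

text \<open>
  The morphism axiom evaluated at the bilinear form \<open>(s, t) \<mapsto> s(A) t(B)\<close> on the tensor square.
  Evaluation at \<open>A\<close> is linear on the whole function type and not only on the span of the pure
  tensors, so that this is a legitimate bilinear form.
\<close>
lemma q_magma_forms:
  assumes "q_magma_coalgebra p d" and A: "bilinear_map scale scale (*) A" and B: "bilinear_map scale scale (*) B"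
  shows "sw u (\<lambda>u1 u2. sw v (\<lambda>v1 v2. sw (d v1 u2) (\<lambda>y1 y2. sw (p u1 v2) (\<lambda>z1 z2.
        A y2 z1 * B y1 z2)))) =
      sw u (\<lambda>u1 u2. sw v (\<lambda>v1 v2. q_map p d u1 v2 A * q_map p d u2 v1 B))"
proof -
  have p: "bilinear_map scale scale scale p" and d: "bilinear_map scale scale scale d"
    and eq: "tensor_comult cop \<Delta> (q_map p d u v) = sw u (\<lambda>u\<^sub>1 u\<^sub>2. sw v (\<lambda>v\<^sub>1 v\<^sub>2.
          tensor tensor_scale tensor_scale (q_map p d u\<^sub>1 v\<^sub>2) (q_map p d u\<^sub>2 v\<^sub>1)))"
    using assms(1) by (auto simp: q_magma_coalgebra_def)
  have T: "bilinear_map tensor_scale tensor_scale tensor_scale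
      (tensor tensor_scale tensor_scale :: ('h, 'h, 'k) tensor \<Rightarrow> ('h, 'h, 'k) tensor \<Rightarrow> _)"
    by (intro tensor_bilinear vector_space_tensor_scale)
  note rules = lin_rules linear_bilinear_left[OF p] linear_bilinear_right[OF p]
    linear_bilinear_left[OF d] linear_bilinear_right[OF d]
    linear_bilinear_left[OF T] linear_bilinear_right[OF T]
  let ?\<beta> = "\<lambda>s t :: ('h, 'h, 'k) tensor. s A * t B"
  have \<beta>: "bilinear_map tensor_scale tensor_scale (*) ?\<beta>"
    by (intro bilinear_mapI lin_mult_field lin_tensor_eval)
  have Q: "bilinear_map scale scale tensor_scale (q_map p d)"
    unfolding q_map_def by (intro rules)
  have ev: "tensor tensor_scale tensor_scale s t ?\<beta> = s A * t B" for s t :: "('h, 'h, 'k) tensor"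
    using \<beta> by (simp add: tensor_def)
  note rules = rules linear_bilinear_left[OF Q] linear_bilinear_right[OF Q]
  let ?T = "tensor tensor_scale tensor_scale :: ('h, 'h, 'k) tensor \<Rightarrow> ('h, 'h, 'k) tensor \<Rightarrow> _"
  have bil: "bilinear_map scale scale tensor_scale (\<lambda>z1 z2. ?T (y2 \<boxtimes> z1) (y1 \<boxtimes> z2))"
    "bilinear_map scale scale tensor_scale
      (\<lambda>y1 y2. sw z (\<lambda>z1 z2. ?T (y2 \<boxtimes> z1) (y1 \<boxtimes> z2)))"
    "bilinear_map scale scale tensor_scale (\<lambda>v1 v2. sw (d v1 b) (\<lambda>y1 y2. sw (p a v2)
      (\<lambda>z1 z2. ?T (y2 \<boxtimes> z1) (y1 \<boxtimes> z2))))"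
    "bilinear_map scale scale tensor_scale (\<lambda>u1 u2. sw v (\<lambda>v1 v2. sw (d v1 u2) (\<lambda>y1 y2. sw (p u1 v2)
      (\<lambda>z1 z2. ?T (y2 \<boxtimes> z1) (y1 \<boxtimes> z2)))))"
    "bilinear_map scale scale tensor_scale (\<lambda>v1 v2. ?T (q_map p d a v2) (q_map p d b v1))"
    "bilinear_map scale scale tensor_scale
      (\<lambda>u1 u2. sw v (\<lambda>v1 v2. ?T (q_map p d u1 v2) (q_map p d u2 v1)))"
    for y1 y2 z a b
    by (intro rules)+
  show ?thesis
    using arg_cong[OF eq, of "\<lambda>t. t ?\<beta>"]
    unfolding tensor_comult_q_map[OF p d] bil[THEN sw_eval] ev tens_apply[OF A] tens_apply[OF B] .
qed

text \<open>
  A counit in one leg of \<open>v\<^sub>1 : u\<^sub>2 \<otimes> u\<^sub>1 \<cdot> v\<^sub>2\<close> removes that leg.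
\<close>
lemma q_map_forms:
  assumes p: "bilinear_map scale scale scale p" and d: "bilinear_map scale scale scale d"
    and \<epsilon>: "\<And>u v. \<epsilon> (p u v) = \<epsilon> u * \<epsilon> v" "\<And>u v. \<epsilon> (d u v) = \<epsilon> u * \<epsilon> v"
    and \<psi>: "lin_form \<psi>"
  shows "q_map p d u v (\<lambda>a b. \<epsilon> a * \<psi> b) = \<psi> (p u v)"
    and "q_map p d u v (\<lambda>a b. \<psi> a * \<epsilon> b) = \<psi> (d v u)"
proof -
  note rules = lin_rules linear_bilinear_left[OF p] linear_bilinear_right[OF p]
    linear_bilinear_left[OF d] linear_bilinear_right[OF d] lin_comp[OF \<psi>] \<psi> counit_linear
  have bil: "bilinear_map scale scale tensor_scale (\<lambda>v1 v2. d v1 b \<boxtimes> p a v2)"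
    "bilinear_map scale scale tensor_scale (\<lambda>u1 u2. sw v (\<lambda>v1 v2. d v1 u2 \<boxtimes> p u1 v2))"
    for a b by (intro rules)+
  have form: "bilinear_map scale scale (*) (\<lambda>a b. \<epsilon> a * \<psi> b)"
    "bilinear_map scale scale (*) (\<lambda>a b. \<psi> a * \<epsilon> b)"
    by (intro rules)+
  have "sw v (\<lambda>v1 v2. \<epsilon> (d v1 b) * \<psi> (p a v2)) = \<epsilon> b * \<psi> (p a v)" for a b
  proof -
    have "sw v (\<lambda>v1 v2. \<epsilon> v1 * (\<epsilon> b * \<psi> (p a v2))) = \<epsilon> b * \<psi> (p a v)"
      by (rule sw_counit_left) (intro rules)
    then show ?thesis by (simp add: \<epsilon> mult.assoc)
  qed
  moreover have "sw u (\<lambda>u1 u2. \<epsilon> u2 * \<psi> (p u1 v)) = \<psi> (p u v)"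
    by (rule sw_counit_right) (intro rules)
  ultimately show "q_map p d u v (\<lambda>a b. \<epsilon> a * \<psi> b) = \<psi> (p u v)"
    unfolding q_map_def bil[THEN sw_eval] by (simp add: tens_apply[OF form(1)])
  have "sw v (\<lambda>v1 v2. \<psi> (d v1 b) * \<epsilon> (p a v2)) = \<epsilon> a * \<psi> (d v b)" for a b
  proof -
    have "sw v (\<lambda>v1 v2. \<epsilon> v2 * (\<epsilon> a * \<psi> (d v1 b))) = \<epsilon> a * \<psi> (d v b)"
      by (rule sw_counit_right) (intro rules)
    then show ?thesis by (simp add: \<epsilon> mult_ac)
  qed
  moreover have "sw u (\<lambda>u1 u2. \<epsilon> u1 * \<psi> (d v u2)) = \<psi> (d v u)"
    by (rule sw_counit_left) (intro rules)
  ultimately show "q_map p d u v (\<lambda>a b. \<psi> a * \<epsilon> b) = \<psi> (d v u)"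
    unfolding q_map_def bil[THEN sw_eval] by (simp add: tens_apply[OF form(2)])
qed

text \<open>
  The morphism axiom says that both operations are coalgebra maps on \<open>X \<otimes> X\<^sup>c\<^sup>o\<^sup>p\<close> and that they
  are compatible.  The three statements arise by putting counits into legs of the
  forms \<open>A\<close> and \<open>B\<close> of \<open>q_magma_forms\<close>: into the first legs, into the second legs, and into the
  second leg of \<open>A\<close> and the first leg of \<open>B\<close>.
\<close>
lemma
  assumes q: "q_magma_coalgebra p d" and \<psi>: "lin_form \<psi>" and \<omega>: "lin_form \<omega>"
  shows q_magma_comult_dot:
      "sw (p u v) (\<lambda>a b. \<psi> a * \<omega> b) =
        sw u (\<lambda>u1 u2. sw v (\<lambda>v1 v2. \<psi> (p u1 v2) * \<omega> (p u2 v1)))" (is ?A)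
    and q_magma_comult_col:
      "sw (d u v) (\<lambda>a b. \<psi> a * \<omega> b) =
        sw u (\<lambda>u1 u2. sw v (\<lambda>v1 v2. \<psi> (d u1 v2) * \<omega> (d u2 v1)))" (is ?B)
    and q_magma_compatible:
      "sw u (\<lambda>u1 u2. sw v (\<lambda>v1 v2. \<psi> (d v1 u2) * \<omega> (p u1 v2))) =
        sw u (\<lambda>u1 u2. sw v (\<lambda>v1 v2. \<psi> (d v2 u1) * \<omega> (p u2 v1)))" (is ?C)
proof -
  have p: "bilinear_map scale scale scale p" and d: "bilinear_map scale scale scale d"
    and \<epsilon>: "\<And>u v. \<epsilon> (p u v) = \<epsilon> u * \<epsilon> v" "\<And>u v. \<epsilon> (d u v) = \<epsilon> u * \<epsilon> v"
    using q by (auto simp: q_magma_coalgebra_def)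
  note rules = lin_rules linear_bilinear_left[OF p] linear_bilinear_right[OF p]
    linear_bilinear_left[OF d] linear_bilinear_right[OF d]
    lin_comp[OF \<psi>] lin_comp[OF \<omega>] \<psi> \<omega> counit_linear
  note Q = q_map_forms[OF p d \<epsilon> \<psi>] q_map_forms[OF p d \<epsilon> \<omega>]
  have form: "bilinear_map scale scale (*) (\<lambda>a b. \<epsilon> a * \<psi> b)" "bilinear_map scale scale (*) (\<lambda>a b. \<epsilon> a * \<omega> b)"
    "bilinear_map scale scale (*) (\<lambda>a b. \<psi> a * \<epsilon> b)" "bilinear_map scale scale (*) (\<lambda>a b. \<omega> a * \<epsilon> b)"
    "bilinear_map scale scale (*) (\<lambda>a b. \<psi> a * \<omega> b)" "bilinear_map scale scale (*) (\<lambda>a b. \<omega> b * \<psi> a)"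
    by (intro rules)+
  have cl: "sw h (\<lambda>a b. \<epsilon> a * F b) = F h" "sw h (\<lambda>a b. \<epsilon> b * F a) = F h" if "lin_form F" for F h
    using that by (intro sw_counit_left sw_counit_right; assumption)+
  have A1: "sw y (\<lambda>y1 y2. sw z (\<lambda>z1 z2. (\<epsilon> y2 * \<psi> z1) * (\<epsilon> y1 * \<omega> z2))) =
      \<epsilon> y * sw z (\<lambda>a b. \<psi> a * \<omega> b)" for y z
  proof -
    have "sw z (\<lambda>z1 z2. (\<epsilon> y2 * \<psi> z1) * (\<epsilon> y1 * \<omega> z2)) =
        \<epsilon> y1 * (\<epsilon> y2 * sw z (\<lambda>a b. \<psi> a * \<omega> b))" for y1 y2
      using sw_mult_const(1)[OF form(5), of z "\<epsilon> y1 * \<epsilon> y2"] by (simp add: mult_ac)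
    moreover have "sw y (\<lambda>y1 y2. \<epsilon> y1 * (\<epsilon> y2 * sw z (\<lambda>a b. \<psi> a * \<omega> b))) =
        \<epsilon> y * sw z (\<lambda>a b. \<psi> a * \<omega> b)"
      by (rule cl) (intro rules)
    ultimately show ?thesis by simp
  qed
  have A2: "sw v (\<lambda>v1 v2. \<epsilon> (d v1 b) * sw (p a v2) (\<lambda>a b. \<psi> a * \<omega> b)) =
      \<epsilon> b * sw (p a v) (\<lambda>a b. \<psi> a * \<omega> b)" for a b
  proof -
    have "sw v (\<lambda>v1 v2. \<epsilon> v1 * (\<epsilon> b * sw (p a v2) (\<lambda>a b. \<psi> a * \<omega> b))) =
        \<epsilon> b * sw (p a v) (\<lambda>a b. \<psi> a * \<omega> b)"
      by (rule cl) (intro rules)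
    then show ?thesis by (simp add: \<epsilon> mult.assoc)
  qed
  have A3: "sw u (\<lambda>u1 u2. \<epsilon> u2 * sw (p u1 v) (\<lambda>a b. \<psi> a * \<omega> b)) =
      sw (p u v) (\<lambda>a b. \<psi> a * \<omega> b)"
    by (rule cl) (intro rules)
  show ?A
    using q_magma_forms[OF q form(1,2), of u v] by (simp add: A1 A2 A3 Q)
  have B1: "sw z (\<lambda>z1 z2. (\<omega> y2 * \<epsilon> z1) * (\<psi> y1 * \<epsilon> z2)) = \<epsilon> z * (\<psi> y1 * \<omega> y2)" for y1 y2 z
  proof -
    have "sw z (\<lambda>z1 z2. \<epsilon> z1 * (\<epsilon> z2 * (\<psi> y1 * \<omega> y2))) = \<epsilon> z * (\<psi> y1 * \<omega> y2)"
      by (rule cl) (intro rules)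
    then show ?thesis by (simp add: mult_ac)
  qed
  have B2: "sw u (\<lambda>u1 u2. sw v (\<lambda>v1 v2. \<epsilon> u1 * \<epsilon> v2 * sw (d v1 u2) (\<lambda>a b. \<psi> a * \<omega> b))) =
      sw (d v u) (\<lambda>a b. \<psi> a * \<omega> b)" for u v
  proof -
    have "sw v (\<lambda>v1 v2. \<epsilon> v2 * (\<epsilon> a * sw (d v1 b) (\<lambda>a b. \<psi> a * \<omega> b))) =
      \<epsilon> a * sw (d v b) (\<lambda>a b. \<psi> a * \<omega> b)" for a b
      by (rule cl) (intro rules)
    moreover have "sw u (\<lambda>u1 u2. \<epsilon> u1 * sw (d v u2) (\<lambda>a b. \<psi> a * \<omega> b)) =
      sw (d v u) (\<lambda>a b. \<psi> a * \<omega> b)"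
      by (rule cl) (intro rules)
    ultimately show ?thesis by (simp add: mult_ac)
  qed
  have "sw (d u v) (\<lambda>a b. \<psi> a * \<omega> b) =
      sw v (\<lambda>v1 v2. sw u (\<lambda>u1 u2. \<omega> (d u2 v1) * \<psi> (d u1 v2)))"
    using q_magma_forms[OF q form(4,3), of v u] by (simp add: B1 sw_mult_const[OF form(5)] \<epsilon> B2 Q)
  also have "\<dots> = sw u (\<lambda>u1 u2. sw v (\<lambda>v1 v2. \<omega> (d u2 v1) * \<psi> (d u1 v2)))"
    by (rule sw_swap[where s = "(*)"]) (intro rules)+
  finally show ?B by (simp add: mult.commute)
  have C1: "sw z (\<lambda>z1 z2. (\<psi> y2 * \<epsilon> z1) * (\<epsilon> y1 * \<omega> z2)) = \<epsilon> y1 * (\<psi> y2 * \<omega> z)" for y1 y2 z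
  proof -
    have "sw z (\<lambda>z1 z2. \<epsilon> z1 * (\<epsilon> y1 * (\<psi> y2 * \<omega> z2))) = \<epsilon> y1 * (\<psi> y2 * \<omega> z)"
      by (rule cl) (intro rules)
    then show ?thesis by (simp add: mult_ac)
  qed
  have C2: "sw y (\<lambda>y1 y2. \<epsilon> y1 * (\<psi> y2 * c)) = \<psi> y * c" for y c
    by (rule cl) (intro rules)
  show ?C
    using q_magma_forms[OF q form(3,2), of u v] by (simp add: C1 C2 Q)
qed

end


section \<open>Grouplike and skew primitive elements\<close>

context rank_one_hopf_algebra
begin

lemma sw_iota: "bilinear_map scale scale s f \<Longrightarrow> g \<in> carrier G \<Longrightarrow> sw (\<iota> g) f = f (\<iota> g) (\<iota> g)"
  by (simp add: sw_def comult_group tensor_lift_tensor)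

lemma sw_x: "bilinear_map scale scale s f \<Longrightarrow> sw x f = f x (\<iota> a) + f 1 x"
  by (simp add: sw_def comult_x tensor_lift_add tensor_lift_tensor tensor_in_tensor_space)

lemma mult_bilinear: "bilinear_map scale scale scale (*)"
  by (intro bilinear_mapI mult_linear)

lemmas hopf_lin_rules =
  lin_rules linear_bilinear_left[OF mult_bilinear] linear_bilinear_right[OF mult_bilinear]

lemma sw_mult:
  assumes f: "bilinear_map scale scale s f"
  shows "sw (u * v) f = sw u (\<lambda>u1 u2. sw v (\<lambda>v1 v2. f (u1 * v1) (u2 * v2)))"
proof -
  note rules = hopf_lin_rules linear_bilinear_left[OF f] linear_bilinear_right[OF f]
  have inner: "tensor_lift scale scale f (sw v (\<lambda>v1 v2. (a * v1) \<boxtimes> (b * v2))) =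
      sw v (\<lambda>v1 v2. f (a * v1) (b * v2))" for a b
    by (subst tensor_lift_sw[OF f]; (intro rules tensor_in_tensor_space)?;
      simp add: tensor_lift_tensor[OF f]; intro rules)
  show ?thesis
    unfolding sw_def[of "u * v"] comult_mult
    by (subst tensor_lift_sw[OF f]; (intro rules sw_in_tensor_space tensor_in_tensor_space)?;
      simp add: inner; intro rules)
qed

lemma sw_mult_x:
  assumes f: "bilinear_map scale scale s f"
  shows "sw (u * x) f = sw u (\<lambda>u1 u2. f (u1 * x) (u2 * \<iota> a) + f u1 (u2 * x))"
proof -
  note rules = hopf_lin_rules linear_bilinear_left[OF f] linear_bilinear_right[OF f]
  have "sw x (\<lambda>v1 v2. f (u1 * v1) (u2 * v2)) = f (u1 * x) (u2 * \<iota> a) + f (u1 * 1) (u2 * x)" for u1 u2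
    by (rule sw_x[where s = s]) (intro rules)
  then show ?thesis
    unfolding sw_mult[OF f] by simp
qed

lemma sw_iota_x:
  assumes f: "bilinear_map scale scale s f" and g: "g \<in> carrier G"
  shows "sw (\<iota> g * x) f = f (\<iota> g * x) (\<iota> (g \<otimes> a)) + f (\<iota> g) (\<iota> g * x)"
proof -
  note rules = hopf_lin_rules linear_bilinear_left[OF f] linear_bilinear_right[OF f]
  have "sw (\<iota> g * x) f = f (\<iota> g * x) (\<iota> g * \<iota> a) + f (\<iota> g) (\<iota> g * x)"
    unfolding sw_mult_x[OF f] by (rule sw_iota[where s = s, OF _ g]) (intro rules)
  then show ?thesis by (simp add: iota_mult g a_closed)
qed

lemma counit_iota: "g \<in> carrier G \<Longrightarrow> \<epsilon> (\<iota> g) = 1"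
proof -
  assume g: "g \<in> carrier G"
  have "sw (\<iota> g) (\<lambda>u v. scale (\<epsilon> u) v) = scale (\<epsilon> (\<iota> g)) (\<iota> g)"
    by (rule sw_iota[where s = scale, OF _ g]) (intro hopf_lin_rules counit_linear)
  then have "scale (\<epsilon> (\<iota> g)) (\<iota> g) = scale 1 (\<iota> g)"
    by (simp add: counit_left)
  then show ?thesis using iota_nonzero[OF g] by (simp del: scale_one)
qed

lemma counit_x: "\<epsilon> x = 0"
proof -
  have "sw x (\<lambda>u v. scale (\<epsilon> u) v) = scale (\<epsilon> x) (\<iota> a) + scale (\<epsilon> 1) x"
    by (rule sw_x[where s = scale]) (intro hopf_lin_rules counit_linear)
  then show ?thesis
    using iota_nonzero[OF a_closed] by (simp add: counit_left counit_one)
qed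

lemma counit_hd_basis: "g \<in> carrier G \<Longrightarrow> \<epsilon> (\<iota> g * x ^ m) = (if m = 0 then 1 else 0)"
  by (cases m) (simp_all add: counit_mult counit_iota counit_x)

definition degree_one :: "'h \<Rightarrow> 'k" where
  "degree_one u = (\<Sum>g\<in>carrier G. coord g 1 u)"

lemma degree_one_linear: "lin_form degree_one"
  unfolding degree_one_def
  by (rule linearI)
    (simp_all add: vector_space_axioms vector_space_field linear_simps[OF coord_linear] sum.distrib
      sum_distrib_left)

lemma degree_one_hd_basis:
  "g \<in> carrier G \<Longrightarrow> m < n \<Longrightarrow> degree_one (\<iota> g * x ^ m) = (if m = 1 then 1 else 0)"
  using finite_carrier by (simp add: degree_one_def coord_hd_basis)

lemma degree_one_iota: "g \<in> carrier G \<Longrightarrow> degree_one (\<iota> g) = 0"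
  using degree_one_hd_basis[of g 0] n_pos by simp

lemma x_pow_iota: "g \<in> carrier G \<Longrightarrow> x ^ m * \<iota> g = scale (\<chi> g ^ m) (\<iota> g * x ^ m)"
proof (induction m)
  case (Suc m)
  have "x ^ Suc m * \<iota> g = x * (x ^ m * \<iota> g)"
    by (simp add: mult.assoc)
  also have "\<dots> = scale (\<chi> g ^ m) ((x * \<iota> g) * x ^ m)"
    using Suc by (simp add: scale_mult_right mult.assoc)
  finally show ?case
    using Suc.prems by (simp add: x_iota scale_mult_left mult.assoc mult.commute)
qed simp

lemma degree_one_mult_a: "degree_one (u * \<iota> a) = \<chi> a * degree_one u"
proof (rule linear_ext_hd_basis[where s = "(*)" and F = "\<lambda>u. degree_one (u * \<iota> a)" and
      F' = "\<lambda>u. \<chi> a * degree_one u"])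
  fix g m assume g: "g \<in> carrier G" and m: "m < n"
  have "\<iota> g * x ^ m * \<iota> a = scale (\<chi> a ^ m) (\<iota> (g \<otimes> a) * x ^ m)"
    using g a_closed by (simp add: mult.assoc x_pow_iota scale_mult_right iota_mult flip: mult.assoc[of "\<iota> g"])
  then show "degree_one (\<iota> g * x ^ m * \<iota> a) = \<chi> a * degree_one (\<iota> g * x ^ m)"
    using g m a_closed by (simp add: degree_one_hd_basis linear_simps[OF degree_one_linear])
qed (intro hopf_lin_rules lin_comp[OF degree_one_linear] degree_one_linear)+

text \<open>
  The elements \<open>g x\<^sup>n\<^sup>-\<^sup>1\<close> need care: there \<open>x\<^sup>n\<close> falls back to degree \<open>0\<close>, and \<open>n > 1\<close> makes both
  sides vanish.
\<close>
lemma degree_one_mult_x: "degree_one (u * x) = \<epsilon> u"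
proof (rule linear_ext_hd_basis[where s = "(*)" and F = "\<lambda>u. degree_one (u * x)" and F' = \<epsilon>])
  fix g m assume g: "g \<in> carrier G" and m: "m < n"
  show "degree_one (\<iota> g * x ^ m * x) = \<epsilon> (\<iota> g * x ^ m)"
  proof (cases "Suc m < n")
    case True
    then show ?thesis
      using g degree_one_hd_basis[OF g True] by (simp add: counit_hd_basis mult.assoc power_commutes)
  next
    case False
    with m have "Suc m = n" by simp
    then have "\<iota> g * x ^ m * x = scale \<alpha> (\<iota> (g \<otimes> a [^] n) - \<iota> g)"
      using x_pow_n g a_closed
      by (simp add: mult.assoc power_commutes scale_mult_right right_diff_distrib iota_mult
          flip: power_Suc)
    then show ?thesis
      using g a_closed \<open>Suc m = n\<close> order_gt_1
      by (simp add: linear_simps[OF degree_one_linear] degree_one_iota counit_hd_basis)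
  qed
qed (intro hopf_lin_rules lin_comp[OF degree_one_linear] counit_linear)+

text \<open>
  The map \<open>(id \<otimes> degree_one) \<circ> \<Delta>\<close>.  By \<open>skew_deriv_mult_x\<close> it is a skew derivative with respect
  to \<open>x\<close>: it sends \<open>g x\<^sup>m\<close> to \<open>g x\<^sup>m\<^sup>-\<^sup>1\<close> times the \<open>q\<close>-number \<open>1 + q + \<dots> + q\<^sup>m\<^sup>-\<^sup>1\<close> for
  \<open>q = \<chi>(a)\<close>.
\<close>
definition skew_deriv :: "'h \<Rightarrow> 'h" where
  "skew_deriv y = sw y (\<lambda>u v. scale (degree_one v) u)"

lemma skew_deriv_bilinear: "bilinear_map scale scale scale (\<lambda>u v. scale (degree_one v) u)"
  by (intro hopf_lin_rules degree_one_linear)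

lemma skew_deriv_linear: "Vector_Spaces.linear scale scale skew_deriv"
  unfolding skew_deriv_def by (rule linear_sw_arg[OF skew_deriv_bilinear])

lemma skew_deriv_mult_x: "skew_deriv (y * x) = scale (\<chi> a) (skew_deriv y * x) + y"
proof -
  note rules = hopf_lin_rules degree_one_linear counit_linear lin_comp[OF degree_one_linear]
  have "skew_deriv (y * x) =
      sw y (\<lambda>u v. scale (\<chi> a) (scale (degree_one v) u * x) + scale (\<epsilon> v) u)"
    unfolding skew_deriv_def sw_mult_x[OF skew_deriv_bilinear]
    by (simp add: degree_one_mult_a degree_one_mult_x scale_mult_left)
  also have "\<dots> = sw y (\<lambda>u v. scale (\<chi> a) (scale (degree_one v) u * x)) + y"
    by (subst sw_add[where s = scale]) (intro rules | simp add: counit_right)+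
  also have "sw y (\<lambda>u v. scale (\<chi> a) (scale (degree_one v) u * x)) = scale (\<chi> a) (skew_deriv y * x)"
    unfolding skew_deriv_def
    by (rule linear_of_sw[where t = scale, OF skew_deriv_bilinear, symmetric]) (intro rules)
  finally show ?thesis .
qed

definition q_number :: "nat \<Rightarrow> 'k" where
  "q_number m = (\<Sum>i<m. \<chi> a ^ i)"

lemma q_number_zero: "q_number 0 = 0"
  by (simp add: q_number_def)

lemma q_number_nonzero: "0 < m \<Longrightarrow> m < n \<Longrightarrow> q_number m \<noteq> 0"
  using power_diff_1_eq[of "\<chi> a" m] char_a_pow_neq_one[of m] by (auto simp: q_number_def)

lemma skew_deriv_hd_basis:
  "g \<in> carrier G \<Longrightarrow> skew_deriv (\<iota> g * x ^ m) = scale (q_number m) (\<iota> g * x ^ (m - 1))"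
proof (induction m)
  case 0
  have "skew_deriv (\<iota> g) = scale (degree_one (\<iota> g)) (\<iota> g)"
    unfolding skew_deriv_def by (rule sw_iota[OF skew_deriv_bilinear 0])
  then show ?case using 0 by (simp add: degree_one_iota q_number_def)
next
  case (Suc m)
  have eq: "\<iota> g * x ^ Suc m = \<iota> g * x ^ m * x"
    by (simp add: mult.assoc power_commutes)
  have "q_number (Suc m) = \<chi> a * q_number m + 1"
    unfolding q_number_def by (simp only: sum.lessThan_Suc_shift sum_distrib_left) simp
  moreover have "scale (q_number m) (\<iota> g * x ^ (m - 1) * x) = scale (q_number m) (\<iota> g * x ^ m)"
    by (cases m) (simp_all add: q_number_def mult.assoc power_commutes)
  ultimately show ?case
    unfolding eq skew_deriv_mult_x Suc.IH[OF Suc.prems]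
    by (auto simp: scale_mult_left scale_left_distrib)
qed

lemma coord_skew_deriv:
  assumes g: "g \<in> carrier G"
  shows "coord g m (skew_deriv u) =
    (if Suc m < n then q_number (Suc m) * coord g (Suc m) u else 0)"
proof (rule linear_ext_hd_basis[where s = "(*)" and F = "\<lambda>u. coord g m (skew_deriv u)" and
      F' = "\<lambda>u. if Suc m < n then q_number (Suc m) * coord g (Suc m) u else 0"])
  show "lin_form (\<lambda>u. coord g m (skew_deriv u))"
    by (rule lin_comp[OF coord_linear skew_deriv_linear])
  show "lin_form (\<lambda>u. if Suc m < n then q_number (Suc m) * coord g (Suc m) u else 0)"
    by (cases "Suc m < n")
      (simp_all add: lin_mult_field coord_linear lin_zero vector_space_axioms vector_space_field)
  fix h k assume h: "h \<in> carrier G" "k < n"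
  then show "coord g m (skew_deriv (\<iota> h * x ^ k)) =
      (if Suc m < n then q_number (Suc m) * coord g (Suc m) (\<iota> h * x ^ k) else 0)"
    using coord_hd_basis[of h "k - 1" g m] coord_hd_basis[of h k g "Suc m"]
    unfolding skew_deriv_hd_basis[OF h(1)]
    by (cases "k = 0") (auto simp: linear_simps[OF coord_linear] q_number_zero)
qed

lemma coord_eqI:
  assumes "\<And>g m. g \<in> carrier G \<Longrightarrow> m < n \<Longrightarrow> coord g m u = coord g m v"
  shows "u = v"
  by (subst hd_basis_expansion, subst (2) hd_basis_expansion) (simp add: assms)

lemma group_part_expansion:
  assumes "\<And>g m. g \<in> carrier G \<Longrightarrow> m < n \<Longrightarrow> m \<noteq> 0 \<Longrightarrow> coord g m u = 0"
  shows "u = (\<Sum>g\<in>carrier G. scale (coord g 0 u) (\<iota> g))"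
proof -
  have "(\<Sum>m<n. scale (coord g m u) (\<iota> g * x ^ m)) = scale (coord g 0 u) (\<iota> g)"
    if g: "g \<in> carrier G" for g
  proof -
    have "(\<Sum>m<n. scale (coord g m u) (\<iota> g * x ^ m)) =
        (\<Sum>m\<in>{0}. scale (coord g m u) (\<iota> g * x ^ m))"
      using n_pos assms[OF g] by (intro sum.mono_neutral_right) auto
    then show ?thesis by simp
  qed
  then show ?thesis
    using hd_basis_expansion[of u] by simp
qed

lemma coord_x: "coord g m x = (if g = \<one> \<and> m = 1 then 1 else 0)"
  using coord_hd_basis[OF one_closed order_gt_1, of g m] by (auto simp: iota_one)

lemma coord_one: "coord g m 1 = (if g = \<one> \<and> m = 0 then 1 else 0)"
  using coord_iota[of \<one> g m] by (auto simp: iota_one)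

lemma form_pair_bilinear:
  "lin_form \<psi> \<Longrightarrow> lin_form \<omega> \<Longrightarrow> bilinear_map scale scale (*) (\<lambda>u v. \<psi> u * \<omega> v)"
  by (intro lin_rules; assumption)

lemma coord_skew_deriv_forms:
  "coord g m (skew_deriv y) = sw y (\<lambda>u v. coord g m u * degree_one v)"
  unfolding skew_deriv_def
  by (subst linear_of_sw[OF skew_deriv_bilinear coord_linear])
    (simp add: linear_simps[OF coord_linear] mult.commute)

lemma sw_group_part:
  assumes f: "bilinear_map scale scale (*) f"
  shows "sw (\<Sum>k\<in>carrier G. scale (c k) (\<iota> k)) f = (\<Sum>k\<in>carrier G. c k * f (\<iota> k) (\<iota> k))"
  by (simp add: lin_sum[OF linear_sw_arg[OF f]] linear_simps[OF linear_sw_arg[OF f]] sw_iota[OF f])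

lemma sw_group_part_coords:
  assumes "g \<in> carrier G" "h \<in> carrier G"
  shows "sw (\<Sum>k\<in>carrier G. scale (c k) (\<iota> k)) (\<lambda>u v. coord g 0 u * coord h 0 v) =
    (if g = h then c g else 0)"
proof -
  have "sw (\<Sum>k\<in>carrier G. scale (c k) (\<iota> k)) (\<lambda>u v. coord g 0 u * coord h 0 v) =
      (\<Sum>k\<in>carrier G. c k * (coord g 0 (\<iota> k) * coord h 0 (\<iota> k)))"
    by (intro sw_group_part form_pair_bilinear coord_linear)
  also have "\<dots> = (\<Sum>k\<in>carrier G. if k = g then if g = h then c g else 0 else 0)"
    by (intro sum.cong) (auto simp: coord_iota)
  finally show ?thesis using assms finite_carrier by simp
qed

text \<open>
  The assumption says \<open>\<Delta> y = y \<otimes> y\<close>.  Then \<open>y\<close> is an eigenvector of the nilpotent map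
  \<^const>\<open>skew_deriv\<close>, so it lies in its kernel, the group algebra; comparing the coefficients of
  \<open>g \<otimes> h\<close> shows that the coefficients of \<open>y\<close> are orthogonal idempotents of the field.
\<close>
lemma grouplike_cases:
  assumes y: "\<And>\<psi> \<omega>. lin_form \<psi> \<Longrightarrow> lin_form \<omega> \<Longrightarrow> sw y (\<lambda>u v. \<psi> u * \<omega> v) = \<psi> y * \<omega> y"
    and "y \<noteq> 0"
  shows "\<exists>g\<in>carrier G. y = \<iota> g"
proof -
  \<comment> \<open>\<open>skew_deriv y = degree_one y \<cdot> y\<close>, written in coordinates\<close>
  have T: "coord g m y * degree_one y =
      (if Suc m < n then q_number (Suc m) * coord g (Suc m) y else 0)" if "g \<in> carrier G" for g m
    using coord_skew_deriv[OF that, of m y]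
    by (simp add: coord_skew_deriv_forms y coord_linear degree_one_linear)
  have "degree_one y = 0"
  proof (rule ccontr)
    assume nz: "degree_one y \<noteq> 0"
    \<comment> \<open>Descending induction on the degree: a nonzero eigenvalue annihilates the top coefficients.\<close>
    have "coord g (n - k) y = 0" if "g \<in> carrier G" "0 < k" "k \<le> n" for g k
      using that(2,3)
    proof (induction k)
      case (Suc k)
      show ?case
      proof (cases "k = 0")
        case True
        then show ?thesis using T[OF that(1), of "n - 1"] nz n_pos by simp
      next
        case False
        then have "coord g (n - k) y = 0" "Suc (n - Suc k) = n - k" using Suc by auto
        then show ?thesis using T[OF that(1), of "n - Suc k"] nz by (auto split: if_splits)
      qed
    qed simp
    then have "coord g m y = 0" if "g \<in> carrier G" "m < n" for g m
      using that by (metis diff_diff_cancel diff_le_self less_imp_le zero_less_diff)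
    then have "y = 0"
      by (intro coord_eqI) (simp add: linear_simps[OF coord_linear])
    with \<open>y \<noteq> 0\<close> show False by contradiction
  qed
  then have "coord g m y = 0" if "g \<in> carrier G" "m < n" "m \<noteq> 0" for g m
    using that T[OF that(1), of "m - 1"] q_number_nonzero[of m] by simp
  then have exp: "y = (\<Sum>g\<in>carrier G. scale (coord g 0 y) (\<iota> g))"
    by (rule group_part_expansion)
  have idem: "coord g 0 y * coord h 0 y = (if g = h then coord g 0 y else 0)"
    if "g \<in> carrier G" "h \<in> carrier G" for g h
    using sw_group_part_coords[OF that, of "\<lambda>g. coord g 0 y", folded exp]
    by (simp add: y coord_linear)
  obtain g where g: "g \<in> carrier G" "coord g 0 y \<noteq> 0"
    using exp \<open>y \<noteq> 0\<close> by (metis (no_types, lifting) scale_zero_left sum.neutral)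
  have "coord g 0 y = 1" using idem[OF g(1) g(1)] g(2) by simp
  moreover have "coord h 0 y = 0" if "h \<in> carrier G" "h \<noteq> g" for h
    using idem[OF g(1) that(1)] that(2) g(2) by auto
  ultimately have "(\<Sum>h\<in>carrier G. scale (coord h 0 y) (\<iota> h)) = (\<Sum>h\<in>carrier G. if h = g then \<iota> g else 0)"
    by (intro sum.cong) auto
  then show ?thesis
    using exp g(1) finite_carrier by auto
qed

text \<open>
  The assumption says \<open>\<Delta> y = y \<otimes> b + 1 \<otimes> y\<close>.  It gives \<open>skew_deriv y = c 1 = skew_deriv (c x)\<close> for
  \<open>c = degree_one y\<close>, so \<open>z = y - c x\<close> lies in the group algebra.  The coefficients of \<open>g \<otimes> h\<close> in
  \<open>\<Delta> z\<close> show that \<open>z\<close> is a multiple of \<open>1 - b\<close>, and the coefficient of \<open>x \<otimes> b\<close>, which is absent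
  from \<open>\<Delta> z\<close>, gives \<open>c = 0\<close> unless \<open>a = b\<close>.
\<close>
lemma skew_primitive_cases:
  assumes b: "b \<in> carrier G"
    and y: "\<And>\<psi> \<omega>. lin_form \<psi> \<Longrightarrow> lin_form \<omega> \<Longrightarrow>
      sw y (\<lambda>u v. \<psi> u * \<omega> v) = \<psi> y * \<omega> (\<iota> b) + \<psi> 1 * \<omega> y"
  obtains c e where "y = scale c x + scale e (1 - \<iota> b)" "c = 0 \<or> b = a"
proof -
  define c where "c = degree_one y"
  define z where "z = y - scale c x"
  have bil: "bilinear_map scale scale (*) (\<lambda>u v. \<psi> u * \<omega> v)" if "lin_form \<psi>" "lin_form \<omega>" for \<psi> \<omega>
    using that by (rule form_pair_bilinear)
  have T: "(if g = \<one> \<and> m = 0 then c else 0) =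
      (if Suc m < n then q_number (Suc m) * coord g (Suc m) y else 0)" if "g \<in> carrier G" for g m
    using coord_skew_deriv[OF that, of m y] b
    by (auto simp: coord_skew_deriv_forms y coord_linear degree_one_linear degree_one_iota coord_one c_def
        split: if_splits)
  have "coord g m z = 0" if "g \<in> carrier G" "m < n" "m \<noteq> 0" for g m
  proof (cases "g = \<one> \<and> m = 1")
    case True
    then show ?thesis
      using T[OF that(1), of 0] order_gt_1
      by (simp add: z_def linear_simps[OF coord_linear] coord_x q_number_def)
  next
    case False
    then show ?thesis
      using T[OF that(1), of "m - 1"] that q_number_nonzero[of m]
      by (auto simp: z_def linear_simps[OF coord_linear] coord_x split: if_splits)
  qed
  then have exp: "z = (\<Sum>g\<in>carrier G. scale (coord g 0 z) (\<iota> g))"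
    by (rule group_part_expansion)
  have sw_z: "sw z (\<lambda>u v. \<psi> u * \<omega> v) =
      \<psi> y * \<omega> (\<iota> b) + \<psi> 1 * \<omega> y - c * (\<psi> x * \<omega> (\<iota> a) + \<psi> 1 * \<omega> x)"
    if "lin_form \<psi>" "lin_form \<omega>" for \<psi> \<omega>
    unfolding z_def
    by (simp add: linear_simps[OF linear_sw_arg[OF bil[OF that]]] y that sw_x[OF bil[OF that]])
  have coord_y: "coord g 0 y = coord g 0 z" for g
    by (simp add: z_def linear_simps[OF coord_linear] coord_x)
  \<comment> \<open>The coefficient of \<open>g \<otimes> h\<close> in \<open>\<Delta> z\<close>, read off from \<open>z \<in> k[G]\<close> and from the coproduct of \<open>y\<close>\<close>
  have rel: "(if g = h then coord g 0 z else 0) =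
      (if b = h then coord g 0 z else 0) + (if g = \<one> then coord h 0 z else 0)"
    if "g \<in> carrier G" "h \<in> carrier G" for g h
    using sw_group_part_coords[OF that, of "\<lambda>g. coord g 0 z", folded exp] b
    by (auto simp: sw_z coord_linear coord_iota coord_one coord_x coord_y a_closed split: if_splits)
  show thesis
  proof (rule that)
    have "coord g 0 z = coord g 0 (scale (coord \<one> 0 z) (1 - \<iota> b))" if "g \<in> carrier G" for g
      using rel[OF that that] rel[OF one_closed b] rel[OF one_closed one_closed] b that
      by (auto simp: linear_simps[OF coord_linear] coord_one coord_iota eq_neg_iff_add_eq_0 add.commute split: if_splits)
    moreover have "coord g m z = coord g m (scale (coord \<one> 0 z) (1 - \<iota> b))"
      if "g \<in> carrier G" "m < n" "m \<noteq> 0" for g m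
      using that \<open>\<And>g m. g \<in> carrier G \<Longrightarrow> m < n \<Longrightarrow> m \<noteq> 0 \<Longrightarrow> coord g m z = 0\<close> b
      by (simp add: linear_simps[OF coord_linear] coord_one coord_iota)
    ultimately have "z = scale (coord \<one> 0 z) (1 - \<iota> b)"
      by (metis coord_eqI)
    then show "y = scale c x + scale (coord \<one> 0 z) (1 - \<iota> b)"
      by (simp add: z_def algebra_simps)
  next
    have "sw z (\<lambda>u v. coord \<one> 1 u * coord b 0 v) =
        (\<Sum>k\<in>carrier G. coord k 0 z * (coord \<one> 1 (\<iota> k) * coord b 0 (\<iota> k)))"
      by (subst exp) (intro sw_group_part bil coord_linear)
    also have "\<dots> = 0"
      by (intro sum.neutral) (simp add: coord_iota)
    finally have "sw z (\<lambda>u v. coord \<one> 1 u * coord b 0 v) = 0" .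
    moreover have "coord \<one> 1 y = c"
      using T[OF one_closed, of 0] order_gt_1 by (simp add: q_number_def)
    ultimately show "c = 0 \<or> b = a"
      using b a_closed
      by (auto simp: sw_z coord_linear coord_iota coord_x coord_one split: if_splits)
  qed
qed

end


section \<open>Operations on the generators of a rank one pointed Hopf algebra\<close>

context rank_one_hopf_algebra
begin

lemma sw_iota_sw_iota:
  assumes "\<And>u1 u2. bilinear_map scale scale s (F u1 u2)"
    and "\<And>v1 v2. bilinear_map scale scale s (\<lambda>u1 u2. F u1 u2 v1 v2)"
    and "g \<in> carrier G" "h \<in> carrier G"
  shows "sw (\<iota> g) (\<lambda>u1 u2. sw (\<iota> h) (F u1 u2)) = F (\<iota> g) (\<iota> g) (\<iota> h) (\<iota> h)"
  by (simp add: sw_iota[OF assms(1,4)] sw_iota[OF assms(2,3)])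

lemma sw_x_sw_iota:
  assumes "\<And>u1 u2. bilinear_map scale scale s (F u1 u2)"
    and "\<And>v1 v2. bilinear_map scale scale s (\<lambda>u1 u2. F u1 u2 v1 v2)"
    and "g \<in> carrier G"
  shows "sw x (\<lambda>u1 u2. sw (\<iota> g) (F u1 u2)) =
    F x (\<iota> a) (\<iota> g) (\<iota> g) + F 1 x (\<iota> g) (\<iota> g)"
  by (simp add: sw_iota[OF assms(1,3)] sw_x[OF assms(2)])

lemma sw_iota_sw_x:
  assumes "\<And>u1 u2. bilinear_map scale scale s (F u1 u2)"
    and "\<And>v1 v2. bilinear_map scale scale s (\<lambda>u1 u2. F u1 u2 v1 v2)"
    and "g \<in> carrier G"
  shows "sw (\<iota> g) (\<lambda>u1 u2. sw x (F u1 u2)) =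
    F (\<iota> g) (\<iota> g) x (\<iota> a) + F (\<iota> g) (\<iota> g) 1 x"
proof -
  have "sw (\<iota> g) (\<lambda>u1 u2. F u1 u2 x (\<iota> a) + F u1 u2 1 x) =
      F (\<iota> g) (\<iota> g) x (\<iota> a) + F (\<iota> g) (\<iota> g) 1 x"
    by (simp add: sw_iota[OF assms(2,3)] sw_add[OF assms(2) assms(2)])
  then show ?thesis by (simp add: sw_x[OF assms(1)])
qed

lemma sw_x_sw_x:
  assumes "\<And>u1 u2. bilinear_map scale scale s (F u1 u2)"
    and "\<And>v1 v2. bilinear_map scale scale s (\<lambda>u1 u2. F u1 u2 v1 v2)"
  shows "sw x (\<lambda>u1 u2. sw x (F u1 u2)) =
    F x (\<iota> a) x (\<iota> a) + F x (\<iota> a) 1 x + F 1 x x (\<iota> a) + F 1 x 1 x"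
proof -
  have "sw x (\<lambda>u1 u2. F u1 u2 x (\<iota> a) + F u1 u2 1 x) =
      sw x (\<lambda>u1 u2. F u1 u2 x (\<iota> a)) + sw x (\<lambda>u1 u2. F u1 u2 1 x)"
    by (rule sw_add[OF assms(2) assms(2)])
  then show ?thesis by (simp add: sw_x[OF assms(1)] sw_x[OF assms(2)] add_ac)
qed

text \<open>
  The operation on the group induced by one on \<open>H\<close> that preserves grouplike elements.
\<close>
definition group_restriction :: "('h \<Rightarrow> 'h \<Rightarrow> 'h) \<Rightarrow> 'g \<Rightarrow> 'g \<Rightarrow> 'g" where
  "group_restriction f g h = (SOME k. k \<in> carrier G \<and> f (\<iota> g) (\<iota> h) = \<iota> k)"

lemma coord_iota_mult_x:
  "h \<in> carrier G \<Longrightarrow> coord g m (\<iota> h * x) = (if h = g \<and> m = 1 then 1 else 0)"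
  using coord_hd_basis[of h 1 g m] order_gt_1 by simp

end

text \<open>
  The consequences of the Hopf \<open>q\<close>-brace axioms from which the operations are determined.  The
  coalgebra conditions are those of \<open>q_magma_comult_dot\<close>, \<open>q_magma_comult_col\<close> and
  \<open>q_magma_compatible\<close>.  The list is symmetric in the two operations; in particular the
  compatibility appears in both orders.
\<close>
locale rank_one_operations =
  rank_one_hopf_algebra G \<chi> a \<alpha> scale \<Delta> \<epsilon> \<iota> x
  for G (structure) and \<chi> :: "'g \<Rightarrow> 'k::field" and a \<alpha>
    and scale :: "'k \<Rightarrow> 'h::ring_1 \<Rightarrow> 'h" and \<Delta> \<epsilon> \<iota> x +
  fixes p d :: "'h \<Rightarrow> 'h \<Rightarrow> 'h"
  assumes p_bilinear: "bilinear_map scale scale scale p"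
    and d_bilinear: "bilinear_map scale scale scale d"
    and comult_p: "\<lbrakk>lin_form \<psi>; lin_form \<omega>\<rbrakk> \<Longrightarrow> sw (p u v) (\<lambda>a b. \<psi> a * \<omega> b) =
      sw u (\<lambda>u1 u2. sw v (\<lambda>v1 v2. \<psi> (p u1 v2) * \<omega> (p u2 v1)))"
    and comult_d: "\<lbrakk>lin_form \<psi>; lin_form \<omega>\<rbrakk> \<Longrightarrow> sw (d u v) (\<lambda>a b. \<psi> a * \<omega> b) =
      sw u (\<lambda>u1 u2. sw v (\<lambda>v1 v2. \<psi> (d u1 v2) * \<omega> (d u2 v1)))"
    and compatible_pd: "\<lbrakk>lin_form \<psi>; lin_form \<omega>\<rbrakk> \<Longrightarrow>
      sw u (\<lambda>u1 u2. sw v (\<lambda>v1 v2. \<psi> (d v1 u2) * \<omega> (p u1 v2))) =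
      sw u (\<lambda>u1 u2. sw v (\<lambda>v1 v2. \<psi> (d v2 u1) * \<omega> (p u2 v1)))"
    and compatible_dp: "\<lbrakk>lin_form \<psi>; lin_form \<omega>\<rbrakk> \<Longrightarrow>
      sw u (\<lambda>u1 u2. sw v (\<lambda>v1 v2. \<psi> (p v1 u2) * \<omega> (d u1 v2))) =
      sw u (\<lambda>u1 u2. sw v (\<lambda>v1 v2. \<psi> (p v2 u1) * \<omega> (d u2 v1)))"
    and p_one: "p h 1 = h"
    and p_mult: "p h (k * l) = p (p h l) k"
    and d_one: "d h 1 = h"
    and d_mult: "d h (k * l) = d (d h l) k"
    and mult_p: "p (h * k) l = sw l (\<lambda>l1 l2. sw k (\<lambda>k1 k2. p h (d l1 k2) * p k1 l2))"
    and mult_d: "d (h * k) l = sw l (\<lambda>l1 l2. sw k (\<lambda>k1 k2. d h (p l1 k2) * d k1 l2))"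
    and p_x_x_nonzero: "p x x \<noteq> 0"
    and d_x_x_nonzero: "d x x \<noteq> 0"
begin

lemma swapped: "rank_one_operations G \<chi> a \<alpha> scale \<Delta> \<epsilon> \<iota> x d p"
  by (intro rank_one_operations.intro rank_one_hopf_algebra_axioms rank_one_operations_axioms.intro)
    (fact p_bilinear d_bilinear comult_p comult_d compatible_pd compatible_dp p_one p_mult d_one
      d_mult mult_p mult_d p_x_x_nonzero d_x_x_nonzero)+

lemmas op_rules =
  hopf_lin_rules linear_bilinear_left[OF p_bilinear] linear_bilinear_right[OF p_bilinear]
  linear_bilinear_left[OF d_bilinear] linear_bilinear_right[OF d_bilinear]

lemmas op_simps =
  linear_simps[OF bilinear_map_linear(1)[OF p_bilinear]] linear_simps[OF bilinear_map_linear(2)[OF p_bilinear]]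
  linear_simps[OF bilinear_map_linear(1)[OF d_bilinear]] linear_simps[OF bilinear_map_linear(2)[OF d_bilinear]]

abbreviation dot :: "'g \<Rightarrow> 'g \<Rightarrow> 'g" where "dot \<equiv> group_restriction p"

lemma p_iota_inv:
  "g \<in> carrier G \<Longrightarrow> p (p u (\<iota> g)) (\<iota> (inv g)) = u" "g \<in> carrier G \<Longrightarrow> p (p u (\<iota> (inv g))) (\<iota> g) = u"
  by (simp_all add: iota_mult iota_one p_one flip: p_mult)

text \<open>
  The value is grouplike, and it is not zero because acting by \<open>h\<close> is invertible.
\<close>
lemma dot:
  assumes g: "g \<in> carrier G" and h: "h \<in> carrier G"
  shows dot_closed: "dot g h \<in> carrier G" and p_iota: "p (\<iota> g) (\<iota> h) = \<iota> (dot g h)"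
proof -
  have "\<exists>k\<in>carrier G. p (\<iota> g) (\<iota> h) = \<iota> k"
  proof (rule grouplike_cases)
    fix \<psi> \<omega> assume \<psi>: "lin_form \<psi>" and \<omega>: "lin_form \<omega>"
    note rules = op_rules lin_comp[OF \<psi>] lin_comp[OF \<omega>]
    show "sw (p (\<iota> g) (\<iota> h)) (\<lambda>u v. \<psi> u * \<omega> v) = \<psi> (p (\<iota> g) (\<iota> h)) * \<omega> (p (\<iota> g) (\<iota> h))"
      unfolding comult_p[OF \<psi> \<omega>] by (rule sw_iota_sw_iota[where s = "(*)"]) (intro rules g h)+
  next
    show "p (\<iota> g) (\<iota> h) \<noteq> 0"
      using p_iota_inv(1)[OF h, of "\<iota> g"] iota_nonzero[OF g] by (auto simp: op_simps)
  qed
  then have "\<exists>k. k \<in> carrier G \<and> p (\<iota> g) (\<iota> h) = \<iota> k" by blast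
  from someI_ex[OF this] show "dot g h \<in> carrier G" "p (\<iota> g) (\<iota> h) = \<iota> (dot g h)"
    unfolding group_restriction_def by blast+
qed

text \<open>
  The multiplicativity axiom at \<open>1 = 1 1\<close> makes the grouplike element \<open>1 \<cdot> g\<close> idempotent.
\<close>
lemma p_one_iota: "g \<in> carrier G \<Longrightarrow> p 1 (\<iota> g) = 1"
proof -
  assume g: "g \<in> carrier G"
  have "p 1 (\<iota> g) = p (1 * \<iota> \<one>) (\<iota> g)" by (simp add: iota_one)
  also have "\<dots> = p 1 (d (\<iota> g) (\<iota> \<one>)) * p (\<iota> \<one>) (\<iota> g)"
    unfolding mult_p by (rule sw_iota_sw_iota[where s = scale]) (intro op_rules g one_closed)+
  finally have "p 1 (\<iota> g) = p 1 (\<iota> g) * p 1 (\<iota> g)"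
    by (simp add: iota_one d_one)
  then have "\<iota> (dot \<one> g) = \<iota> (dot \<one> g \<otimes> dot \<one> g)"
    using p_iota[OF one_closed g] dot_closed[OF one_closed g] by (simp add: iota_one iota_mult)
  then have "dot \<one> g = dot \<one> g \<otimes> dot \<one> g"
    using dot_closed[OF one_closed g] iota_inj by blast
  then have "dot \<one> g = \<one>"
    using dot_closed[OF one_closed g] by (metis l_cancel_one)
  then show "p 1 (\<iota> g) = 1"
    using p_iota[OF one_closed g] by (simp add: iota_one)
qed

text \<open>
  The element \<open>x \<cdot> g\<close> is skew primitive for \<open>(a \<cdot> g, 1)\<close>.  If it had no component in \<open>x\<close>, it would
  lie in the group algebra, and so would \<open>x = (x \<cdot> g) \<cdot> g\<^sup>-\<^sup>1\<close>.
\<close>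
lemma p_x_iota_cases:
  assumes g: "g \<in> carrier G"
  shows "dot a g = a" and "\<exists>c e. c \<noteq> 0 \<and> p x (\<iota> g) = scale c x + scale e (1 - \<iota> a)"
proof -
  have b: "dot a g \<in> carrier G" using dot_closed a_closed g by blast
  obtain c e where eq: "p x (\<iota> g) = scale c x + scale e (1 - \<iota> (dot a g))" and c: "c = 0 \<or> dot a g = a"
  proof (rule skew_primitive_cases[OF b, of "p x (\<iota> g)"])
    fix \<psi> \<omega> assume \<psi>: "lin_form \<psi>" and \<omega>: "lin_form \<omega>"
    note rules = op_rules lin_comp[OF \<psi>] lin_comp[OF \<omega>]
    have "sw (p x (\<iota> g)) (\<lambda>u v. \<psi> u * \<omega> v) =
        \<psi> (p x (\<iota> g)) * \<omega> (p (\<iota> a) (\<iota> g)) + \<psi> (p 1 (\<iota> g)) * \<omega> (p x (\<iota> g))"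
      unfolding comult_p[OF \<psi> \<omega>] by (rule sw_x_sw_iota[where s = "(*)"]) (intro rules g)+
    then show "sw (p x (\<iota> g)) (\<lambda>u v. \<psi> u * \<omega> v) =
        \<psi> (p x (\<iota> g)) * \<omega> (\<iota> (dot a g)) + \<psi> 1 * \<omega> (p x (\<iota> g))"
      by (simp add: p_one_iota g p_iota a_closed)
  qed
  have "c \<noteq> 0"
  proof
    assume "c = 0"
    then have "x = scale e (p (1 - \<iota> (dot a g)) (\<iota> (inv g)))"
      using eq p_iota_inv(1)[OF g, of x] by (simp add: op_simps)
    then have "x = scale e (1 - \<iota> (dot (dot a g) (inv g)))"
      using b g by (simp add: op_simps p_one_iota p_iota)
    then have "coord \<one> 1 x = coord \<one> 1 (scale e (1 - \<iota> (dot (dot a g) (inv g))))"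
      by (rule arg_cong)
    then show False
      using b g dot_closed by (simp add: linear_simps[OF coord_linear] coord_x coord_one coord_iota)
  qed
  with c show "dot a g = a" by blast
  with eq \<open>c \<noteq> 0\<close> show "\<exists>c e. c \<noteq> 0 \<and> p x (\<iota> g) = scale c x + scale e (1 - \<iota> a)"
    by auto
qed

lemma p_a_iota: "g \<in> carrier G \<Longrightarrow> p (\<iota> a) (\<iota> g) = \<iota> a"
  using p_iota[of a g] p_x_iota_cases(1)[of g] a_closed by simp

text \<open>
  The compatibility at \<open>x, g\<close> reads
  \<open>(g : a) \<otimes> (x \<cdot> g) + (g : x) \<otimes> 1 = (g : x) \<otimes> a + g \<otimes> (x \<cdot> g)\<close>.  Since \<open>x \<cdot> g\<close> involves \<open>x\<close>, the
  coefficient of \<open>x\<close> in the second leg gives \<open>g : a = g\<close>, and the coefficient of \<open>1\<close> then gives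
  \<open>g : x = 0\<close>.
\<close>
lemma d_iota_x_and_a:
  assumes g: "g \<in> carrier G"
  shows "d (\<iota> g) (\<iota> a) = \<iota> g" and "d (\<iota> g) x = 0"
proof -
  interpret swap: rank_one_operations G \<chi> a \<alpha> scale \<Delta> \<epsilon> \<iota> x d p by (rule swapped)
  define k where "k = swap.dot g a"
  have k: "k \<in> carrier G" "d (\<iota> g) (\<iota> a) = \<iota> k"
    using swap.dot_closed[OF g a_closed] swap.p_iota[OF g a_closed] by (simp_all add: k_def)
  obtain c e where c: "c \<noteq> 0" and px: "p x (\<iota> g) = scale c x + scale e (1 - \<iota> a)"
    using p_x_iota_cases(2)[OF g] by blast
  have eq: "\<psi> (\<iota> k) * \<omega> (p x (\<iota> g)) + \<psi> (d (\<iota> g) x) * \<omega> 1 =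
      \<psi> (d (\<iota> g) x) * \<omega> (\<iota> a) + \<psi> (\<iota> g) * \<omega> (p x (\<iota> g))"
    if \<psi>: "lin_form \<psi>" and \<omega>: "lin_form \<omega>" for \<psi> \<omega>
  proof -
    note rules = op_rules lin_comp[OF \<psi>] lin_comp[OF \<omega>]
    have "sw x (\<lambda>u1 u2. sw (\<iota> g) (\<lambda>v1 v2. \<psi> (d v1 u2) * \<omega> (p u1 v2))) =
        \<psi> (d (\<iota> g) (\<iota> a)) * \<omega> (p x (\<iota> g)) + \<psi> (d (\<iota> g) x) * \<omega> (p 1 (\<iota> g))"
      by (rule sw_x_sw_iota[where s = "(*)"]) (intro rules g)+
    moreover have "sw x (\<lambda>u1 u2. sw (\<iota> g) (\<lambda>v1 v2. \<psi> (d v2 u1) * \<omega> (p u2 v1))) =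
        \<psi> (d (\<iota> g) x) * \<omega> (p (\<iota> a) (\<iota> g)) + \<psi> (d (\<iota> g) 1) * \<omega> (p x (\<iota> g))"
      by (rule sw_x_sw_iota[where s = "(*)"]) (intro rules g)+
    ultimately show ?thesis
      using compatible_pd[OF \<psi> \<omega>, of x "\<iota> g"] by (simp add: k g p_one_iota p_a_iota d_one)
  qed
  note simps = px linear_simps[OF coord_linear] coord_x coord_one coord_iota a_closed a_neq_one
  \<comment> \<open>The forms are the coefficients of \<open>g\<close> in the first leg and of \<open>x\<close> in the second.\<close>
  have "coord g 0 (\<iota> k) = coord g 0 (\<iota> g)"
    using eq[OF coord_linear[of g 0] coord_linear[of \<one> 1]] c by (simp add: simps)
  then have "k = g"
    using k g by (simp add: coord_iota split: if_splits)
  then show "d (\<iota> g) (\<iota> a) = \<iota> g" using k by simp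
  have "coord h m (d (\<iota> g) x) = coord h m 0" for h m
    using eq[OF coord_linear[of h m] coord_linear[of \<one> 0]] \<open>k = g\<close> by (simp add: simps)
  then show "d (\<iota> g) x = 0" by (intro coord_eqI)
qed

end

context rank_one_operations
begin

interpretation swap: rank_one_operations G \<chi> a \<alpha> scale \<Delta> \<epsilon> \<iota> x d p by (rule swapped)

lemmas p_iota_x_and_a = swap.d_iota_x_and_a

lemma one_x: "p 1 x = 0" "d 1 x = 0"
  using p_iota_x_and_a(2)[OF one_closed] d_iota_x_and_a(2)[OF one_closed] by (simp_all add: iota_one)

lemma p_mult_iota:
  assumes g: "g \<in> carrier G"
  shows "p (u * x) (\<iota> g) = p u (\<iota> g) * p x (\<iota> g)"
    and "h \<in> carrier G \<Longrightarrow> p (u * \<iota> h) (\<iota> g) = p u (\<iota> (swap.dot g h)) * \<iota> (dot h g)"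
proof -
  have "p (u * x) (\<iota> g) =
      p u (d (\<iota> g) (\<iota> a)) * p x (\<iota> g) + p u (d (\<iota> g) x) * p 1 (\<iota> g)"
    unfolding mult_p by (rule sw_iota_sw_x[where s = scale]) (intro op_rules g)+
  then show "p (u * x) (\<iota> g) = p u (\<iota> g) * p x (\<iota> g)"
    using g by (simp add: d_iota_x_and_a op_simps)
  assume h: "h \<in> carrier G"
  have "p (u * \<iota> h) (\<iota> g) = p u (d (\<iota> g) (\<iota> h)) * p (\<iota> h) (\<iota> g)"
    unfolding mult_p by (rule sw_iota_sw_iota[where s = scale]) (intro op_rules g h)+
  then show "p (u * \<iota> h) (\<iota> g) = p u (\<iota> (swap.dot g h)) * \<iota> (dot h g)"
    using g h by (simp add: p_iota swap.p_iota)
qed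

text \<open>
  Expanding \<open>x a \<cdot> g\<close> directly and as \<open>\<chi>(a) a x \<cdot> g\<close> multiplies the component of \<open>x \<cdot> g\<close> along
  \<open>1 - a\<close> by \<open>1\<close> and by \<open>\<chi>(a) \<noteq> 1\<close>.
\<close>
lemma p_x_iota_scale:
  assumes g: "g \<in> carrier G"
  shows "\<exists>c. c \<noteq> 0 \<and> p x (\<iota> g) = scale c x"
proof -
  obtain c e where c: "c \<noteq> 0" and px: "p x (\<iota> g) = scale c x + scale e (1 - \<iota> a)"
    using p_x_iota_cases(2)[OF g] by blast
  have "\<iota> (swap.dot g a) = \<iota> g"
    using d_iota_x_and_a(1)[OF g] swap.p_iota[OF g a_closed] by simp
  then have "swap.dot g a = g"
    using g a_closed swap.dot_closed iota_inj by blast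
  then have "p (x * \<iota> a) (\<iota> g) = p x (\<iota> g) * \<iota> a"
    using p_mult_iota(2)[OF g a_closed, of x] p_x_iota_cases(1)[OF g] by simp
  moreover have "p (x * \<iota> a) (\<iota> g) = scale (\<chi> a) (\<iota> a * p x (\<iota> g))"
    using p_mult_iota(1)[OF g, of "\<iota> a"] g a_closed by (simp add: x_iota op_simps p_a_iota)
  ultimately have "coord a 0 (p x (\<iota> g) * \<iota> a) = coord a 0 (scale (\<chi> a) (\<iota> a * p x (\<iota> g)))"
    by simp
  moreover have "\<iota> a * \<iota> a = \<iota> (a \<otimes> a)" "a \<otimes> a \<noteq> a"
    using a_closed a_neq_one by (simp_all add: iota_mult)
  ultimately have "e = \<chi> a * e"
    using a_closed
    by (simp add: px linear_simps[OF coord_linear] algebra_simps scale_mult_left scale_mult_right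
        x_iota coord_iota coord_iota_mult_x)
  then have "e = 0" using char_a_neq_one by simp
  then show ?thesis using c px by auto
qed

text \<open>
  The element \<open>x \<cdot> x\<close> is skew primitive, say \<open>\<xi> x + e (1 - a)\<close>, and \<open>x \<cdot> g = c x\<close>.  Evaluating
  \<open>x \<cdot> x g\<close> as \<open>(x \<cdot> g) \<cdot> x\<close> and as \<open>\<chi>(g) ((x \<cdot> x) \<cdot> g)\<close> gives \<open>c \<xi> = \<chi>(g) c \<xi>\<close> and
  \<open>c e = \<chi>(g) e\<close>.  The first equation at \<open>g = a\<close> yields \<open>\<xi> = 0\<close>; as \<open>x \<cdot> x \<noteq> 0\<close>, the second then
  determines \<open>c\<close>.
\<close>
lemma p_x_x_and_p_x_iota:
  shows "\<exists>e. e \<noteq> 0 \<and> p x x = scale e (1 - \<iota> a)"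
    and "g \<in> carrier G \<Longrightarrow> p x (\<iota> g) = scale (\<chi> g) x"
proof -
  obtain \<xi> e where eq: "p x x = scale \<xi> x + scale e (1 - \<iota> a)"
  proof (rule skew_primitive_cases[OF a_closed, of "p x x"])
    fix \<psi> \<omega> assume \<psi>: "lin_form \<psi>" and \<omega>: "lin_form \<omega>"
    note rules = op_rules lin_comp[OF \<psi>] lin_comp[OF \<omega>]
    have "sw (p x x) (\<lambda>u v. \<psi> u * \<omega> v) =
        \<psi> (p x (\<iota> a)) * \<omega> (p (\<iota> a) x) + \<psi> (p x x) * \<omega> (p (\<iota> a) 1) +
        \<psi> (p 1 (\<iota> a)) * \<omega> (p x x) + \<psi> (p 1 x) * \<omega> (p x 1)"
      unfolding comult_p[OF \<psi> \<omega>] by (rule sw_x_sw_x[where s = "(*)"]) (intro rules)+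
    then show "sw (p x x) (\<lambda>u v. \<psi> u * \<omega> v) = \<psi> (p x x) * \<omega> (\<iota> a) + \<psi> 1 * \<omega> (p x x)"
      by (simp add: p_iota_x_and_a a_closed p_one one_x p_one_iota linear_simps[OF \<psi>] linear_simps[OF \<omega>])
  qed
  have rel: "\<exists>c. c \<noteq> 0 \<and> p x (\<iota> g) = scale c x \<and> c * \<xi> = \<chi> g * c * \<xi> \<and> c * e = \<chi> g * e"
    if g: "g \<in> carrier G" for g
  proof -
    obtain c where c: "c \<noteq> 0" "p x (\<iota> g) = scale c x"
      using p_x_iota_scale[OF g] by blast
    have "p x (x * \<iota> g) = scale c (p x x)"
      by (simp add: p_mult c op_simps)
    moreover have "p x (x * \<iota> g) = scale (\<chi> g) (p (p x x) (\<iota> g))"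
      by (simp add: x_iota g op_simps p_mult)
    ultimately have *: "scale c (p x x) = scale (\<chi> g) (p (p x x) (\<iota> g))" by simp
    have "p (p x x) (\<iota> g) = scale (\<xi> * c) x + scale e (1 - \<iota> a)"
      using g by (simp add: eq op_simps c p_one_iota p_a_iota)
    with * have **: "scale c (scale \<xi> x + scale e (1 - \<iota> a)) =
        scale (\<chi> g) (scale (\<xi> * c) x + scale e (1 - \<iota> a))"
      by (simp add: eq)
    note simps = linear_simps[OF coord_linear] coord_x coord_one coord_iota a_closed a_neq_one
    have "c * \<xi> = \<chi> g * c * \<xi>"
      using arg_cong[OF **, of "coord \<one> 1"] by (simp add: simps mult_ac)
    moreover have "c * e = \<chi> g * e"
      using arg_cong[OF **, of "coord \<one> 0"] by (simp add: simps)
    ultimately show ?thesis using c by blast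
  qed
  have "\<xi> = 0" using rel[OF a_closed] char_a_neq_one by auto
  then have e: "e \<noteq> 0" using eq p_x_x_nonzero by auto
  then show "\<exists>e. e \<noteq> 0 \<and> p x x = scale e (1 - \<iota> a)" using eq \<open>\<xi> = 0\<close> by auto
  show "p x (\<iota> g) = scale (\<chi> g) x" if "g \<in> carrier G"
    using rel[OF that] e by auto
qed

lemmas p_x_x = p_x_x_and_p_x_iota(1)
lemmas p_x_iota = p_x_x_and_p_x_iota(2)

end


section \<open>The group structure and the parameter\<close>

context rank_one_operations
begin

interpretation swap: rank_one_operations G \<chi> a \<alpha> scale \<Delta> \<epsilon> \<iota> x d p by (rule swapped)

abbreviation col :: "'g \<Rightarrow> 'g \<Rightarrow> 'g" where "col \<equiv> group_restriction d"

text \<open>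
  The compatibility at \<open>x, x\<close>, tested on the coefficients of \<open>x \<otimes> x\<close> and of \<open>1 \<otimes> 1\<close>.
\<close>
lemma opposite_parameters:
  assumes px: "p x x = scale e (1 - \<iota> a)" and dx: "d x x = scale e' (1 - \<iota> a)"
  shows "(\<chi> a)\<^sup>2 = 1" and "e' = - e"
proof -
  have eq: "(\<chi> a)\<^sup>2 * (\<psi> x * \<omega> x) + e * (\<psi> 1 * \<omega> (1 - \<iota> a)) + e' * (\<psi> (1 - \<iota> a) * \<omega> 1) =
      e' * (\<psi> (1 - \<iota> a) * \<omega> (\<iota> a)) + e * (\<psi> (\<iota> a) * \<omega> (1 - \<iota> a)) + \<psi> x * \<omega> x"
    if \<psi>: "lin_form \<psi>" and \<omega>: "lin_form \<omega>" for \<psi> \<omega>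
  proof -
    note rules = op_rules lin_comp[OF \<psi>] lin_comp[OF \<omega>]
    have "sw x (\<lambda>u1 u2. sw x (\<lambda>v1 v2. \<psi> (d v1 u2) * \<omega> (p u1 v2))) =
        \<psi> (d x (\<iota> a)) * \<omega> (p x (\<iota> a)) + \<psi> (d 1 (\<iota> a)) * \<omega> (p x x) +
        \<psi> (d x x) * \<omega> (p 1 (\<iota> a)) + \<psi> (d 1 x) * \<omega> (p 1 x)"
      by (rule sw_x_sw_x[where s = "(*)"]) (intro rules)+
    moreover have "sw x (\<lambda>u1 u2. sw x (\<lambda>v1 v2. \<psi> (d v2 u1) * \<omega> (p u2 v1))) =
        \<psi> (d (\<iota> a) x) * \<omega> (p (\<iota> a) x) + \<psi> (d x x) * \<omega> (p (\<iota> a) 1) +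
        \<psi> (d (\<iota> a) 1) * \<omega> (p x x) + \<psi> (d x 1) * \<omega> (p x 1)"
      by (rule sw_x_sw_x[where s = "(*)"]) (intro rules)+
    ultimately show ?thesis
      using compatible_pd[OF \<psi> \<omega>, of x x]
      by (simp add: px dx p_x_iota swap.p_x_iota a_closed one_x p_one_iota swap.p_one_iota p_one d_one
          p_iota_x_and_a d_iota_x_and_a linear_simps[OF \<psi>] linear_simps[OF \<omega>] power2_eq_square
          mult_ac)
  qed
  note simps = linear_simps[OF coord_linear] coord_x coord_one coord_iota a_closed a_neq_one
  show "(\<chi> a)\<^sup>2 = 1"
    using eq[OF coord_linear coord_linear, of \<one> 1 \<one> 1] by (simp add: simps)
  show "e' = - e"
    using eq[OF coord_linear coord_linear, of \<one> 0 \<one> 0] by (simp add: simps eq_neg_iff_add_eq_0 add.commute)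
qed

lemma order_eq_two: "n = 2"
proof -
  obtain e e' where "p x x = scale e (1 - \<iota> a)" "d x x = scale e' (1 - \<iota> a)"
    using p_x_x swap.p_x_x by blast
  from opposite_parameters(1)[OF this] show ?thesis
    using char_a_pow_neq_one[of 2] order_gt_1 by fastforce
qed

lemma p_iota_mult_x:
  assumes h: "h \<in> carrier G" and g: "g \<in> carrier G"
  shows "p (\<iota> h * x) (\<iota> g) = scale (\<chi> g) (\<iota> (dot h g) * x)"
    and "p (\<iota> h) (\<iota> g * x) = 0"
  using p_mult_iota(1)[OF g, of "\<iota> h"] h g
  by (simp_all add: p_x_iota p_iota scale_mult_right p_mult p_iota_x_and_a op_simps)

lemma dot_a: "g \<in> carrier G \<Longrightarrow> dot g a = g"
  using p_iota_x_and_a(1)[of g] p_iota[of g a] iota_inj[OF dot_closed[of g a]] a_closed by simp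

lemma col_a: "g \<in> carrier G \<Longrightarrow> col g a = g"
  using d_iota_x_and_a(1)[of g] swap.p_iota[of g a] iota_inj[OF swap.dot_closed[of g a]] a_closed by simp

lemma dot_of_a: "g \<in> carrier G \<Longrightarrow> dot a g = a"
  by (rule p_x_iota_cases(1))

lemma p_iota_mult_x_x:
  assumes h: "h \<in> carrier G" and g: "g \<in> carrier G" and px: "p x x = scale e (1 - \<iota> a)"
  shows "p (\<iota> h * x) (\<iota> g * x) = scale e (\<iota> (dot h g) * (1 - \<iota> a))"
proof -
  obtain e' where dx: "d x x = scale e' (1 - \<iota> a)" using swap.p_x_x by blast
  have "p (\<iota> h * x) x =
      p (\<iota> h) (d x (\<iota> a)) * p x (\<iota> a) + p (\<iota> h) (d x x) * p 1 (\<iota> a) +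
      p (\<iota> h) (d 1 (\<iota> a)) * p x x + p (\<iota> h) (d 1 x) * p 1 x"
    unfolding mult_p by (rule sw_x_sw_x[where s = scale]) (intro op_rules)+
  also have "\<dots> = scale e (\<iota> h - \<iota> (h \<otimes> a))"
    using h by (simp add: p_x_iota swap.p_x_iota a_closed p_iota_x_and_a one_x dx px op_simps p_one
        swap.p_one_iota scale_mult_right iota_mult algebra_simps)
  finally have "p (\<iota> h * x) (\<iota> g * x) = scale e (p (\<iota> h) (\<iota> g) - p (\<iota> h * \<iota> a) (\<iota> g))"
    using h a_closed by (simp add: p_mult op_simps iota_mult)
  also have "p (\<iota> h * \<iota> a) (\<iota> g) = \<iota> (dot h g) * \<iota> a"
    using p_mult_iota(2)[OF g a_closed, of "\<iota> h"] h g
    by (simp add: dot_of_a p_iota col_a)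
  finally show ?thesis
    using h g by (simp add: p_iota right_diff_distrib)
qed

end

context rank_one_operations
begin

interpretation swap: rank_one_operations G \<chi> a \<alpha> scale \<Delta> \<epsilon> \<iota> x d p by (rule swapped)

text \<open>
  Two expansions of \<open>x g \<cdot> l = \<chi>(g) g x \<cdot> l\<close>.
\<close>
lemma char_dot_col:
  assumes g: "g \<in> carrier G" and l: "l \<in> carrier G"
  shows "\<chi> (col l g) * \<chi> (dot g l) = \<chi> g * \<chi> l"
proof -
  have "p (x * \<iota> g) (\<iota> l) = scale (\<chi> (col l g) * \<chi> (dot g l)) (\<iota> (dot g l) * x)"
    using p_mult_iota(2)[OF l g, of x] g l
    by (simp add: p_x_iota swap.dot_closed dot_closed scale_mult_left x_iota)
  moreover have "p (x * \<iota> g) (\<iota> l) = scale (\<chi> g * \<chi> l) (\<iota> (dot g l) * x)"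
    using g l by (simp add: x_iota op_simps p_iota_mult_x)
  ultimately have "coord (dot g l) 1 (scale (\<chi> (col l g) * \<chi> (dot g l)) (\<iota> (dot g l) * x)) =
      coord (dot g l) 1 (scale (\<chi> g * \<chi> l) (\<iota> (dot g l) * x))"
    by metis
  then show ?thesis
    using dot_closed[OF g l] by (simp add: linear_simps[OF coord_linear] coord_iota_mult_x)
qed

text \<open>
  The first cycle identity at \<open>x, g, x\<close> is \<open>(x \<cdot> g) \<cdot> (x : g) = (x \<cdot> x) \<cdot> g\<close>.
\<close>
lemma char_squared:
  assumes cycle: "\<And>u v w. sw v (\<lambda>v1 v2. p (p u v1) (d w v2)) = sw w (\<lambda>w1 w2. p (p u w2) (p v w1))"
    and g: "g \<in> carrier G"
  shows "(\<chi> g)\<^sup>2 = 1"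
proof -
  obtain e where e: "e \<noteq> 0" "p x x = scale e (1 - \<iota> a)" using p_x_x by blast
  have "sw (\<iota> g) (\<lambda>v1 v2. p (p x v1) (d x v2)) = p (p x (\<iota> g)) (d x (\<iota> g))"
    by (rule sw_iota[where s = scale]) (intro op_rules g)+
  moreover have "sw x (\<lambda>w1 w2. p (p x w2) (p (\<iota> g) w1)) =
      p (p x (\<iota> a)) (p (\<iota> g) x) + p (p x x) (p (\<iota> g) 1)"
    by (rule sw_x[where s = scale]) (intro op_rules)+
  ultimately have "scale ((\<chi> g)\<^sup>2 * e) (1 - \<iota> a) = scale e (1 - \<iota> a)"
    using cycle[of "\<iota> g" x x] g
    by (simp add: p_x_iota swap.p_x_iota p_iota_x_and_a op_simps p_one p_one_iota p_a_iota e
        power2_eq_square mult_ac)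
  then have "coord \<one> 0 (scale ((\<chi> g)\<^sup>2 * e) (1 - \<iota> a)) = coord \<one> 0 (scale e (1 - \<iota> a))"
    by (rule arg_cong)
  then show ?thesis
    using e a_closed a_neq_one by (simp add: linear_simps[OF coord_linear] coord_one coord_iota)
qed

lemma star_formulas_hold:
  "\<exists>\<mu>. \<mu> \<noteq> 0 \<and> star_formulas G \<chi> a scale \<iota> x dot col \<mu> p d"
proof -
  obtain e where e: "e \<noteq> 0" "p x x = scale e (1 - \<iota> a)" using p_x_x by blast
  obtain e' where "d x x = scale e' (1 - \<iota> a)" using swap.p_x_x by blast
  with opposite_parameters(2)[OF e(2)] have d: "d x x = scale (- e) (1 - \<iota> a)" by blast
  have "star_formulas G \<chi> a scale \<iota> x dot col e p d"
    unfolding star_formulas_def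
    using p_iota_mult_x p_iota_mult_x_x[OF _ _ e(2)] swap.p_iota_mult_x swap.p_iota_mult_x_x[OF _ _ d]
    by (simp add: scale_minus_left)
  with e(1) show ?thesis by blast
qed

lemma group_structure:
  assumes cycle: "\<And>u v w. sw v (\<lambda>v1 v2. p (p u v1) (d w v2)) = sw w (\<lambda>w1 w2. p (p u w2) (p v w1))"
    "\<And>u v w. sw v (\<lambda>v1 v2. d (p u v1) (p w v2)) = sw w (\<lambda>w1 w2. p (d u w2) (d v w1))"
    "\<And>u v w. sw v (\<lambda>v1 v2. d (d u v1) (d w v2)) = sw w (\<lambda>w1 w2. d (d u w2) (p v w1))"
  shows "group_q_brace G dot col"
proof -
  note closed = dot_closed swap.dot_closed
  have eqI: "g = h" if "\<iota> g = \<iota> h" "g \<in> carrier G" "h \<in> carrier G" for g h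
    using that iota_inj by blast
  have cyc: "sw (\<iota> v) F = F (\<iota> v) (\<iota> v)" if "v \<in> carrier G" "bilinear_map scale scale scale F" for v F
    using that by (intro sw_iota)
  have cycle1: "p (p (\<iota> u) (\<iota> v)) (d (\<iota> w) (\<iota> v)) = p (p (\<iota> u) (\<iota> w)) (p (\<iota> v) (\<iota> w))"
    and cycle2: "d (p (\<iota> u) (\<iota> v)) (p (\<iota> w) (\<iota> v)) = p (d (\<iota> u) (\<iota> w)) (d (\<iota> v) (\<iota> w))"
    and cycle3: "d (d (\<iota> u) (\<iota> v)) (d (\<iota> w) (\<iota> v)) = d (d (\<iota> u) (\<iota> w)) (p (\<iota> v) (\<iota> w))"
    if "u \<in> carrier G" "v \<in> carrier G" "w \<in> carrier G" for u v w
  proof -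
    show "p (p (\<iota> u) (\<iota> v)) (d (\<iota> w) (\<iota> v)) = p (p (\<iota> u) (\<iota> w)) (p (\<iota> v) (\<iota> w))"
      by (rule trans[OF trans[OF sym[OF cyc[OF that(2)]] cycle(1)] cyc[OF that(3)]]) (intro op_rules)+
    show "d (p (\<iota> u) (\<iota> v)) (p (\<iota> w) (\<iota> v)) = p (d (\<iota> u) (\<iota> w)) (d (\<iota> v) (\<iota> w))"
      by (rule trans[OF trans[OF sym[OF cyc[OF that(2)]] cycle(2)] cyc[OF that(3)]]) (intro op_rules)+
    show "d (d (\<iota> u) (\<iota> v)) (d (\<iota> w) (\<iota> v)) = d (d (\<iota> u) (\<iota> w)) (p (\<iota> v) (\<iota> w))"
      by (rule trans[OF trans[OF sym[OF cyc[OF that(2)]] cycle(3)] cyc[OF that(3)]]) (intro op_rules)+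
  qed
  have inv: "dot (dot g h) (inv h) = g" "dot (dot g (inv h)) h = g"
    "col (col g h) (inv h) = g" "col (col g (inv h)) h = g"
    if "g \<in> carrier G" "h \<in> carrier G" for g h
    using that p_iota_inv[of h "\<iota> g"] swap.p_iota_inv[of h "\<iota> g"]
    by (intro eqI; simp add: p_iota swap.p_iota closed)+
  show ?thesis
  proof unfold_locales
    fix h assume h: "h \<in> carrier G"
    show "bij_betw (\<lambda>g. dot g h) (carrier G) (carrier G)"
      by (rule bij_betw_byWitness[where f' = "\<lambda>g. dot g (inv h)"]) (auto simp: h inv closed)
    show "bij_betw (\<lambda>g. col g h) (carrier G) (carrier G)"
      by (rule bij_betw_byWitness[where f' = "\<lambda>g. col g (inv h)"]) (auto simp: h inv closed)
    show "dot h \<one> = h" "col h \<one> = h"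
      using h p_iota[OF h one_closed] swap.p_iota[OF h one_closed]
      by (intro eqI; simp add: closed iota_one p_one d_one)+
  next
    fix u v w assume uvw: "u \<in> carrier G" "v \<in> carrier G" "w \<in> carrier G"
    show "dot (dot u v) (col w v) = dot (dot u w) (dot v w)"
      using uvw cycle1[OF uvw] by (intro eqI) (simp_all add: p_iota swap.p_iota closed)
    show "col (dot u v) (dot w v) = dot (col u w) (col v w)"
      using uvw cycle2[OF uvw] by (intro eqI) (simp_all add: p_iota swap.p_iota closed)
    show "col (col u v) (col w v) = col (col u w) (dot v w)"
      using uvw cycle3[OF uvw] by (intro eqI) (simp_all add: p_iota swap.p_iota closed)
    show "dot u (v \<otimes> w) = dot (dot u w) v"
      using uvw p_mult[of "\<iota> u" "\<iota> v" "\<iota> w"]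
      by (intro eqI) (simp_all add: p_iota closed iota_mult)
    show "col u (v \<otimes> w) = col (col u w) v"
      using uvw d_mult[of "\<iota> u" "\<iota> v" "\<iota> w"]
      by (intro eqI) (simp_all add: swap.p_iota closed iota_mult)
    show "dot (u \<otimes> v) w = dot u (col w v) \<otimes> dot v w"
      using uvw p_mult_iota(2)[of w v "\<iota> u"]
      by (intro eqI) (simp_all add: p_iota closed iota_mult)
    show "col (u \<otimes> v) w = col u (dot w v) \<otimes> col v w"
      using uvw swap.p_mult_iota(2)[of w v "\<iota> u"]
      by (intro eqI) (simp_all add: swap.p_iota closed iota_mult)
  qed
qed

lemma admissible:
  assumes cycle: "\<And>u v w. sw v (\<lambda>v1 v2. p (p u v1) (d w v2)) = sw w (\<lambda>w1 w2. p (p u w2) (p v w1))"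
    "\<And>u v w. sw v (\<lambda>v1 v2. d (p u v1) (p w v2)) = sw w (\<lambda>w1 w2. p (d u w2) (d v w1))"
    "\<And>u v w. sw v (\<lambda>v1 v2. d (d u v1) (d w v2)) = sw w (\<lambda>w1 w2. d (d u w2) (p v w1))"
  shows "admissible_q_brace G \<chi> a dot col"
proof -
  have "\<chi> h * \<chi> (col l h) = \<chi> l * \<chi> (dot h l)" if h: "h \<in> carrier G" and l: "l \<in> carrier G" for h l
  proof -
    have sq: "\<chi> h * \<chi> h = 1" "\<chi> (dot h l) * \<chi> (dot h l) = 1"
      using char_squared[OF cycle(1)] h l dot_closed by (simp_all add: power2_eq_square)
    have "\<chi> h * \<chi> (col l h) = \<chi> h * (\<chi> (col l h) * \<chi> (dot h l)) * \<chi> (dot h l)"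
      using sq by (simp add: mult.assoc)
    also have "\<dots> = (\<chi> h * \<chi> h) * \<chi> l * \<chi> (dot h l)"
      by (simp only: char_dot_col[OF h l]) (simp only: mult_ac)
    finally show ?thesis using sq by simp
  qed
  then show ?thesis
    unfolding admissible_q_brace_def
    using group_structure[OF cycle] char_squared[OF cycle(1)] dot_a dot_of_a col_a swap.dot_of_a
    by simp
qed

end

context rank_one_hopf_algebra
begin

text \<open>
  The compatibility in the other order is obtained by exchanging the two arguments and the two
  Sweedler sums.
\<close>
lemma rank_one_operations_of_brace:
  assumes brace: "hopf_q_brace scale \<Delta> \<epsilon> p d" and nz: "p x x \<noteq> 0" "d x x \<noteq> 0"
  shows "rank_one_operations G \<chi> a \<alpha> scale \<Delta> \<epsilon> \<iota> x p d"
proof -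
  interpret B: hopf_q_brace scale \<Delta> \<epsilon> p d by fact
  have q: "q_magma_coalgebra p d"
    using B.q_cycle by (simp add: q_cycle_coalgebra_def)
  then have p: "bilinear_map scale scale scale p" and d: "bilinear_map scale scale scale d"
    by (simp_all add: q_magma_coalgebra_def)
  have dp: "sw u (\<lambda>u1 u2. sw v (\<lambda>v1 v2. \<psi> (p v1 u2) * \<omega> (d u1 v2))) =
      sw u (\<lambda>u1 u2. sw v (\<lambda>v1 v2. \<psi> (p v2 u1) * \<omega> (d u2 v1)))"
    if \<psi>: "lin_form \<psi>" and \<omega>: "lin_form \<omega>" for \<psi> \<omega> u v
  proof -
    note rules = lin_rules linear_bilinear_left[OF p] linear_bilinear_right[OF p]
      linear_bilinear_left[OF d] linear_bilinear_right[OF d] lin_comp[OF \<psi>] lin_comp[OF \<omega>]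
    have "sw u (\<lambda>u1 u2. sw v (\<lambda>v1 v2. \<psi> (p v1 u2) * \<omega> (d u1 v2))) =
        sw v (\<lambda>v1 v2. sw u (\<lambda>u1 u2. \<psi> (p v1 u2) * \<omega> (d u1 v2)))"
      by (rule sw_swap[where s = "(*)"]) (intro rules)+
    also have "\<dots> = sw v (\<lambda>v1 v2. sw u (\<lambda>u1 u2. \<psi> (p v2 u1) * \<omega> (d u2 v1)))"
      using q_magma_compatible[OF q \<omega> \<psi>, of v u] by (simp add: mult.commute)
    also have "\<dots> = sw u (\<lambda>u1 u2. sw v (\<lambda>v1 v2. \<psi> (p v2 u1) * \<omega> (d u2 v1)))"
      by (rule sw_swap[where s = "(*)"]) (intro rules)+
    finally show ?thesis .
  qed
  show ?thesis
    by (intro rank_one_operations.intro rank_one_hopf_algebra_axioms rank_one_operations_axioms.intro)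
      (fact p d q_magma_comult_dot[OF q] q_magma_comult_col[OF q] q_magma_compatible[OF q] dp
        B.p_one B.p_mult B.d_one B.d_mult B.mult_p B.mult_d nz)+
qed

theorem hopf_q_brace_restriction:
  assumes brace: "hopf_q_brace scale \<Delta> \<epsilon> p d" and nz: "p x x \<noteq> 0" "d x x \<noteq> 0"
  shows "n = 2 \<and>
    (\<exists>dot col. restricts_to G \<iota> p dot \<and> restricts_to G \<iota> d col \<and>
      admissible_q_brace G \<chi> a dot col \<and>
      (\<exists>\<mu>. \<mu> \<noteq> 0 \<and> star_formulas G \<chi> a scale \<iota> x dot col \<mu> p d))"
proof -
  interpret B: hopf_q_brace scale \<Delta> \<epsilon> p d by fact
  interpret O: rank_one_operations G \<chi> a \<alpha> scale \<Delta> \<epsilon> \<iota> x p d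
    by (rule rank_one_operations_of_brace) fact+
  interpret O': rank_one_operations G \<chi> a \<alpha> scale \<Delta> \<epsilon> \<iota> x d p
    by (rule O.swapped)
  have "admissible_q_brace G \<chi> a (group_restriction p) (group_restriction d)"
    using B.q_cycle unfolding q_cycle_coalgebra_def by (intro O.admissible) blast+
  moreover have "restricts_to G \<iota> p (group_restriction p)" "restricts_to G \<iota> d (group_restriction d)"
    by (simp_all add: restricts_to_def O.p_iota O'.p_iota)
  ultimately show ?thesis
    using O.order_eq_two O.star_formulas_hold by blast
qed

end


section \<open>Linear and bilinear maps given on the basis\<close>

context rank_one_hopf_algebra
begin

lemma sum_hd_basis:
  assumes "h \<in> carrier G" "k < n"
  shows "(\<Sum>g\<in>carrier G. \<Sum>m<n. scale (coord g m (\<iota> h * x ^ k)) (f g m)) = f h k"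
proof -
  have "(\<Sum>g\<in>carrier G. \<Sum>m<n. scale (coord g m (\<iota> h * x ^ k)) (f g m)) =
      (\<Sum>g\<in>carrier G. \<Sum>m<n. if g = h then if m = k then f h k else 0 else 0)"
    using assms by (intro sum.cong refl) (auto simp: coord_hd_basis)
  also have "\<dots> = (\<Sum>g\<in>carrier G. if g = h then f h k else 0)"
    using assms by (intro sum.cong refl) simp
  also have "\<dots> = f h k"
    using assms finite_carrier by simp
  finally show ?thesis .
qed

definition extend_linear :: "('g \<Rightarrow> nat \<Rightarrow> 'h) \<Rightarrow> 'h \<Rightarrow> 'h" where
  "extend_linear f u = (\<Sum>g\<in>carrier G. \<Sum>m<n. scale (coord g m u) (f g m))"

lemma extend_linear: "Vector_Spaces.linear scale scale (extend_linear f)"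
  unfolding extend_linear_def
  by (rule linearI)
    (simp_all add: vector_space_axioms linear_simps[OF coord_linear] scale_left_distrib
      sum.distrib scale_sum_right)

lemma extend_linear_hd_basis:
  "h \<in> carrier G \<Longrightarrow> k < n \<Longrightarrow> extend_linear f (\<iota> h * x ^ k) = f h k"
  unfolding extend_linear_def by (rule sum_hd_basis)

lemma bilinear_extension:
  "\<exists>f. bilinear_map scale scale scale f \<and>
    (\<forall>g\<in>carrier G. \<forall>h\<in>carrier G. \<forall>i<n. \<forall>j<n. f (\<iota> g * x ^ i) (\<iota> h * x ^ j) = t g i h j)"
proof (intro exI conjI ballI allI impI)
  let ?f = "\<lambda>u v. extend_linear (\<lambda>g i. extend_linear (t g i) v) u"
  have "Vector_Spaces.linear scale scale (\<lambda>v. ?f u v)" for u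
    unfolding extend_linear_def[of _ u]
    by (rule linearI)
      (simp_all add: vector_space_axioms linear_simps[OF extend_linear] scale_right_distrib
        sum.distrib scale_sum_right mult.commute)
  then show "bilinear_map scale scale scale ?f"
    using extend_linear by (intro bilinear_mapI)
  show "?f (\<iota> g * x ^ i) (\<iota> h * x ^ j) = t g i h j"
    if "g \<in> carrier G" "h \<in> carrier G" "i < n" "j < n" for g h i j
    using that by (simp add: extend_linear_hd_basis)
qed

end

section \<open>Regularity of module structures\<close>

context coalgebra
begin

lemma tensor_lift_in_tensor_space:
  assumes "bilinear_map scale scale tensor_scale f" "\<And>u v. f u v \<in> tensor_space scale scale"
    and "t \<in> tensor_space scale scale"
  shows "tensor_lift scale scale f t \<in> tensor_space scale scale"
  using tensor_space_sum_list[OF vector_space_axioms vector_space_axioms assms(3)]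
  by (auto simp: tensor_lift_sum[OF assms(1)] intro!: tensor_space_sum_list_closed assms(2))

lemma tensor_lift_inverse:
  assumes f: "bilinear_map scale scale tensor_scale f" "\<And>u v. f u v \<in> tensor_space scale scale"
    and g: "bilinear_map scale scale tensor_scale g"
    and inv: "\<And>u v. tensor_lift scale scale g (f u v) = u \<boxtimes> v"
    and t: "t \<in> tensor_space scale scale"
  shows "tensor_lift scale scale g (tensor_lift scale scale f t) = t"
proof -
  obtain L where L: "t = (\<Sum>(u, v)\<leftarrow>L. u \<boxtimes> v)"
    using tensor_space_sum_list[OF vector_space_axioms vector_space_axioms t] by blast
  show ?thesis
    unfolding L tensor_lift_sum[OF f(1)] tensor_lift_sum_list[OF g f(2)] inv ..
qed

text \<open>
  The inverse is required on pure tensors only.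
\<close>
lemma bij_betw_tensor_lift:
  assumes "bilinear_map scale scale tensor_scale f" "\<And>u v. f u v \<in> tensor_space scale scale"
    and "bilinear_map scale scale tensor_scale g" "\<And>u v. g u v \<in> tensor_space scale scale"
    and "\<And>u v. tensor_lift scale scale g (f u v) = u \<boxtimes> v"
    and "\<And>u v. tensor_lift scale scale f (g u v) = u \<boxtimes> v"
  shows "bij_betw (tensor_lift scale scale f) (tensor_space scale scale) (tensor_space scale scale)"
  by (rule bij_betw_byWitness[where f' = "tensor_lift scale scale g"])
    (auto intro: tensor_lift_inverse tensor_lift_in_tensor_space assms)

end

context rank_one_hopf_algebra
begin

text \<open>
  A constant for the second kind of basis elements keeps products with group elements from being
  reassociated by the simplifier.
\<close>
definition \<xi> :: "'g \<Rightarrow> 'h" where "\<xi> g = \<iota> g * x"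

lemma sw_\<xi>:
  "bilinear_map scale scale s f \<Longrightarrow> g \<in> carrier G \<Longrightarrow>
    sw (\<xi> g) f = f (\<xi> g) (\<iota> (g \<otimes> a)) + f (\<iota> g) (\<xi> g)"
  unfolding \<xi>_def by (rule sw_iota_x)

lemma mult_\<xi>:
  assumes "g \<in> carrier G" "h \<in> carrier G"
  shows "\<iota> g * \<xi> h = \<xi> (g \<otimes> h)" "\<xi> g * \<iota> h = scale (\<chi> h) (\<xi> (g \<otimes> h))"
  using assms
  by (simp_all add: \<xi>_def iota_mult mult.assoc x_iota scale_mult_right flip: mult.assoc[of "\<iota> _" "\<iota> _"])

lemma char_inv: "g \<in> carrier G \<Longrightarrow> \<chi> (inv g) = inverse (\<chi> g)"
  using char_mult[of g "inv g"] by (simp add: char_one char_nonzero inverse_unique)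

lemma linear_ext_two:
  assumes n: "n = 2" and F: "Vector_Spaces.linear scale s F" "Vector_Spaces.linear scale s F'"
    and eq: "\<And>g. g \<in> carrier G \<Longrightarrow> F (\<iota> g) = F' (\<iota> g)" "\<And>g. g \<in> carrier G \<Longrightarrow> F (\<xi> g) = F' (\<xi> g)"
  shows "F u = F' u"
proof (rule linear_ext_hd_basis[OF F])
  fix g m assume g: "g \<in> carrier G" and "m < n"
  then consider "m = 0" | "m = 1" using n by linarith
  then show "F (\<iota> g * x ^ m) = F' (\<iota> g * x ^ m)"
    using eq[OF g] by cases (simp_all add: \<xi>_def)
qed

text \<open>
  For a right module over the opposite of \<open>H\<close>, the inverse of \<open>u \<otimes> v \<mapsto> u v\<^sub>1 \<otimes> v\<^sub>2\<close> is
  \<open>u \<otimes> v \<mapsto> u S(v\<^sub>1) \<otimes> v\<^sub>2\<close> with the inverse \<open>S\<close> of the antipode, and the inverse of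
  \<open>u \<otimes> v \<mapsto> u v\<^sub>2 \<otimes> v\<^sub>1\<close> is \<open>u \<otimes> v \<mapsto> u S'(v\<^sub>2) \<otimes> v\<^sub>1\<close> with the antipode \<open>S'\<close>.  Both are given here
  by their values on the basis.
\<close>
lemma
  assumes n: "n = 2" and f: "bilinear_map scale scale scale f"
    and f_one: "\<And>h. f h 1 = h" and f_mult: "\<And>h k l. f h (k * l) = f (f h l) k"
  shows left_regular_module: "left_regular f" and right_regular_module: "right_regular f"
proof -
  have f_iota: "f (f u (\<iota> g)) (\<iota> (inv g)) = u" "f (f u (\<iota> (inv g))) (\<iota> g) = u"
    if "g \<in> carrier G" for u g
    using that by (simp_all add: iota_mult iota_one f_one flip: f_mult)
  have f_sum: "f u v + f u w = f u (v + w)" "f u 0 = 0" for u v w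
    by (simp_all add: linear_simps[OF bilinear_map_linear(2)[OF f]])
  define S where "S = extend_linear (\<lambda>g m. if m = 0 then \<iota> (inv g) else scale (- inverse (\<chi> g)) (\<xi> (inv (g \<otimes> a))))"
  define S' where "S' = extend_linear (\<lambda>g m. if m = 0 then \<iota> (inv g) else scale (- \<chi> (inv (g \<otimes> a))) (\<xi> (inv (g \<otimes> a))))"
  have lin: "Vector_Spaces.linear scale scale S" "Vector_Spaces.linear scale scale S'"
    unfolding S_def S'_def by (rule extend_linear)+
  have S: "S (\<iota> g) = \<iota> (inv g)" "S (\<xi> g) = scale (- inverse (\<chi> g)) (\<xi> (inv (g \<otimes> a)))"
      "S' (\<iota> g) = \<iota> (inv g)" "S' (\<xi> g) = scale (- \<chi> (inv (g \<otimes> a))) (\<xi> (inv (g \<otimes> a)))"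
    if "g \<in> carrier G" for g
    using extend_linear_hd_basis[OF that, of 0] extend_linear_hd_basis[OF that, of 1] n
    by (simp_all add: S_def S'_def \<xi>_def)
  note rules = hopf_lin_rules linear_bilinear_left[OF f] linear_bilinear_right[OF f]
    lin_comp[OF lin(1)] lin_comp[OF lin(2)]
  note tens_simps = linear_simps(1)[OF bilinear_map_linear(1)[OF tens_bilinear], symmetric]
    linear_simps(5)[OF bilinear_map_linear(1)[OF tens_bilinear]]
  let ?\<phi> = "\<lambda>u v. sw v (\<lambda>v1 v2. f u v1 \<boxtimes> v2)" and ?\<psi> = "\<lambda>u v. sw v (\<lambda>v1 v2. f u (S v1) \<boxtimes> v2)"
  let ?\<phi>' = "\<lambda>u v. sw v (\<lambda>v1 v2. f u v2 \<boxtimes> v1)" and ?\<psi>' = "\<lambda>u v. sw v (\<lambda>v1 v2. f u (S' v2) \<boxtimes> v1)"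
  have inner: "bilinear_map scale scale tensor_scale (\<lambda>v1 v2. f u v1 \<boxtimes> v2)"
      "bilinear_map scale scale tensor_scale (\<lambda>v1 v2. f u (S v1) \<boxtimes> v2)"
      "bilinear_map scale scale tensor_scale (\<lambda>v1 v2. f u v2 \<boxtimes> v1)"
      "bilinear_map scale scale tensor_scale (\<lambda>v1 v2. f u (S' v2) \<boxtimes> v1)" for u
    by (intro rules)+
  have outer: "bilinear_map scale scale tensor_scale ?\<phi>" "bilinear_map scale scale tensor_scale ?\<psi>"
      "bilinear_map scale scale tensor_scale ?\<phi>'" "bilinear_map scale scale tensor_scale ?\<psi>'"
    by (intro rules)+
  have mem: "?\<phi> u v \<in> tensor_space scale scale" "?\<psi> u v \<in> tensor_space scale scale"
      "?\<phi>' u v \<in> tensor_space scale scale" "?\<psi>' u v \<in> tensor_space scale scale" for u v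
    by (intro sw_in_tensor_space inner tensor_in_tensor_space)+
  have lift: "tensor_lift scale scale g (sw v (\<lambda>v1 v2. A v1 v2 \<boxtimes> B v1 v2)) =
      sw v (\<lambda>v1 v2. g (A v1 v2) (B v1 v2))"
    if "bilinear_map scale scale tensor_scale g"
      "bilinear_map scale scale tensor_scale (\<lambda>v1 v2. A v1 v2 \<boxtimes> B v1 v2)"
      "bilinear_map scale scale tensor_scale (\<lambda>v1 v2. g (A v1 v2) (B v1 v2))"
    for g :: "'h \<Rightarrow> 'h \<Rightarrow> ('h, 'h, 'k) tensor" and A B v
    using that
    by (subst tensor_lift_sw) (auto simp: tensor_lift_tensor tensor_in_tensor_space)
  have comp: "bilinear_map scale scale tensor_scale (\<lambda>v1 v2. ?\<psi> (f u v1) v2)"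
      "bilinear_map scale scale tensor_scale (\<lambda>v1 v2. ?\<phi> (f u (S v1)) v2)"
      "bilinear_map scale scale tensor_scale (\<lambda>v1 v2. ?\<psi>' (f u v2) v1)"
      "bilinear_map scale scale tensor_scale (\<lambda>v1 v2. ?\<phi>' (f u (S' v2)) v1)" for u
    by (intro rules)+
  \<comment> \<open>The antipode identities for \<open>\<xi> g\<close>, whose coproduct has two terms and whose counit is \<open>0\<close>\<close>
  have cancel: "f (f u (\<xi> g)) (\<iota> (inv (g \<otimes> a))) + f (f u (\<iota> g)) (S (\<xi> g)) = 0"
      "f (f u (S (\<xi> g))) (\<iota> (g \<otimes> a)) + f (f u (\<iota> (inv g))) (\<xi> g) = 0"
      "f (f u (\<iota> (g \<otimes> a))) (S' (\<xi> g)) + f (f u (\<xi> g)) (\<iota> (inv g)) = 0"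
      "f (f u (\<iota> (inv (g \<otimes> a)))) (\<xi> g) + f (f u (S' (\<xi> g))) (\<iota> g) = 0"
    if g: "g \<in> carrier G" for u g
    using that a_closed
    by (simp_all add: f_sum S mult_\<xi> scale_mult_left scale_mult_right char_inv char_nonzero flip: f_mult)
  have inverse1: "tensor_lift scale scale ?\<psi> (?\<phi> u v) = u \<boxtimes> v" for u v
    unfolding lift[OF outer(2) inner(1) comp(1)]
  proof (rule linear_ext_two[OF n linear_sw_arg[OF comp(1)], where F' = "\<lambda>v. u \<boxtimes> v"])
    show "Vector_Spaces.linear scale tensor_scale ((\<boxtimes>) u)" by (intro rules)
    fix g assume g: "g \<in> carrier G"
    show "sw (\<iota> g) (\<lambda>v1 v2. ?\<psi> (f u v1) v2) = u \<boxtimes> \<iota> g"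
      using g by (simp add: sw_iota[OF comp(1)] sw_iota[OF inner(2)] S f_iota)
    show "sw (\<xi> g) (\<lambda>v1 v2. ?\<psi> (f u v1) v2) = u \<boxtimes> \<xi> g"
      using g a_closed cancel(1)[OF g, of u]
      by (simp add: sw_\<xi>[OF comp(1)] sw_iota[OF inner(2)] sw_\<xi>[OF inner(2)] S(1,3) f_iota
          tens_simps add_ac)
  qed
  have inverse2: "tensor_lift scale scale ?\<phi> (?\<psi> u v) = u \<boxtimes> v" for u v
    unfolding lift[OF outer(1) inner(2) comp(2)]
  proof (rule linear_ext_two[OF n linear_sw_arg[OF comp(2)], where F' = "\<lambda>v. u \<boxtimes> v"])
    show "Vector_Spaces.linear scale tensor_scale ((\<boxtimes>) u)" by (intro rules)
    fix g assume g: "g \<in> carrier G"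
    show "sw (\<iota> g) (\<lambda>v1 v2. ?\<phi> (f u (S v1)) v2) = u \<boxtimes> \<iota> g"
      using g by (simp add: sw_iota[OF comp(2)] sw_iota[OF inner(1)] S f_iota)
    show "sw (\<xi> g) (\<lambda>v1 v2. ?\<phi> (f u (S v1)) v2) = u \<boxtimes> \<xi> g"
      using g a_closed cancel(2)[OF g, of u]
      by (simp add: sw_\<xi>[OF comp(2)] sw_iota[OF inner(1)] sw_\<xi>[OF inner(1)] S(1,3) f_iota
          tens_simps add_ac)
  qed
  have inverse3: "tensor_lift scale scale ?\<psi>' (?\<phi>' u v) = u \<boxtimes> v" for u v
    unfolding lift[OF outer(4) inner(3) comp(3)]
  proof (rule linear_ext_two[OF n linear_sw_arg[OF comp(3)], where F' = "\<lambda>v. u \<boxtimes> v"])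
    show "Vector_Spaces.linear scale tensor_scale ((\<boxtimes>) u)" by (intro rules)
    fix g assume g: "g \<in> carrier G"
    show "sw (\<iota> g) (\<lambda>v1 v2. ?\<psi>' (f u v2) v1) = u \<boxtimes> \<iota> g"
      using g by (simp add: sw_iota[OF comp(3)] sw_iota[OF inner(4)] S f_iota)
    show "sw (\<xi> g) (\<lambda>v1 v2. ?\<psi>' (f u v2) v1) = u \<boxtimes> \<xi> g"
      using g a_closed cancel(3)[OF g, of u]
      by (simp add: sw_\<xi>[OF comp(3)] sw_iota[OF inner(4)] sw_\<xi>[OF inner(4)] S(1,3) f_iota
          tens_simps add_ac)
  qed
  have inverse4: "tensor_lift scale scale ?\<phi>' (?\<psi>' u v) = u \<boxtimes> v" for u v
    unfolding lift[OF outer(3) inner(4) comp(4)]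
  proof (rule linear_ext_two[OF n linear_sw_arg[OF comp(4)], where F' = "\<lambda>v. u \<boxtimes> v"])
    show "Vector_Spaces.linear scale tensor_scale ((\<boxtimes>) u)" by (intro rules)
    fix g assume g: "g \<in> carrier G"
    show "sw (\<iota> g) (\<lambda>v1 v2. ?\<phi>' (f u (S' v2)) v1) = u \<boxtimes> \<iota> g"
      using g by (simp add: sw_iota[OF comp(4)] sw_iota[OF inner(3)] S f_iota)
    show "sw (\<xi> g) (\<lambda>v1 v2. ?\<phi>' (f u (S' v2)) v1) = u \<boxtimes> \<xi> g"
      using g a_closed cancel(4)[OF g, of u]
      by (simp add: sw_\<xi>[OF comp(4)] sw_iota[OF inner(3)] sw_\<xi>[OF inner(3)] S(1,3) f_iota
          tens_simps add_ac)
  qed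
  show "left_regular f"
    unfolding left_regular_def
    by (rule bij_betw_tensor_lift[OF outer(1) mem(1) outer(2) mem(2) inverse1 inverse2])
  show "right_regular f"
    unfolding right_regular_def
    by (rule bij_betw_tensor_lift[OF outer(3) mem(3) outer(4) mem(4) inverse3 inverse4])
qed

end


section \<open>Hopf \<open>q\<close>-braces from \<open>q\<close>-brace structures on the group\<close>

text \<open>
  A fixed pair of bilinear operations satisfying the explicit formulas.  All axioms are verified on
  the basis elements \<open>g\<close> and \<open>\<xi> g = g x\<close>.
\<close>
locale star_operations =
  rank_one_hopf_algebra G \<chi> a \<alpha> scale \<Delta> \<epsilon> \<iota> x
  for G (structure) and \<chi> :: "'g \<Rightarrow> 'k::field" and a \<alpha>
    and scale :: "'k \<Rightarrow> 'h::ring_1 \<Rightarrow> 'h" and \<Delta> \<epsilon> \<iota> x +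
  fixes dot col :: "'g \<Rightarrow> 'g \<Rightarrow> 'g" and \<mu> :: 'k and p d :: "'h \<Rightarrow> 'h \<Rightarrow> 'h"
  assumes admissible: "admissible_q_brace G \<chi> a dot col"
    and p_bilinear: "bilinear_map scale scale scale p"
    and d_bilinear: "bilinear_map scale scale scale d"
    and p_restricts: "restricts_to G \<iota> p dot"
    and d_restricts: "restricts_to G \<iota> d col"
    and star: "star_formulas G \<chi> a scale \<iota> x dot col \<mu> p d"
begin

sublocale B: group_q_brace G dot col
  using admissible by (simp add: admissible_q_brace_def)

lemma brace_a: "g \<in> carrier G \<Longrightarrow> dot a g = a" "g \<in> carrier G \<Longrightarrow> col a g = a"
    "g \<in> carrier G \<Longrightarrow> dot g a = g" "g \<in> carrier G \<Longrightarrow> col g a = g"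
  and char_square: "g \<in> carrier G \<Longrightarrow> \<chi> g * \<chi> g = 1"
  and char_col_dot: "\<lbrakk>h \<in> carrier G; l \<in> carrier G\<rbrakk> \<Longrightarrow> \<chi> h * \<chi> (col l h) = \<chi> l * \<chi> (dot h l)"
  using admissible by (simp_all add: admissible_q_brace_def power2_eq_square)

lemma closed: 
  assumes "g \<in> carrier G" "h \<in> carrier G"
  shows "dot g h \<in> carrier G" "col g h \<in> carrier G"
  using B.dot_bij[OF assms(2)] B.col_bij[OF assms(2)] assms by (auto dest: bij_betwE)

lemma char_a: "\<chi> a = - 1"
  using char_square[OF a_closed] char_a_neq_one by (simp add: square_eq_1_iff)

lemma order_two: "n = 2"
proof -
  have "\<not> 2 < n" using char_a_pow_neq_one[of 2] char_square[OF a_closed] by (auto simp: power2_eq_square)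
  then show ?thesis using order_gt_1 by simp
qed

lemma char_square_cancel: "g \<in> carrier G \<Longrightarrow> \<chi> g * (\<chi> g * c) = c"
  using char_square by (simp flip: mult.assoc)

text \<open>
  With this orientation every value of the character is rewritten to values at the variables and
  at elements of the form \<open>g \<cdot> h\<close>, whose squares cancel.
\<close>
lemma char_col: "\<lbrakk>h \<in> carrier G; l \<in> carrier G\<rbrakk> \<Longrightarrow> \<chi> (col l h) = \<chi> h * (\<chi> l * \<chi> (dot h l))"
  using char_square_cancel[of h "\<chi> (col l h)"] by (simp add: char_col_dot)

text \<open>
  The central element \<open>a\<close> is moved to the right of products.  Only values of the operations are passed,
  which keeps the rewriting from looping on \<open>a\<close> itself.
\<close>
lemma a_moves:
  assumes "g \<in> carrier G" "h \<in> carrier G" "k \<in> carrier G"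
  shows "g \<otimes> a \<otimes> dot h k = g \<otimes> dot h k \<otimes> a" "g \<otimes> a \<otimes> col h k = g \<otimes> col h k \<otimes> a"
  using assms a_closed a_central closed by (simp_all add: m_assoc)

lemma assoc_left: "\<lbrakk>g \<in> carrier G; h \<in> carrier G; k \<in> carrier G\<rbrakk> \<Longrightarrow> g \<otimes> (h \<otimes> k) = g \<otimes> h \<otimes> k"
  by (simp add: m_assoc)

lemma brace_mult_a:
  assumes "g \<in> carrier G" "h \<in> carrier G"
  shows "dot (g \<otimes> a) h = dot g h \<otimes> a" "col (g \<otimes> a) h = col g h \<otimes> a"
    "dot g (h \<otimes> a) = dot g h" "col g (h \<otimes> a) = col g h"
  using assms a_closed by (simp_all add: B.mult_dot B.mult_col B.dot_mult B.col_mult brace_a closed)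

lemma x_squared: "x * x = scale \<alpha> (\<iota> (a \<otimes> a) - 1)"
  using x_pow_n a_closed by (simp add: order_two power2_eq_square numeral_2_eq_2)

lemma \<xi>_mult_\<xi>:
  assumes "g \<in> carrier G" "h \<in> carrier G"
  shows "\<xi> g * \<xi> h = scale (\<chi> h * \<alpha>) (\<iota> (g \<otimes> h \<otimes> a \<otimes> a) - \<iota> (g \<otimes> h))"
proof -
  have "\<xi> g * \<xi> h = scale (\<chi> h) (\<iota> (g \<otimes> h) * (x * x))"
    using mult_\<xi>(2)[OF assms] by (simp add: \<xi>_def[of h] \<xi>_def[of "g \<otimes> h"] scale_mult_left mult.assoc flip: mult.assoc[of "\<xi> g"])
  then show ?thesis
    using assms a_closed
    by (simp add: x_squared scale_mult_right right_diff_distrib iota_mult m_assoc)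
qed

lemma operations:
  assumes "h \<in> carrier G" "g \<in> carrier G"
  shows "p (\<iota> h) (\<iota> g) = \<iota> (dot h g)" "p (\<xi> h) (\<iota> g) = scale (\<chi> g) (\<xi> (dot h g))"
    "p (\<iota> h) (\<xi> g) = 0" "p (\<xi> h) (\<xi> g) = scale \<mu> (\<iota> (dot h g) - \<iota> (dot h g \<otimes> a))"
    "d (\<iota> h) (\<iota> g) = \<iota> (col h g)" "d (\<xi> h) (\<iota> g) = scale (\<chi> g) (\<xi> (col h g))"
    "d (\<iota> h) (\<xi> g) = 0" "d (\<xi> h) (\<xi> g) = scale \<mu> (\<iota> (col h g \<otimes> a) - \<iota> (col h g))"
  using assms p_restricts d_restricts star a_closed
  by (simp_all add: restricts_to_def star_formulas_def \<xi>_def right_diff_distrib iota_mult closed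
      scale_right_diff_distrib)

lemmas op_rules =
  hopf_lin_rules linear_bilinear_left[OF p_bilinear] linear_bilinear_right[OF p_bilinear]
  linear_bilinear_left[OF d_bilinear] linear_bilinear_right[OF d_bilinear]

lemmas op_simps =
  linear_simps[OF bilinear_map_linear(1)[OF p_bilinear]] linear_simps[OF bilinear_map_linear(2)[OF p_bilinear]]
  linear_simps[OF bilinear_map_linear(1)[OF d_bilinear]] linear_simps[OF bilinear_map_linear(2)[OF d_bilinear]]

lemma trilinear_ext:
  assumes F: "\<And>v w. Vector_Spaces.linear scale s (\<lambda>u. F u v w)" "\<And>u w. Vector_Spaces.linear scale s (\<lambda>v. F u v w)"
      "\<And>u v. Vector_Spaces.linear scale s (F u v)"
    and F': "\<And>v w. Vector_Spaces.linear scale s (\<lambda>u. F' u v w)" "\<And>u w. Vector_Spaces.linear scale s (\<lambda>v. F' u v w)"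
      "\<And>u v. Vector_Spaces.linear scale s (F' u v)"
    and eq: "\<And>u v w. \<lbrakk>u \<in> \<iota> ` carrier G \<union> \<xi> ` carrier G; v \<in> \<iota> ` carrier G \<union> \<xi> ` carrier G;
      w \<in> \<iota> ` carrier G \<union> \<xi> ` carrier G\<rbrakk> \<Longrightarrow> F u v w = F' u v w"
  shows "F u v w = F' u v w"
proof -
  let ?B = "\<iota> ` carrier G \<union> \<xi> ` carrier G"
  have 1: "F u v w = F' u v w" if "u \<in> ?B" "v \<in> ?B" for u v w
    by (rule linear_ext_two[OF order_two F(3)[of u v] F'(3)[of u v]]; rule eq[OF that]; blast)
  have 2: "F u v w = F' u v w" if "u \<in> ?B" for u v w
    by (rule linear_ext_two[OF order_two F(2)[of u w] F'(2)[of u w]]; rule 1[OF that]; blast)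
  show ?thesis
    by (rule linear_ext_two[OF order_two F(1)[of v w] F'(1)[of v w]]; rule 2; blast)
qed

lemmas brace_simps = closed a_closed brace_a brace_mult_a a_moves assoc_left char_a char_mult char_square char_square_cancel char_col
  B.dot_mult B.col_mult B.mult_dot B.mult_col B.cycle1 B.cycle2 B.cycle3

lemmas basis_simps = operations op_simps mult_\<xi> \<xi>_mult_\<xi> iota_mult brace_simps
  scale_mult_left scale_mult_right scale_right_diff_distrib scale_right_distrib mult_ac
  left_diff_distrib right_diff_distrib distrib_left distrib_right

lemma p_module: "p h (k * l) = p (p h l) k"
proof (rule trilinear_ext[where F = "\<lambda>h k l. p h (k * l)" and F' = "\<lambda>h k l. p (p h l) k" and s = scale])
  fix u v w
  assume "u \<in> \<iota> ` carrier G \<union> \<xi> ` carrier G" "v \<in> \<iota> ` carrier G \<union> \<xi> ` carrier G"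
    "w \<in> \<iota> ` carrier G \<union> \<xi> ` carrier G"
  then show "p u (v * w) = p (p u w) v"
    by (elim UnE imageE) (simp_all add: basis_simps)
qed (intro op_rules)+

lemma d_module: "d h (k * l) = d (d h l) k"
proof (rule trilinear_ext[where F = "\<lambda>h k l. d h (k * l)" and F' = "\<lambda>h k l. d (d h l) k" and s = scale])
  fix u v w
  assume "u \<in> \<iota> ` carrier G \<union> \<xi> ` carrier G" "v \<in> \<iota> ` carrier G \<union> \<xi> ` carrier G"
    "w \<in> \<iota> ` carrier G \<union> \<xi> ` carrier G"
  then show "d u (v * w) = d (d u w) v"
    by (elim UnE imageE) (simp_all add: basis_simps)
qed (intro op_rules)+

lemma cycle_1: "sw v (\<lambda>v1 v2. p (p u v1) (d w v2)) = sw w (\<lambda>w1 w2. p (p u w2) (p v w1))"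
proof (rule trilinear_ext[where F = "\<lambda>u v w. sw v (\<lambda>v1 v2. p (p u v1) (d w v2))" and
      F' = "\<lambda>u v w. sw w (\<lambda>w1 w2. p (p u w2) (p v w1))" and s = scale])
  have bil: "bilinear_map scale scale scale (\<lambda>v1 v2. p (p u v1) (d w v2))"
    "bilinear_map scale scale scale (\<lambda>w1 w2. p (p u w2) (p v w1))" for u v w
    by (intro op_rules)+
  fix u v w
  assume "u \<in> \<iota> ` carrier G \<union> \<xi> ` carrier G" "v \<in> \<iota> ` carrier G \<union> \<xi> ` carrier G"
    "w \<in> \<iota> ` carrier G \<union> \<xi> ` carrier G"
  then show "sw v (\<lambda>v1 v2. p (p u v1) (d w v2)) = sw w (\<lambda>w1 w2. p (p u w2) (p v w1))"
    by (elim UnE imageE) (simp_all add: bil[THEN sw_iota] bil[THEN sw_\<xi>] basis_simps)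
qed (intro op_rules)+

lemma cycle_2: "sw v (\<lambda>v1 v2. d (p u v1) (p w v2)) = sw w (\<lambda>w1 w2. p (d u w2) (d v w1))"
proof (rule trilinear_ext[where F = "\<lambda>u v w. sw v (\<lambda>v1 v2. d (p u v1) (p w v2))" and
      F' = "\<lambda>u v w. sw w (\<lambda>w1 w2. p (d u w2) (d v w1))" and s = scale])
  have bil: "bilinear_map scale scale scale (\<lambda>v1 v2. d (p u v1) (p w v2))"
    "bilinear_map scale scale scale (\<lambda>w1 w2. p (d u w2) (d v w1))" for u v w
    by (intro op_rules)+
  fix u v w
  assume "u \<in> \<iota> ` carrier G \<union> \<xi> ` carrier G" "v \<in> \<iota> ` carrier G \<union> \<xi> ` carrier G"
    "w \<in> \<iota> ` carrier G \<union> \<xi> ` carrier G"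
  then show "sw v (\<lambda>v1 v2. d (p u v1) (p w v2)) = sw w (\<lambda>w1 w2. p (d u w2) (d v w1))"
    by (elim UnE imageE) (simp_all add: bil[THEN sw_iota] bil[THEN sw_\<xi>] basis_simps)
qed (intro op_rules)+

lemma cycle_3: "sw v (\<lambda>v1 v2. d (d u v1) (d w v2)) = sw w (\<lambda>w1 w2. d (d u w2) (p v w1))"
proof (rule trilinear_ext[where F = "\<lambda>u v w. sw v (\<lambda>v1 v2. d (d u v1) (d w v2))" and
      F' = "\<lambda>u v w. sw w (\<lambda>w1 w2. d (d u w2) (p v w1))" and s = scale])
  have bil: "bilinear_map scale scale scale (\<lambda>v1 v2. d (d u v1) (d w v2))"
    "bilinear_map scale scale scale (\<lambda>w1 w2. d (d u w2) (p v w1))" for u v w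
    by (intro op_rules)+
  fix u v w
  assume "u \<in> \<iota> ` carrier G \<union> \<xi> ` carrier G" "v \<in> \<iota> ` carrier G \<union> \<xi> ` carrier G"
    "w \<in> \<iota> ` carrier G \<union> \<xi> ` carrier G"
  then show "sw v (\<lambda>v1 v2. d (d u v1) (d w v2)) = sw w (\<lambda>w1 w2. d (d u w2) (p v w1))"
    by (elim UnE imageE) (simp_all add: bil[THEN sw_iota] bil[THEN sw_\<xi>] basis_simps)
qed (intro op_rules)+

text \<open>
  The outer Sweedler sum is expanded before the inner one, as the expansion rule for the outer sum
  refers to the unexpanded inner sum.  Condition 2) already enters at \<open>\<xi> h, k, l\<close>, where
  \<open>\<chi>(k) \<chi>(l)\<close> has to equal \<open>\<chi>(l : k) \<chi>(k \<cdot> l)\<close>.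
\<close>
lemma mult_p: "p (h * k) l = sw l (\<lambda>l1 l2. sw k (\<lambda>k1 k2. p h (d l1 k2) * p k1 l2))"
proof (rule trilinear_ext[where F = "\<lambda>h k l. p (h * k) l" and
      F' = "\<lambda>h k l. sw l (\<lambda>l1 l2. sw k (\<lambda>k1 k2. p h (d l1 k2) * p k1 l2))" and s = scale])
  have bil: "bilinear_map scale scale scale (\<lambda>k1 k2. p h (d l1 k2) * p k1 l2)"
    "bilinear_map scale scale scale (\<lambda>l1 l2. sw k (\<lambda>k1 k2. p h (d l1 k2) * p k1 l2))" for h k l1 l2
    by (intro op_rules)+
  fix h k l
  assume "h \<in> \<iota> ` carrier G \<union> \<xi> ` carrier G" "k \<in> \<iota> ` carrier G \<union> \<xi> ` carrier G"
    "l \<in> \<iota> ` carrier G \<union> \<xi> ` carrier G"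
  then show "p (h * k) l = sw l (\<lambda>l1 l2. sw k (\<lambda>k1 k2. p h (d l1 k2) * p k1 l2))"
    by (elim UnE imageE; simp only: bil(2)[THEN sw_iota] bil(2)[THEN sw_\<xi>];
        simp add: bil(1)[THEN sw_iota] bil(1)[THEN sw_\<xi>] basis_simps)
qed (intro op_rules)+

lemma mult_d: "d (h * k) l = sw l (\<lambda>l1 l2. sw k (\<lambda>k1 k2. d h (p l1 k2) * d k1 l2))"
proof (rule trilinear_ext[where F = "\<lambda>h k l. d (h * k) l" and
      F' = "\<lambda>h k l. sw l (\<lambda>l1 l2. sw k (\<lambda>k1 k2. d h (p l1 k2) * d k1 l2))" and s = scale])
  have bil: "bilinear_map scale scale scale (\<lambda>k1 k2. d h (p l1 k2) * d k1 l2)"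
    "bilinear_map scale scale scale (\<lambda>l1 l2. sw k (\<lambda>k1 k2. d h (p l1 k2) * d k1 l2))" for h k l1 l2
    by (intro op_rules)+
  fix h k l
  assume "h \<in> \<iota> ` carrier G \<union> \<xi> ` carrier G" "k \<in> \<iota> ` carrier G \<union> \<xi> ` carrier G"
    "l \<in> \<iota> ` carrier G \<union> \<xi> ` carrier G"
  then show "d (h * k) l = sw l (\<lambda>l1 l2. sw k (\<lambda>k1 k2. d h (p l1 k2) * d k1 l2))"
    by (elim UnE imageE; simp only: bil(2)[THEN sw_iota] bil(2)[THEN sw_\<xi>];
        simp add: bil(1)[THEN sw_iota] bil(1)[THEN sw_\<xi>] basis_simps)
qed (intro op_rules)+

end


context star_operations
begin

lemma bilinear_ext:
  assumes F: "bilinear_map scale scale s F" and F': "bilinear_map scale scale s F'"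
    and eq: "\<And>u v. \<lbrakk>u \<in> \<iota> ` carrier G \<union> \<xi> ` carrier G; v \<in> \<iota> ` carrier G \<union> \<xi> ` carrier G\<rbrakk> \<Longrightarrow> F u v = F' u v"
  shows "F u v = F' u v"
proof -
  let ?B = "\<iota> ` carrier G \<union> \<xi> ` carrier G"
  note F = bilinear_map_linear[OF F] and F' = bilinear_map_linear[OF F']
  have 1: "F u v = F' u v" if "u \<in> ?B" for u v
    by (rule linear_ext_two[OF order_two F(2)[of u] F'(2)[of u]]; rule eq[OF that]; blast)
  show ?thesis
    by (rule linear_ext_two[OF order_two F(1)[of v] F'(1)[of v]]; rule 1; blast)
qed

lemma counit_\<xi>: "g \<in> carrier G \<Longrightarrow> \<epsilon> (\<xi> g) = 0"
  by (simp add: \<xi>_def counit_mult counit_x)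

lemma counit_operations: "\<epsilon> (p u v) = \<epsilon> u * \<epsilon> v" "\<epsilon> (d u v) = \<epsilon> u * \<epsilon> v"
proof -
  note simps = counit_iota counit_\<xi> operations linear_simps[OF counit_linear] closed a_closed
  have bil: "bilinear_map scale scale (*) (\<lambda>u v. \<epsilon> (p u v))" "bilinear_map scale scale (*) (\<lambda>u v. \<epsilon> (d u v))"
    "bilinear_map scale scale (*) (\<lambda>u v. \<epsilon> u * \<epsilon> v)"
    by (intro op_rules counit_linear)+
  show "\<epsilon> (p u v) = \<epsilon> u * \<epsilon> v"
    by (rule bilinear_ext[OF bil(1,3)]) (elim UnE imageE; simp add: simps)
  show "\<epsilon> (d u v) = \<epsilon> u * \<epsilon> v"
    by (rule bilinear_ext[OF bil(2,3)]) (elim UnE imageE; simp add: simps)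
qed

lemma q_map_bilinear: "bilinear_map scale scale tensor_scale (q_map p d)"
  unfolding q_map_def by (intro op_rules)

lemmas tens_simps =
  linear_simps[OF bilinear_map_linear(1)[OF tens_bilinear]] linear_simps[OF bilinear_map_linear(2)[OF tens_bilinear]]

lemmas tensor_scale_simps =
  module.scale_right_diff_distrib[OF vector_space_tensor_scale[folded module_iff_vector_space]]
  module.scale_right_distrib[OF vector_space_tensor_scale[folded module_iff_vector_space]]
  module.scale_scale[OF vector_space_tensor_scale[folded module_iff_vector_space]]
  module.scale_minus_left[OF vector_space_tensor_scale[folded module_iff_vector_space]]
  module.scale_minus_right[OF vector_space_tensor_scale[folded module_iff_vector_space]]
  module.scale_one[OF vector_space_tensor_scale[folded module_iff_vector_space]]

lemma q_map_basis:
  assumes g: "g \<in> carrier G" and h: "h \<in> carrier G"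
  shows "q_map p d (\<iota> g) (\<iota> h) = \<iota> (col h g) \<boxtimes> \<iota> (dot g h)"
    "q_map p d (\<xi> g) (\<iota> h) = tensor_scale (\<chi> h) (\<iota> (col h g) \<boxtimes> \<xi> (dot g h))"
    "q_map p d (\<iota> g) (\<xi> h) = tensor_scale (\<chi> g) (\<xi> (col h g) \<boxtimes> \<iota> (dot g h))"
    "q_map p d (\<xi> g) (\<xi> h) = tensor_scale (\<chi> g * \<chi> h) (\<xi> (col h g) \<boxtimes> \<xi> (dot g h)) +
      (tensor_scale \<mu> (\<iota> (col h g \<otimes> a) \<boxtimes> \<iota> (dot g h)) - tensor_scale \<mu> (\<iota> (col h g) \<boxtimes> \<iota> (dot g h \<otimes> a)))"
proof -
  have bil: "bilinear_map scale scale tensor_scale (\<lambda>v1 v2. d v1 u2 \<boxtimes> p u1 v2)"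
    "bilinear_map scale scale tensor_scale (\<lambda>u1 u2. sw v (\<lambda>v1 v2. d v1 u2 \<boxtimes> p u1 v2))" for u1 u2 v
    by (intro op_rules)+
  note outer = bil(2)[THEN sw_iota] bil(2)[THEN sw_\<xi>] and inner = bil(1)[THEN sw_iota] bil(1)[THEN sw_\<xi>]
  note simps = operations closed a_closed brace_mult_a char_mult char_a tens_simps tensor_scale_simps
  show "q_map p d (\<iota> g) (\<iota> h) = \<iota> (col h g) \<boxtimes> \<iota> (dot g h)"
    unfolding q_map_def outer[OF g] by (simp add: inner simps g h)
  show "q_map p d (\<xi> g) (\<iota> h) = tensor_scale (\<chi> h) (\<iota> (col h g) \<boxtimes> \<xi> (dot g h))"
    unfolding q_map_def outer[OF g] by (simp add: inner simps g h)
  show "q_map p d (\<iota> g) (\<xi> h) = tensor_scale (\<chi> g) (\<xi> (col h g) \<boxtimes> \<iota> (dot g h))"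
    unfolding q_map_def outer[OF g] by (simp add: inner simps g h)
  show "q_map p d (\<xi> g) (\<xi> h) = tensor_scale (\<chi> g * \<chi> h) (\<xi> (col h g) \<boxtimes> \<xi> (dot g h)) +
      (tensor_scale \<mu> (\<iota> (col h g \<otimes> a) \<boxtimes> \<iota> (dot g h)) - tensor_scale \<mu> (\<iota> (col h g) \<boxtimes> \<iota> (dot g h \<otimes> a)))"
    unfolding q_map_def outer[OF g] by (simp add: inner simps g h mult.commute)
qed

lemma tensor_square_bilinear:
  "bilinear_map tensor_scale tensor_scale tensor_scale
    (tensor tensor_scale tensor_scale :: ('h, 'h, 'k) tensor \<Rightarrow> ('h, 'h, 'k) tensor \<Rightarrow> _)"
  by (intro tensor_bilinear vector_space_tensor_scale)

text \<open>
  Both sides have the form of an iterated Sweedler sum over \<open>u\<close> and \<open>v\<close>, on the left of the bilinear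
  map \<open>K\<close> which interleaves the coproducts of its two arguments.
\<close>
lemma q_map_comult:
  "tensor_comult cop \<Delta> (q_map p d u v) =
    sw u (\<lambda>u1 u2. sw v (\<lambda>v1 v2.
      tensor tensor_scale tensor_scale (q_map p d u1 v2) (q_map p d u2 v1)))"
proof -
  let ?T = "tensor tensor_scale tensor_scale :: ('h, 'h, 'k) tensor \<Rightarrow> ('h, 'h, 'k) tensor \<Rightarrow> _"
  note T = tensor_square_bilinear
  note rules = op_rules linear_bilinear_left[OF T] linear_bilinear_right[OF T]
    linear_bilinear_left[OF q_map_bilinear] linear_bilinear_right[OF q_map_bilinear]
  define K where "K y z = sw y (\<lambda>y1 y2. sw z (\<lambda>z1 z2. ?T (y2 \<boxtimes> z1) (y1 \<boxtimes> z2)))" for y z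
  have K: "bilinear_map scale scale tensor_scale K"
    unfolding K_def by (intro rules)
  have K_bil: "bilinear_map scale scale tensor_scale (\<lambda>z1 z2. ?T (y2 \<boxtimes> z1) (y1 \<boxtimes> z2))"
    "bilinear_map scale scale tensor_scale
      (\<lambda>y1 y2. sw z (\<lambda>z1 z2. ?T (y2 \<boxtimes> z1) (y1 \<boxtimes> z2)))" for y1 y2 z
    by (intro rules)+
  have K_basis: "K (\<iota> g) (\<iota> h) = ?T (\<iota> g \<boxtimes> \<iota> h) (\<iota> g \<boxtimes> \<iota> h)"
    "K (\<iota> g) (\<xi> h) = ?T (\<iota> g \<boxtimes> \<xi> h) (\<iota> g \<boxtimes> \<iota> (h \<otimes> a)) + ?T (\<iota> g \<boxtimes> \<iota> h) (\<iota> g \<boxtimes> \<xi> h)"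
    "K (\<xi> g) (\<iota> h) = ?T (\<iota> (g \<otimes> a) \<boxtimes> \<iota> h) (\<xi> g \<boxtimes> \<iota> h) + ?T (\<xi> g \<boxtimes> \<iota> h) (\<iota> g \<boxtimes> \<iota> h)"
    "K (\<xi> g) (\<xi> h) = ?T (\<iota> (g \<otimes> a) \<boxtimes> \<xi> h) (\<xi> g \<boxtimes> \<iota> (h \<otimes> a)) + ?T (\<iota> (g \<otimes> a) \<boxtimes> \<iota> h) (\<xi> g \<boxtimes> \<xi> h) +
      (?T (\<xi> g \<boxtimes> \<xi> h) (\<iota> g \<boxtimes> \<iota> (h \<otimes> a)) + ?T (\<xi> g \<boxtimes> \<iota> h) (\<iota> g \<boxtimes> \<xi> h))"
    if "g \<in> carrier G" "h \<in> carrier G" for g h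
    unfolding K_def K_bil(2)[THEN sw_iota, OF that(1)] K_bil(2)[THEN sw_\<xi>, OF that(1)]
    by (simp_all only: K_bil(1)[THEN sw_iota, OF that(2)] K_bil(1)[THEN sw_\<xi>, OF that(2)])
  have L: "bilinear_map scale scale tensor_scale (\<lambda>v1 v2. K (d v1 u2) (p u1 v2))"
    "bilinear_map scale scale tensor_scale (\<lambda>u1 u2. sw v (\<lambda>v1 v2. K (d v1 u2) (p u1 v2)))"
    "bilinear_map scale scale tensor_scale (\<lambda>u v. sw u (\<lambda>u1 u2. sw v (\<lambda>v1 v2. K (d v1 u2) (p u1 v2))))"
    for u1 u2 v
    by (intro rules linear_bilinear_left[OF K] linear_bilinear_right[OF K])+
  have R: "bilinear_map scale scale tensor_scale (\<lambda>v1 v2. ?T (q_map p d u1 v2) (q_map p d u2 v1))"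
    "bilinear_map scale scale tensor_scale (\<lambda>u1 u2. sw v (\<lambda>v1 v2. ?T (q_map p d u1 v2) (q_map p d u2 v1)))"
    "bilinear_map scale scale tensor_scale
      (\<lambda>u v. sw u (\<lambda>u1 u2. sw v (\<lambda>v1 v2. ?T (q_map p d u1 v2) (q_map p d u2 v1))))"
    for u1 u2 v
    by (intro rules)+
  note outer = L(2)[THEN sw_iota] L(2)[THEN sw_\<xi>] R(2)[THEN sw_iota] R(2)[THEN sw_\<xi>]
    and inner = L(1)[THEN sw_iota] L(1)[THEN sw_\<xi>] R(1)[THEN sw_iota] R(1)[THEN sw_\<xi>]
  note simps = operations q_map_basis closed a_closed brace_mult_a char_mult char_a char_square char_square_cancel
    K_basis linear_simps[OF bilinear_map_linear(1)[OF K]] linear_simps[OF bilinear_map_linear(2)[OF K]]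
    linear_simps[OF bilinear_map_linear(1)[OF T]] linear_simps[OF bilinear_map_linear(2)[OF T]]
    tensor_scale_simps mult_ac
  have "sw u (\<lambda>u1 u2. sw v (\<lambda>v1 v2. K (d v1 u2) (p u1 v2))) =
      sw u (\<lambda>u1 u2. sw v (\<lambda>v1 v2. ?T (q_map p d u1 v2) (q_map p d u2 v1)))"
  proof (rule bilinear_ext[OF L(3) R(3)])
    fix u v
    assume "u \<in> \<iota> ` carrier G \<union> \<xi> ` carrier G" "v \<in> \<iota> ` carrier G \<union> \<xi> ` carrier G"
    then show "sw u (\<lambda>u1 u2. sw v (\<lambda>v1 v2. K (d v1 u2) (p u1 v2))) =
        sw u (\<lambda>u1 u2. sw v (\<lambda>v1 v2. ?T (q_map p d u1 v2) (q_map p d u2 v1)))"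
      by (elim UnE imageE; simp only: outer; simp add: inner simps)
  qed
  then show ?thesis
    unfolding tensor_comult_q_map[OF p_bilinear d_bilinear] K_def .
qed

lemma q_map_counit: "tensor_counit (q_map p d u v) = \<epsilon> u * \<epsilon> v"
proof -
  have \<epsilon>: "bilinear_map scale scale (*) (\<lambda>u v. \<epsilon> u * \<epsilon> v)"
    by (intro op_rules counit_linear)
  have bil: "bilinear_map scale scale tensor_scale (\<lambda>v1 v2. d v1 u2 \<boxtimes> p u1 v2)"
    "bilinear_map scale scale tensor_scale (\<lambda>u1 u2. sw v (\<lambda>v1 v2. d v1 u2 \<boxtimes> p u1 v2))" for u1 u2 v
    by (intro op_rules)+
  have counit: "sw h (\<lambda>a b. \<epsilon> a * F b) = F h" "sw h (\<lambda>a b. \<epsilon> b * F a) = F h" if "lin_form F" for F h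
    using that by (intro sw_counit_left sw_counit_right; assumption)+
  have v: "sw v (\<lambda>v1 v2. (\<epsilon> v1 * \<epsilon> u2) * (\<epsilon> u1 * \<epsilon> v2)) = \<epsilon> u1 * (\<epsilon> u2 * \<epsilon> v)" for u1 u2
  proof -
    have "sw v (\<lambda>v1 v2. \<epsilon> v1 * (\<epsilon> u1 * (\<epsilon> u2 * \<epsilon> v2))) = \<epsilon> u1 * (\<epsilon> u2 * \<epsilon> v)"
      by (rule counit) (intro op_rules counit_linear)
    then show ?thesis by (simp add: mult_ac)
  qed
  have inner: "tensor_lift scale scale (\<lambda>u v. \<epsilon> u * \<epsilon> v) (sw v (\<lambda>v1 v2. d v1 u2 \<boxtimes> p u1 v2)) =
      \<epsilon> u1 * (\<epsilon> u2 * \<epsilon> v)" for u1 u2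
    by (subst tensor_lift_sw[OF \<epsilon> bil(1)])
      (simp_all add: tensor_in_tensor_space tensor_lift_tensor[OF \<epsilon>] counit_operations v,
        intro op_rules counit_linear)
  have "tensor_counit (q_map p d u v) = sw u (\<lambda>u1 u2. \<epsilon> u1 * (\<epsilon> u2 * \<epsilon> v))"
    unfolding tensor_counit_def q_map_def
    by (subst tensor_lift_sw[OF \<epsilon> bil(2)])
      (simp_all add: inner sw_in_tensor_space[OF bil(1)] tensor_in_tensor_space,
        intro op_rules counit_linear)
  also have "\<dots> = \<epsilon> u * \<epsilon> v"
    by (rule counit) (intro op_rules counit_linear)
  finally show ?thesis .
qed

lemma q_magma: "q_magma_coalgebra p d"
  unfolding q_magma_coalgebra_def
  using coalgebra_axioms p_bilinear d_bilinear counit_operations q_map_comult q_map_counit by blast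

lemma operations_one: "p h 1 = h" "d h 1 = h"
proof -
  note simps = operations[OF _ one_closed, unfolded iota_one] B.dot_one B.col_one char_one
  have lin: "Vector_Spaces.linear scale scale (\<lambda>h. p h 1)" "Vector_Spaces.linear scale scale (\<lambda>h. d h 1)"
    "Vector_Spaces.linear scale scale (\<lambda>h. h)"
    by (intro op_rules)+
  show "p h 1 = h"
    by (rule linear_ext_two[OF order_two lin(1,3)]) (simp_all add: simps)
  show "d h 1 = h"
    by (rule linear_ext_two[OF order_two lin(2,3)]) (simp_all add: simps)
qed

theorem hopf_q_brace: "hopf_q_brace scale \<Delta> \<epsilon> p d"
proof (intro hopf_q_brace.intro hopf_algebra_axioms hopf_q_brace_axioms.intro)
  show "q_cycle_coalgebra p d"
    unfolding q_cycle_coalgebra_def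
    using q_magma left_regular_module[OF order_two p_bilinear operations_one(1) p_module]
      cycle_1 cycle_2 cycle_3 by blast
  show "right_regular d"
    by (rule right_regular_module[OF order_two d_bilinear operations_one(2) d_module])
qed (fact operations_one p_module d_module mult_p mult_d)+

end

context rank_one_hopf_algebra
begin

lemma star_operations_exist:
  assumes adm: "admissible_q_brace G \<chi> a dot col"
  shows "\<exists>p d. star_operations G \<chi> a \<alpha> scale \<Delta> \<epsilon> \<iota> x dot col \<mu> p d"
proof -
  \<comment> \<open>The prescribed value on \<open>g x\<^sup>i\<close> and \<open>h x\<^sup>j\<close>\<close>
  define t where "t op \<nu> g i h j =
    (if j = 0 then if i = 0 then \<iota> (op g h) else scale (\<chi> h) (\<iota> (op g h) * x)
     else if i = 0 then 0 else scale \<nu> (\<iota> (op g h) * (1 - \<iota> a)))" 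
    for op :: "'g \<Rightarrow> 'g \<Rightarrow> 'g" and \<nu> g h and i j :: nat
  obtain p where p: "bilinear_map scale scale scale p"
    "\<And>g h i j. \<lbrakk>g \<in> carrier G; h \<in> carrier G; i < n; j < n\<rbrakk> \<Longrightarrow>
      p (\<iota> g * x ^ i) (\<iota> h * x ^ j) = t dot \<mu> g i h j"
    using bilinear_extension[of "t dot \<mu>"] by blast
  obtain d where d: "bilinear_map scale scale scale d"
    "\<And>g h i j. \<lbrakk>g \<in> carrier G; h \<in> carrier G; i < n; j < n\<rbrakk> \<Longrightarrow>
      d (\<iota> g * x ^ i) (\<iota> h * x ^ j) = t col (- \<mu>) g i h j"
    using bilinear_extension[of "t col (- \<mu>)"] by blast
  note P = p(2)[of _ _ 0 0] p(2)[of _ _ 0 1] p(2)[of _ _ 1 0] p(2)[of _ _ 1 1]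
    and D = d(2)[of _ _ 0 0] d(2)[of _ _ 0 1] d(2)[of _ _ 1 0] d(2)[of _ _ 1 1]
  have "restricts_to G \<iota> p dot" "restricts_to G \<iota> d col"
    using P D n_pos by (simp_all add: restricts_to_def t_def)
  moreover have "star_formulas G \<chi> a scale \<iota> x dot col \<mu> p d"
    using P D n_pos order_gt_1 by (simp add: star_formulas_def t_def scale_minus_left)
  ultimately show ?thesis
    using adm p(1) d(1) rank_one_hopf_algebra_axioms
    by (intro exI[of _ p] exI[of _ d])
      (simp add: star_operations_def star_operations_axioms_def)
qed

text \<open>
  The formulas prescribe both operations on all pairs of basis elements.
\<close>
lemma star_operations_unique:
  assumes 1: "star_operations G \<chi> a \<alpha> scale \<Delta> \<epsilon> \<iota> x dot col \<mu> p d"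
    and 2: "star_operations G \<chi> a \<alpha> scale \<Delta> \<epsilon> \<iota> x dot col \<mu> p' d'"
  shows "p = p'" "d = d'"
proof -
  interpret A: star_operations G \<chi> a \<alpha> scale \<Delta> \<epsilon> \<iota> x dot col \<mu> p d by fact
  interpret B: star_operations G \<chi> a \<alpha> scale \<Delta> \<epsilon> \<iota> x dot col \<mu> p' d' by fact
  have "p u v = p' u v" for u v
    by (rule A.bilinear_ext[OF A.p_bilinear B.p_bilinear])
      (elim UnE imageE; simp add: A.operations B.operations)
  then show "p = p'" by (intro ext)
  have "d u v = d' u v" for u v
    by (rule A.bilinear_ext[OF A.d_bilinear B.d_bilinear])
      (elim UnE imageE; simp add: A.operations B.operations)
  then show "d = d'" by (intro ext)
qed

end

section \<open>The correspondence\<close>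

theorem theorem3p9:
  fixes G :: "('g, 'm) monoid_scheme"
    and \<chi> :: "'g \<Rightarrow> 'k::{alg_closed_field, field_char_0}"
    and a :: 'g and \<alpha> :: 'k and n :: nat
    and scale :: "'k \<Rightarrow> 'h::ring_1 \<Rightarrow> 'h"
    and \<Delta> :: "'h \<Rightarrow> ('h, 'h, 'k) tensor" and \<epsilon> :: "'h \<Rightarrow> 'k"
    and \<iota> :: "'g \<Rightarrow> 'h" and x :: 'h
  assumes datum: "rank_one_datum G \<chi> a \<alpha>"
    and n: "n = mult_order (\<chi> a)"
    and H: "rank_one_hopf_algebra G \<chi> a \<alpha> scale \<Delta> \<epsilon> \<iota> x"
  shows
    "(\<forall>p d. hopf_q_brace scale \<Delta> \<epsilon> p d \<and> p x x \<noteq> 0 \<and> d x x \<noteq> 0 \<longrightarrow>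
        n = 2 \<and>
        (\<exists>dot col. restricts_to G \<iota> p dot \<and> restricts_to G \<iota> d col \<and>
           admissible_q_brace G \<chi> a dot col \<and>
           (\<exists>\<mu>. \<mu> \<noteq> 0 \<and> star_formulas G \<chi> a scale \<iota> x dot col \<mu> p d)))
     \<and>
     (\<forall>dot col. admissible_q_brace G \<chi> a dot col \<longrightarrow>
        (\<forall>\<mu>. \<mu> \<noteq> 0 \<longrightarrow>
           (\<exists>!(p, d).
              bilinear_map scale scale scale p \<and> bilinear_map scale scale scale d \<and>
              restricts_to G \<iota> p dot \<and> restricts_to G \<iota> d col \<and>
              star_formulas G \<chi> a scale \<iota> x dot col \<mu> p d) \<and>
           (\<forall>p d.
              bilinear_map scale scale scale p \<and> bilinear_map scale scale scale d \<and>
              restricts_to G \<iota> p dot \<and> restricts_to G \<iota> d col \<and>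
              star_formulas G \<chi> a scale \<iota> x dot col \<mu> p d \<longrightarrow>
              hopf_q_brace scale \<Delta> \<epsilon> p d)))"
proof -
  interpret rank_one_hopf_algebra G \<chi> a \<alpha> scale \<Delta> \<epsilon> \<iota> x by (rule H)
  have star: "star_operations G \<chi> a \<alpha> scale \<Delta> \<epsilon> \<iota> x dot col \<mu> p d \<longleftrightarrow>
      bilinear_map scale scale scale p \<and> bilinear_map scale scale scale d \<and>
      restricts_to G \<iota> p dot \<and> restricts_to G \<iota> d col \<and>
      star_formulas G \<chi> a scale \<iota> x dot col \<mu> p d"
    if "admissible_q_brace G \<chi> a dot col" for dot col \<mu> p d
    using that H by (simp add: star_operations_def star_operations_axioms_def)
  show ?thesis
  proof (intro conjI allI impI)
    fix p d assume "hopf_q_brace scale \<Delta> \<epsilon> p d \<and> p x x \<noteq> 0 \<and> d x x \<noteq> 0"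
    with hopf_q_brace_restriction[of p d] n
    show "n = 2" "\<exists>dot col. restricts_to G \<iota> p dot \<and> restricts_to G \<iota> d col \<and>
        admissible_q_brace G \<chi> a dot col \<and>
        (\<exists>\<mu>. \<mu> \<noteq> 0 \<and> star_formulas G \<chi> a scale \<iota> x dot col \<mu> p d)"
      by simp_all
  next
    fix dot col and \<mu> :: 'k assume adm: "admissible_q_brace G \<chi> a dot col"
    obtain p d where pd: "star_operations G \<chi> a \<alpha> scale \<Delta> \<epsilon> \<iota> x dot col \<mu> p d"
      using star_operations_exist[OF adm] by blast
    have "\<exists>!(p, d). star_operations G \<chi> a \<alpha> scale \<Delta> \<epsilon> \<iota> x dot col \<mu> p d"
    proof (rule ex1I[of _ "(p, d)"])
      fix z assume z: "case z of (p, d) \<Rightarrow> star_operations G \<chi> a \<alpha> scale \<Delta> \<epsilon> \<iota> x dot col \<mu> p d"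
      obtain p' d' where "z = (p', d')" by (cases z)
      then show "z = (p, d)" using z star_operations_unique[OF _ pd, of p' d'] by simp
    qed (simp add: pd)
    then show "\<exists>!(p, d).
        bilinear_map scale scale scale p \<and> bilinear_map scale scale scale d \<and>
        restricts_to G \<iota> p dot \<and> restricts_to G \<iota> d col \<and>
        star_formulas G \<chi> a scale \<iota> x dot col \<mu> p d"
      by (simp only: star[OF adm])
  next
    fix dot col and \<mu> :: 'k and p d assume adm: "admissible_q_brace G \<chi> a dot col"
      and "bilinear_map scale scale scale p \<and> bilinear_map scale scale scale d \<and>
        restricts_to G \<iota> p dot \<and> restricts_to G \<iota> d col \<and>
        star_formulas G \<chi> a scale \<iota> x dot col \<mu> p d"
    then have "star_operations G \<chi> a \<alpha> scale \<Delta> \<epsilon> \<iota> x dot col \<mu> p d"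
      using star by blast
    then show "hopf_q_brace scale \<Delta> \<epsilon> p d"
      by (rule star_operations.hopf_q_brace)
  qed
qed

end
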